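(* The theory $\mathrm{RCA}_0^{\Omega}$ proves $\mathrm{MUC}\leftrightarrow\mathrm{MUC}^{\mathrm{st}}\leftrightarrow\mathfrak{P}$, where $\mathfrak{P}$ is the statement $$(\forall^{\mathrm{st}}\varphi^{2})(\exists^{\mathrm{st}}x^{0})(\forall f^{1},g^{1}\leq_{1}1)\big[\overline{f}x=_{0}\overline{g}x\to\varphi(f)=_{0}\varphi(g)\big].$$
   Context: BASE THEORY. Finite types: $0$ (natural numbers), $\sigma\to\tau$, and $\sigma^{*}$ (finite sequences of objects of type $\sigma$); $1=0\to 0$, $2=1\to 0$, $3=2\to 0$. Superscripts indicate types; tuples are coded as single objects where convenient. Equality $=_0$ is primitive; for $\tau=\tau_1\to\dots\to\tau_k\to 0$, $x=_\tau y$ means $(\forall z_1\dots z_k)(xz_1\dots z_k=_0 yz_1\dots z_k)$. $\mathrm{RCA}_0^{\omega}$ is Kohlenbach's higher-order base theory: classical arithmetic in all finite types with combinators, zero, successor, the recursor $R_0$ (primitive recursion with type $0$ values), quantifier-free induction, extensionality $x=_\rho y\to\varphi(x)=_\tau\varphi(y)$ for all $\varphi^{\rho\to\tau}$, and $\mathrm{QF\text{-}AC}^{1,0}$, where $\mathrm{QF\text{-}AC}^{\sigma,\tau}$ is $(\forall x^\sigma)(\exists y^\tau)A_0(x,y)\to(\exists F^{\sigma\to\tau})(\forall x)A_0(x,F(x))$ for quantifier-free $A_0$. $\mathrm{RCA}_0^{\Omega}$ extends $\mathrm{RCA}_0^{\omega}$ (with the types $\sigma^*$) by a predicate $\mathrm{st}$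 ("is standard") for each type. A formula is internal if it does not contain $\mathrm{st}$; $(\forall^{\mathrm{st}}x)A$ is $(\forall x)(\mathrm{st}(x)\to A)$, $(\exists^{\mathrm{st}}x)A$ is $(\exists x)(\mathrm{st}(x)\wedge A)$; $N\in\Omega$ means $\neg\mathrm{st}(N^0)$; $A^{\mathrm{st}}$ is $A$ with all quantifiers (except bounded number quantifiers) relativised to $\mathrm{st}$. Axioms: (i) standardness respects equality, closed terms are standard, a standard functional applied to a standard object is standard, and numbers below a standard number are standard; (ii) Idealization: $(\forall^{\mathrm{st}}x^{\sigma^*})(\exists y^\tau)(\forall z\in x)\varphi(z,y)\to(\exists y)(\forall^{\mathrm{st}}z^{\sigma})\varphi(z,y)$ for internal $\varphi$; (iii) $\mathrm{HAC}_{\mathrm{int}}$: $(\forall^{\mathrm{st}}x^{\rho})(\exists^{\mathrm{st}}y^{\tau})\varphi(x,y)\to(\exists^{\mathrm{st}}\Phi^{\rho\to\tau^*})(\forall^{\mathrm{st}}x)(\exists y\in\Phi(x))\varphi(x,y)$ for internal $\varphi$; (iv) $\mathrm{PF\text{-}TP}_\forall$: $(\forall^{\mathrm{st}}x^\tau)\varphi(x)\to(\forall x^\tau)\varphi(x)$ for internal $\varphi(x)$ with no parameters other than $x$; (v) for certain functionals uniquely specified by a parameter-free internal formula, constants with axioms expressing their uniqueness and standardness; these constants do not count as parameters in (iv). In particular there is a constant $\Omega_0^3$ with the axiom $$\mathrm{st}(\Omega_0)\wedge(\forall^{\mathrm{st}}\Xi^3)\big[M^{\mathrm{st}}(\Xi)\to(\forall^{\mathrm{st}}\varphi^2)(\Omega_0(\varphi)=\Xi(\varphi))\big],$$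 where $M(\Omega)$ is the universal formula $(\forall\varphi^2)(\forall f,g\leq_11)[\overline{f}(\Omega(\varphi))=_0\overline{g}(\Omega(\varphi))\to\varphi(f)=_0\varphi(g)]$ together with the requirement that $\Omega(\varphi)$ is minimal. NOTATION. $f\leq_11$ means $f^1$ is a $0$-$1$ sequence; $\overline{f}n$ is the (code of the) initial segment of $f$ of length $n$. PRINCIPLE $\mathrm{MUC}$ (existence of the fan functional): $(\exists\Omega^3)(\forall\varphi^2)(\forall f^1,g^1\leq_11)[\overline{f}(\Omega(\varphi))=_0\overline{g}(\Omega(\varphi))\to\varphi(f)=_0\varphi(g)]$. *)

theory Defs
  imports Main
begin

section \<open>Syntax\<close>

datatype ty = N | Fn ty ty (infixr "\<rightarrow>" 60) | Sq ty

abbreviation T1 :: ty where "T1 \<equiv> N \<rightarrow> N"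
abbreviation T2 :: ty where "T2 \<equiv> T1 \<rightarrow> N"
abbreviation T3 :: ty where "T3 \<equiv> T2 \<rightarrow> N"

type_synonym var = "nat \<times> ty"

text \<open>
  Finite sequences are presented by \<open>Len\<close> (length), \<open>Proj\<close> (\<open>i\<close>-th entry) and \<open>Tab\<close>,
  where \<open>Tab f n\<close> is the sequence of \<open>f 0, \<dots>, f (n - 1)\<close>. \<open>Rec\<close> is the recursor \<open>R_0\<close>.
  \<open>Spec k \<tau>\<close> are the constants for functionals of type \<open>\<tau>\<close> that are specified by internal
  formulas other than the one for \<open>Omega0\<close>; a theory says which of them it has (type \<open>specs\<close>).
\<close>

datatype const =
    Zero | Succ | Rec
  | K ty ty | S ty ty ty
  | Len ty | Proj ty | Tab ty
  | Omega0 | Spec nat ty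

datatype tm = V var | C const | App tm tm (infixl "\<cdot>" 200)

fun const_ty :: "const \<Rightarrow> ty" where
  "const_ty Zero = N"
| "const_ty Succ = N \<rightarrow> N"
| "const_ty Rec = N \<rightarrow> N \<rightarrow> (N \<rightarrow> N \<rightarrow> N) \<rightarrow> N"
| "const_ty (K \<sigma> \<tau>) = \<sigma> \<rightarrow> \<tau> \<rightarrow> \<sigma>"
| "const_ty (S \<rho> \<sigma> \<tau>) = (\<rho> \<rightarrow> \<sigma> \<rightarrow> \<tau>) \<rightarrow> (\<rho> \<rightarrow> \<sigma>) \<rightarrow> \<rho> \<rightarrow> \<tau>"
| "const_ty (Len \<sigma>) = Sq \<sigma> \<rightarrow> N"
| "const_ty (Proj \<sigma>) = Sq \<sigma> \<rightarrow> N \<rightarrow> \<sigma>"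
| "const_ty (Tab \<sigma>) = (N \<rightarrow> \<sigma>) \<rightarrow> N \<rightarrow> Sq \<sigma>"
| "const_ty Omega0 = T3"
| "const_ty (Spec k \<tau>) = \<tau>"

text \<open>The value of \<open>ty_of\<close> is meaningful on well-typed terms only.\<close>

fun ty_of :: "tm \<Rightarrow> ty" where
  "ty_of (V x) = snd x"
| "ty_of (C c) = const_ty c"
| "ty_of (s \<cdot> t) = (case ty_of s of \<sigma> \<rightarrow> \<tau> \<Rightarrow> \<tau> | _ \<Rightarrow> N)"

datatype fm =
    Eq tm tm
  | St tm
  | Bot
  | Imp fm fm
  | All var fm

text \<open>\<open>D (k, \<tau>) = Some A\<close>: the constant \<open>Spec k \<tau>\<close> is present, specified by \<open>A\<close> as a property
  of the variable \<open>(0, \<tau>)\<close>.\<close>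

type_synonym specs = "nat \<times> ty \<Rightarrow> fm option"

fun wt :: "specs \<Rightarrow> tm \<Rightarrow> bool" where
  "wt D (V x) \<longleftrightarrow> True"
| "wt D (C (Spec k \<tau>)) \<longleftrightarrow> D (k, \<tau>) \<noteq> None"
| "wt D (C c) \<longleftrightarrow> True"
| "wt D (s \<cdot> t) \<longleftrightarrow> wt D s \<and> wt D t \<and> (\<exists>\<tau>. ty_of s = (ty_of t \<rightarrow> \<tau>))"

text \<open>\<open>Eq\<close> is equality of natural numbers; \<open>St t\<close> is the standardness predicate of the type of \<open>t\<close>.\<close>

fun wff :: "specs \<Rightarrow> fm \<Rightarrow> bool" where
  "wff D (Eq s t) \<longleftrightarrow> wt D s \<and> wt D t \<and> ty_of s = N \<and> ty_of t = N"
| "wff D (St t) \<longleftrightarrow> wt D t"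
| "wff D Bot \<longleftrightarrow> True"
| "wff D (Imp A B) \<longleftrightarrow> wff D A \<and> wff D B"
| "wff D (All x A) \<longleftrightarrow> wff D A"

definition Neg :: "fm \<Rightarrow> fm" where "Neg A = Imp A Bot"
definition And :: "fm \<Rightarrow> fm \<Rightarrow> fm" where "And A B = Neg (Imp A (Neg B))"
definition Iff :: "fm \<Rightarrow> fm \<Rightarrow> fm" where "Iff A B = And (Imp A B) (Imp B A)"
definition Ex :: "var \<Rightarrow> fm \<Rightarrow> fm" where "Ex x A = Neg (All x (Neg A))"
definition AllSt :: "var \<Rightarrow> fm \<Rightarrow> fm" where "AllSt x A = All x (Imp (St (V x)) A)"
definition ExSt :: "var \<Rightarrow> fm \<Rightarrow> fm" where "ExSt x A = Ex x (And (St (V x)) A)"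

fun fvt :: "tm \<Rightarrow> var set" where
  "fvt (V x) = {x}"
| "fvt (C c) = {}"
| "fvt (s \<cdot> t) = fvt s \<union> fvt t"

fun fv :: "fm \<Rightarrow> var set" where
  "fv (Eq s t) = fvt s \<union> fvt t"
| "fv (St t) = fvt t"
| "fv Bot = {}"
| "fv (Imp A B) = fv A \<union> fv B"
| "fv (All x A) = fv A - {x}"

fun substt :: "var \<Rightarrow> tm \<Rightarrow> tm \<Rightarrow> tm" where
  "substt x u (V y) = (if x = y then u else V y)"
| "substt x u (C c) = C c"
| "substt x u (s \<cdot> t) = substt x u s \<cdot> substt x u t"

text \<open>Substitution does not rename bound variables; it is used under \<open>free_for\<close> or on
  quantifier-free formulas.\<close>

fun subst :: "var \<Rightarrow> tm \<Rightarrow> fm \<Rightarrow> fm" where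
  "subst x u (Eq s t) = Eq (substt x u s) (substt x u t)"
| "subst x u (St t) = St (substt x u t)"
| "subst x u Bot = Bot"
| "subst x u (Imp A B) = Imp (subst x u A) (subst x u B)"
| "subst x u (All y A) = (if x = y then All y A else All y (subst x u A))"

fun free_for :: "tm \<Rightarrow> var \<Rightarrow> fm \<Rightarrow> bool" where
  "free_for u x (Imp A B) \<longleftrightarrow> free_for u x A \<and> free_for u x B"
| "free_for u x (All y A) \<longleftrightarrow> x \<notin> fv (All y A) \<or> (y \<notin> fvt u \<and> free_for u x A)"
| "free_for u x _ \<longleftrightarrow> True"

fun internal :: "fm \<Rightarrow> bool" where
  "internal (Eq s t) \<longleftrightarrow> True"
| "internal (St t) \<longleftrightarrow> False"
| "internal Bot \<longleftrightarrow> True"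
| "internal (Imp A B) \<longleftrightarrow> internal A \<and> internal B"
| "internal (All x A) \<longleftrightarrow> internal A"

fun quantifier_free :: "fm \<Rightarrow> bool" where
  "quantifier_free (Eq s t) \<longleftrightarrow> True"
| "quantifier_free (St t) \<longleftrightarrow> False"
| "quantifier_free Bot \<longleftrightarrow> True"
| "quantifier_free (Imp A B) \<longleftrightarrow> quantifier_free A \<and> quantifier_free B"
| "quantifier_free (All x A) \<longleftrightarrow> False"


section \<open>Arithmetical terms\<close>

text \<open>Bracket abstraction: \<open>lam x t\<close> is a combinatory term for the function mapping \<open>x\<close> to \<open>t\<close>.\<close>

fun lam :: "var \<Rightarrow> tm \<Rightarrow> tm" where
  "lam x (V y) = (if x = y
     then C (S (snd x) (snd x \<rightarrow> snd x) (snd x)) \<cdot> C (K (snd x) (snd x \<rightarrow> snd x)) \<cdot> C (K (snd x) (snd x))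
     else C (K (snd y) (snd x)) \<cdot> V y)"
| "lam x (C c) = C (K (const_ty c) (snd x)) \<cdot> C c"
| "lam x (s \<cdot> t) = (if x \<in> fvt (s \<cdot> t)
     then C (S (snd x) (ty_of t) (ty_of (s \<cdot> t))) \<cdot> lam x s \<cdot> lam x t
     else C (K (ty_of (s \<cdot> t)) (snd x)) \<cdot> (s \<cdot> t))"

abbreviation zero :: tm where "zero \<equiv> C Zero"
abbreviation suc :: "tm \<Rightarrow> tm" where "suc t \<equiv> C Succ \<cdot> t"

text \<open>\<open>Rec n b h\<close> is iterated in its first argument: \<open>Rec (n + 1) b h = h (Rec n b h) n\<close>.\<close>

definition rec :: "tm \<Rightarrow> tm \<Rightarrow> tm \<Rightarrow> tm" where "rec n b h = C Rec \<cdot> n \<cdot> b \<cdot> h"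

definition predT :: tm where
  "predT = (let n = (0, N); r = (1, N); k = (2, N) in
     lam n (rec (V n) zero (lam r (lam k (V k)))))"

definition monusT :: tm where
  "monusT = (let m = (0, N); n = (1, N); r = (2, N); k = (3, N) in
     lam m (lam n (rec (V n) (V m) (lam r (lam k (predT \<cdot> V r))))))"

definition plusT :: tm where
  "plusT = (let m = (0, N); n = (1, N); r = (2, N); k = (3, N) in
     lam m (lam n (rec (V n) (V m) (lam r (lam k (suc (V r)))))))"

text \<open>Triangular numbers and the Cantor pairing function.\<close>

definition triT :: tm where
  "triT = (let n = (0, N); r = (1, N); k = (2, N) in
     lam n (rec (V n) zero (lam r (lam k (plusT \<cdot> V r \<cdot> suc (V k))))))"

definition pairT :: tm where
  "pairT = (let m = (0, N); n = (1, N) in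
     lam m (lam n (plusT \<cdot> (triT \<cdot> (plusT \<cdot> V m \<cdot> V n)) \<cdot> V n)))"

text \<open>The code of the initial segment of \<open>f\<close> of length \<open>n\<close>: the code of the empty sequence is \<open>0\<close>,
  that of \<open>c\<close> extended by \<open>a\<close> is \<open>pair c a + 1\<close>.\<close>

definition segT :: tm where
  "segT = (let f = (0, T1); n = (1, N); r = (2, N); k = (3, N) in
     lam f (lam n (rec (V n) zero (lam r (lam k (suc (pairT \<cdot> V r \<cdot> (V f \<cdot> V k))))))))"

definition seg :: "tm \<Rightarrow> tm \<Rightarrow> tm" where "seg f n = segT \<cdot> f \<cdot> n"

definition leq :: "tm \<Rightarrow> tm \<Rightarrow> fm" where "leq s t = Eq (monusT \<cdot> s \<cdot> t) zero"
definition lt :: "tm \<Rightarrow> tm \<Rightarrow> fm" where "lt s t = leq (suc s) t"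


section \<open>Bounded quantifiers, equality at higher types, relativisation\<close>

text \<open>Existential bounded quantifiers are negated universal bounded ones, so that \<open>rel\<close> below
  recognises them as bounded.\<close>

definition BAll :: "var \<Rightarrow> tm \<Rightarrow> fm \<Rightarrow> fm" where "BAll i t A = All i (Imp (lt (V i) t) A)"
definition BEx :: "var \<Rightarrow> tm \<Rightarrow> fm \<Rightarrow> fm" where "BEx i t A = Neg (BAll i t (Neg A))"

fun bound :: "tm \<Rightarrow> nat" where
  "bound (V x) = Suc (fst x)"
| "bound (C c) = 0"
| "bound (s \<cdot> t) = max (bound s) (bound t)"

text \<open>A variable name not occurring in \<open>s\<close> or \<open>t\<close>.\<close>

definition fresh :: "tm \<Rightarrow> tm \<Rightarrow> nat" where "fresh s t = max (bound s) (bound t)"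

fun eqf :: "ty \<Rightarrow> tm \<Rightarrow> tm \<Rightarrow> fm" where
  "eqf N s t = Eq s t"
| "eqf (\<sigma> \<rightarrow> \<tau>) s t = (let z = (fresh s t, \<sigma>) in All z (eqf \<tau> (s \<cdot> V z) (t \<cdot> V z)))"
| "eqf (Sq \<sigma>) s t = (let i = (fresh s t, N) in
     And (Eq (C (Len \<sigma>) \<cdot> s) (C (Len \<sigma>) \<cdot> t))
         (BAll i (C (Len \<sigma>) \<cdot> s) (eqf \<sigma> (C (Proj \<sigma>) \<cdot> s \<cdot> V i) (C (Proj \<sigma>) \<cdot> t \<cdot> V i))))"

definition eq :: "tm \<Rightarrow> tm \<Rightarrow> fm" where "eq s t = eqf (ty_of s) s t"

definition mem :: "tm \<Rightarrow> tm \<Rightarrow> fm" where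
  "mem s t = (let i = (fresh s t, N) in
     BEx i (C (Len (ty_of s)) \<cdot> t) (eq s (C (Proj (ty_of s)) \<cdot> t \<cdot> V i)))"

fun zero_of :: "ty \<Rightarrow> tm" where
  "zero_of N = zero"
| "zero_of (\<sigma> \<rightarrow> \<tau>) = C (K \<tau> \<sigma>) \<cdot> zero_of \<tau>"
| "zero_of (Sq \<sigma>) = C (Tab \<sigma>) \<cdot> (C (K \<sigma> N) \<cdot> zero_of \<sigma>) \<cdot> zero"

definition is_bounded :: "var \<Rightarrow> fm \<Rightarrow> bool" where
  "is_bounded x A \<longleftrightarrow> snd x = N \<and> (\<exists>t B. x \<notin> fvt t \<and> A = Imp (lt (V x) t) B)"

text \<open>\<open>rel A\<close> is the formula \<open>A\<close> with all quantifiers, except the bounded number quantifiers,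
  relativised to \<open>St\<close>.\<close>

primrec rel :: "fm \<Rightarrow> fm" where
  "rel (Eq s t) = Eq s t"
| "rel (St t) = St t"
| "rel Bot = Bot"
| "rel (Imp A B) = Imp (rel A) (rel B)"
| "rel (All x A) = (if is_bounded x A then All x (rel A) else AllSt x (rel A))"


section \<open>The principles\<close>

definition binary :: "tm \<Rightarrow> fm" where
  "binary f = (let i = (bound f, N) in All i (leq (f \<cdot> V i) (suc zero)))"

text \<open>The variables \<open>(2, T1)\<close> and \<open>(3, T1)\<close> must not occur in \<open>\<phi>\<close> and \<open>n\<close>.\<close>

definition modulus :: "tm \<Rightarrow> tm \<Rightarrow> fm" where
  "modulus \<phi> n = (let f = (2, T1); g = (3, T1) in
     All f (All g (Imp (And (binary (V f)) (binary (V g)))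
       (Imp (Eq (seg (V f) n) (seg (V g) n)) (Eq (\<phi> \<cdot> V f) (\<phi> \<cdot> V g))))))"

definition MUC :: fm where
  "MUC = (let \<Omega> = (0, T3); \<phi> = (1, T2) in
     Ex \<Omega> (All \<phi> (modulus (V \<phi>) (V \<Omega> \<cdot> V \<phi>))))"

text \<open>\<open>M\<close>, with free variable \<open>(0, T3)\<close>: a fan functional with least possible values.\<close>

definition M :: fm where
  "M = (let \<Xi> = (0, T3); \<phi> = (1, T2); m = (4, N) in
     All \<phi> (And (modulus (V \<phi>) (V \<Xi> \<cdot> V \<phi>))
                 (All m (Imp (modulus (V \<phi>) (V m)) (leq (V \<Xi> \<cdot> V \<phi>) (V m))))))"

definition \<PP> :: fm where
  "\<PP> = (let \<phi> = (1, T2); x = (4, N) in AllSt \<phi> (ExSt x (modulus (V \<phi>) (V x))))"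


section \<open>The theory\<close>

text \<open>Formulas with free variables stand for their universal closures. Only those instances that
  are well-formed (\<open>wff\<close>) are axioms of the theory; see the rule \<open>ax\<close> below.\<close>

inductive RCA0\<omega>_axiom :: "fm \<Rightarrow> bool" where
  eq_refl: "RCA0\<omega>_axiom (Eq t t)"
| eq_sym: "RCA0\<omega>_axiom (Imp (Eq s t) (Eq t s))"
| eq_trans: "RCA0\<omega>_axiom (Imp (Eq s t) (Imp (Eq t u) (Eq s u)))"
| suc_not_zero: "RCA0\<omega>_axiom (Neg (Eq (suc t) zero))"
| suc_inj: "RCA0\<omega>_axiom (Imp (Eq (suc s) (suc t)) (Eq s t))"
| comb_K: "RCA0\<omega>_axiom (eq (C (K \<sigma> \<tau>) \<cdot> s \<cdot> t) s)"
| comb_S: "RCA0\<omega>_axiom (eq (C (S \<rho> \<sigma> \<tau>) \<cdot> s \<cdot> t \<cdot> u) (s \<cdot> u \<cdot> (t \<cdot> u)))"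
| rec_zero: "RCA0\<omega>_axiom (Eq (rec zero b h) b)"
| rec_suc: "RCA0\<omega>_axiom (Eq (rec (suc n) b h) (h \<cdot> rec n b h \<cdot> n))"
| len_tab: "RCA0\<omega>_axiom (Eq (C (Len \<sigma>) \<cdot> (C (Tab \<sigma>) \<cdot> f \<cdot> n)) n)"
| proj_tab: "RCA0\<omega>_axiom (Imp (lt i n) (eq (C (Proj \<sigma>) \<cdot> (C (Tab \<sigma>) \<cdot> f \<cdot> n) \<cdot> i) (f \<cdot> i)))"
| proj_default: "RCA0\<omega>_axiom
    (Imp (Neg (lt i (C (Len \<sigma>) \<cdot> s))) (eq (C (Proj \<sigma>) \<cdot> s \<cdot> i) (zero_of \<sigma>)))"
| qf_induction: "quantifier_free A \<Longrightarrow> snd n = N \<Longrightarrow>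
    RCA0\<omega>_axiom (Imp (subst n zero A) (Imp (All n (Imp A (subst n (suc (V n)) A))) (All n A)))"
| extensionality: "RCA0\<omega>_axiom (Imp (eq s t) (eq (u \<cdot> s) (u \<cdot> t)))"
| QF_AC_1_0: "quantifier_free A \<Longrightarrow> snd x = T1 \<Longrightarrow> snd y = N \<Longrightarrow> snd F = T1 \<rightarrow> N \<Longrightarrow> F \<notin> fv A \<Longrightarrow>
    RCA0\<omega>_axiom (Imp (All x (Ex y A)) (Ex F (All x (subst y (V F \<cdot> V x) A))))"

text \<open>The clause \<open>PF_TP\<close> has a tuple \<open>xs\<close> of variables, which must contain all free variables of
  the formula.\<close>

inductive RCA0\<Omega>_axiom :: "specs \<Rightarrow> fm \<Rightarrow> bool" for D where
  base: "RCA0\<omega>_axiom A \<Longrightarrow> RCA0\<Omega>_axiom D A"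
| st_eq: "RCA0\<Omega>_axiom D (Imp (And (St s) (eq s t)) (St t))"
| st_closed: "fvt t = {} \<Longrightarrow> RCA0\<Omega>_axiom D (St t)"
| st_app: "RCA0\<Omega>_axiom D (Imp (And (St s) (St t)) (St (s \<cdot> t)))"
| st_below: "RCA0\<Omega>_axiom D (Imp (And (St t) (leq s t)) (St s))"
| idealization: "internal A \<Longrightarrow> snd z = \<sigma> \<Longrightarrow> snd x = Sq \<sigma> \<Longrightarrow> y \<noteq> z \<Longrightarrow> y \<noteq> x \<Longrightarrow> x \<notin> fv A \<Longrightarrow>
    RCA0\<Omega>_axiom D (Imp (AllSt x (Ex y (All z (Imp (mem (V z) (V x)) A)))) (Ex y (AllSt z A)))"
| HAC_int: "internal A \<Longrightarrow> x \<noteq> y \<Longrightarrow> snd F = (snd x \<rightarrow> Sq (snd y)) \<Longrightarrow> F \<notin> fv A \<Longrightarrow>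
    RCA0\<Omega>_axiom D (Imp (AllSt x (ExSt y A))
      (ExSt F (AllSt x (Ex y (And (mem (V y) (V F \<cdot> V x)) A)))))"
| PF_TP: "internal A \<Longrightarrow> fv A \<subseteq> set xs \<Longrightarrow>
    RCA0\<Omega>_axiom D (Imp (foldr AllSt xs A) (foldr All xs A))"
| Omega0: "\<Xi> = (0, T3) \<Longrightarrow> \<phi> = (1, T2) \<Longrightarrow>
    RCA0\<Omega>_axiom D (And (St (C Omega0))
      (AllSt \<Xi> (Imp (rel M) (AllSt \<phi> (Eq (C Omega0 \<cdot> V \<phi>) (V \<Xi> \<cdot> V \<phi>))))))"
| Spec: "D (k, \<tau>) = Some A \<Longrightarrow> \<Xi> = (0, \<tau>) \<Longrightarrow>
    RCA0\<Omega>_axiom D (And (St (C (Spec k \<tau>)))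
      (AllSt \<Xi> (Imp (rel A) (rel (eq (C (Spec k \<tau>)) (V \<Xi>))))))"

text \<open>Admissible families of specified constants. That the formulas specify their objects uniquely
  is asserted by the axiom \<open>Spec\<close> and is not demanded separately.\<close>

definition spec_family :: "specs \<Rightarrow> bool" where
  "spec_family D \<longleftrightarrow>
     (\<forall>k \<tau> A. D (k, \<tau>) = Some A \<longrightarrow> wff D A \<and> internal A \<and> fv A \<subseteq> {(0, \<tau>)})"

text \<open>Classical many-sorted natural deduction over the axioms. The freshness condition of \<open>allI\<close>
  concerns the hypotheses \<open>\<Gamma>\<close> only.\<close>

inductive deriv :: "specs \<Rightarrow> fm set \<Rightarrow> fm \<Rightarrow> bool" for D where
  ax: "RCA0\<Omega>_axiom D A \<Longrightarrow> wff D A \<Longrightarrow> deriv D \<Gamma> A"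
| hyp: "A \<in> \<Gamma> \<Longrightarrow> wff D A \<Longrightarrow> deriv D \<Gamma> A"
| impI: "wff D A \<Longrightarrow> deriv D (insert A \<Gamma>) B \<Longrightarrow> deriv D \<Gamma> (Imp A B)"
| impE: "deriv D \<Gamma> (Imp A B) \<Longrightarrow> deriv D \<Gamma> A \<Longrightarrow> deriv D \<Gamma> B"
| raa: "wff D A \<Longrightarrow> deriv D (insert (Neg A) \<Gamma>) Bot \<Longrightarrow> deriv D \<Gamma> A"
| allI: "deriv D \<Gamma> A \<Longrightarrow> (\<And>B. B \<in> \<Gamma> \<Longrightarrow> x \<notin> fv B) \<Longrightarrow> deriv D \<Gamma> (All x A)"
| allE: "deriv D \<Gamma> (All x A) \<Longrightarrow> wt D t \<Longrightarrow> ty_of t = snd x \<Longrightarrow> free_for t x A \<Longrightarrow>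
    deriv D \<Gamma> (subst x t A)"

definition RCA0\<Omega>_proves :: "specs \<Rightarrow> fm \<Rightarrow> bool" where
  "RCA0\<Omega>_proves D A \<longleftrightarrow> deriv D {} A"

end

theory Submission
  imports Defs "HOL-Library.Countable"
begin

text \<open>
  By a Henkin completeness theorem for \<open>deriv\<close>, it suffices to establish the equivalences in every
  model of the theory; the models are made extensional by a quotient, so that equality at all types
  is identity.

  Transfer (\<open>PF_TP\<close>) makes a fan functional standard, which gives \<open>\<PP>\<close>. From \<open>\<PP>\<close>, \<open>HAC_int\<close> yields a
  standard functional mapping \<open>\<phi>\<close> to a finite sequence containing a modulus of \<open>\<phi>\<close>, and the sum of
  the entries is again a modulus. It remains to pass from functions that are binary to functions that
  are binary at standard arguments; see \<open>\<phi>_sgf\<close>. Finally, given a standard \<open>\<Omega>\<close> as in the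
  relativisation of \<open>MUC\<close>, a search bounded by \<open>\<Omega> \<phi>\<close> through the codes of binary sequences of
  length \<open>\<Omega> \<phi>\<close>, all of which are standard, computes the least modulus. The axiom \<open>Omega0\<close> identifies the
  result with the parameter-free \<open>Omega0\<close> at standard \<open>\<phi>\<close>, so that transfer applies once more.
\<close>

section \<open>Hilbert-style consequences\<close>

text \<open>Transfer admits no parameters, so a standard \<open>\<Omega>\<close> taken from the
  relativised principle cannot itself be transferred. Constants do not count as parameters, but the
  axiom for \<open>Omega0\<close> is of use only once some standard object satisfies the relativised
  \<open>M\<close>, whose minimality clause fixes its values at standard arguments. This is why a
  least modulus has to be computed from \<open>\<Omega>\<close> by a closed term. The computation is
  possible because the relativised notion of modulus sees standard sequences only: such a sequence
  may be replaced by its first \<open>\<Omega> \<phi>\<close> digits, and codes below a standard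
  bound, together with the sequences decoded from them, are standard.

  The passage to sequences that are binary at standard arguments is forced by \<open>rel\<close>:
  the quantifier in \<open>binary\<close> has no bound, so it is relativised. That a standard
  \<open>f\<close> of this kind is binary everywhere is not an instance of transfer, because
  \<open>f\<close> would be a parameter.

  Models replace derivations by ordinary reasoning about elements; the restriction that remains
  visible is induction, which is available for quantifier-free formulas only.\<close>

abbreviation prov :: "specs \<Rightarrow> fm \<Rightarrow> bool" where "prov D \<equiv> deriv D {}"

lemma wt_substt: "wt D t \<Longrightarrow> wt D u \<Longrightarrow> ty_of u = snd x \<Longrightarrow>
    wt D (substt x u t) \<and> ty_of (substt x u t) = ty_of t"
  by (induction t) auto

lemma wff_subst: "wff D A \<Longrightarrow> wt D u \<Longrightarrow> ty_of u = snd x \<Longrightarrow> wff D (subst x u A)"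
  by (induction A) (auto simp: wt_substt)

lemma wff_deriv: "deriv D \<Gamma> A \<Longrightarrow> wff D A"
  by (induction rule: deriv.induct) (auto simp: wff_subst)

lemma prov_mp: "prov D (Imp A B) \<Longrightarrow> prov D A \<Longrightarrow> prov D B"
  by (rule deriv.impE)

lemma wff_Neg [simp]: "wff D (Neg A) \<longleftrightarrow> wff D A"
  and wff_And [simp]: "wff D (And A B) \<longleftrightarrow> wff D A \<and> wff D B"
  by (auto simp: Neg_def And_def)

lemma fv_Neg [simp]: "fv (Neg A) = fv A"
  and fv_And [simp]: "fv (And A B) = fv A \<union> fv B"
  by (auto simp: Neg_def And_def)

section \<open>Propositional laws as theorems in the empty context\<close>

lemma prov_K: "wff D A \<Longrightarrow> wff D B \<Longrightarrow> prov D (Imp A (Imp B A))"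
  by (rule deriv.impI, assumption)+ (simp add: deriv.hyp)

lemma prov_S:
  assumes "wff D A" "wff D B" "wff D E"
  shows "prov D (Imp (Imp A (Imp B E)) (Imp (Imp A B) (Imp A E)))"
proof -
  let ?\<Gamma> = "{A, Imp A B, Imp A (Imp B E)}"
  have h: "deriv D ?\<Gamma> A" "deriv D ?\<Gamma> (Imp A B)" "deriv D ?\<Gamma> (Imp A (Imp B E))"
    by (rule deriv.hyp; simp add: assms)+
  have "deriv D ?\<Gamma> E" by (rule deriv.impE[OF deriv.impE[OF h(3,1)] deriv.impE[OF h(2,1)]])
  then show ?thesis by (intro deriv.impI) (simp_all add: assms)
qed

lemma prov_wkn: "prov D B \<Longrightarrow> wff D A \<Longrightarrow> prov D (Imp A B)"
  by (meson prov_K prov_mp wff_deriv)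

text \<open>A finite context is carried as one formula \<open>G\<close> on the left of an
  implication. This fits the Henkin construction, where each stage is a single formula.\<close>

lemma prov_mp_under:
  assumes "prov D (Imp G (Imp A B))" "prov D (Imp G A)"
  shows "prov D (Imp G B)"
proof -
  have "prov D (Imp (Imp G (Imp A B)) (Imp (Imp G A) (Imp G B)))"
    using wff_deriv[OF assms(1)] by (intro prov_S) auto
  then show ?thesis using assms prov_mp by blast
qed

lemma prov_trans:
  assumes "prov D (Imp A B)" "prov D (Imp B E)" shows "prov D (Imp A E)"
  using prov_mp_under[OF prov_wkn[OF assms(2)] assms(1)] wff_deriv[OF assms(1)] by simp

lemma prov_refl: "wff D A \<Longrightarrow> prov D (Imp A A)"
  by (rule deriv.impI, assumption) (simp add: deriv.hyp)

lemma prov_dn: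
  assumes "wff D A" shows "prov D (Imp (Neg (Neg A)) A)"
proof -
  let ?\<Gamma> = "{Neg A, Neg (Neg A)}"
  have h: "deriv D ?\<Gamma> (Neg A)" "deriv D ?\<Gamma> (Imp (Neg A) Bot)"
    by (rule deriv.hyp; simp add: assms; simp add: Neg_def)+
  have "deriv D {Neg (Neg A)} A" by (rule deriv.raa[OF _ deriv.impE[OF h(2,1)]]) (simp add: assms)
  then show ?thesis by (intro deriv.impI) (simp_all add: assms)
qed

lemma prov_contrapos:
  assumes "wff D A" "wff D B" shows "prov D (Imp (Imp A B) (Imp (Neg B) (Neg A)))"
proof -
  let ?\<Gamma> = "{A, Imp B Bot, Imp A B}"
  have h: "deriv D ?\<Gamma> A" "deriv D ?\<Gamma> (Imp A B)" "deriv D ?\<Gamma> (Imp B Bot)"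
    by (rule deriv.hyp; simp add: assms)+
  have "deriv D ?\<Gamma> Bot" by (rule deriv.impE[OF h(3) deriv.impE[OF h(2,1)]])
  then show ?thesis unfolding Neg_def by (intro deriv.impI) (simp_all add: assms)
qed

lemma prov_contra:
  "prov D (Imp G (Imp A Bot)) \<Longrightarrow> prov D (Imp G (Imp (Neg A) Bot)) \<Longrightarrow> prov D (Imp G Bot)"
  by (metis Neg_def prov_mp_under)

lemma prov_neg_imp1:
  assumes "wff D A" "wff D B" shows "prov D (Imp (Neg (Imp A B)) A)"
proof -
  let ?\<Gamma> = "{A, Neg A, Imp (Imp A B) Bot}"
  have h: "deriv D (insert (Neg B) ?\<Gamma>) A" "deriv D (insert (Neg B) ?\<Gamma>) (Imp A Bot)"
    by (rule deriv.hyp; simp add: assms; simp add: Neg_def)+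
  have "deriv D ?\<Gamma> B" by (rule deriv.raa[OF _ deriv.impE[OF h(2,1)]]) (simp add: assms)
  then have "deriv D {Neg A, Imp (Imp A B) Bot} (Imp A B)" by (rule deriv.impI[OF assms(1)])
  with deriv.hyp[of "Imp (Imp A B) Bot"] have "deriv D {Neg A, Imp (Imp A B) Bot} Bot"
    by (rule deriv.impE) (simp_all add: assms)
  then have "deriv D {Imp (Imp A B) Bot} A"
    by (rule deriv.raa[OF assms(1)])
  then show ?thesis unfolding Neg_def by (intro deriv.impI) (simp_all add: assms)
qed

lemma prov_neg_imp2:
  assumes "wff D A" "wff D B" shows "prov D (Imp (Neg (Imp A B)) (Neg B))"
  by (rule prov_mp[OF prov_contrapos prov_K]) (simp_all add: assms)

lemma prov_and1:
  assumes "wff D A" "wff D B" shows "prov D (Imp (And A B) A)"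
  unfolding And_def by (rule prov_neg_imp1) (simp_all add: assms)

lemma prov_and2:
  assumes "wff D A" "wff D B" shows "prov D (Imp (And A B) B)"
  unfolding And_def by (rule prov_trans[OF prov_neg_imp2 prov_dn]) (simp_all add: assms)

lemma prov_andI:
  assumes "wff D A" "wff D B" shows "prov D (Imp A (Imp B (And A B)))"
proof -
  let ?\<Gamma> = "{Imp A (Imp B Bot), B, A}"
  have h: "deriv D ?\<Gamma> A" "deriv D ?\<Gamma> B" "deriv D ?\<Gamma> (Imp A (Imp B Bot))"
    by (rule deriv.hyp; simp add: assms)+
  have "deriv D ?\<Gamma> Bot" by (rule deriv.impE[OF deriv.impE[OF h(3,1)] h(2)])
  then show ?thesis unfolding Neg_def And_def by (intro deriv.impI) (simp_all add: assms)
qed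

lemma prov_curry:
  assumes "prov D (Imp (And G A) B)" "wff D G" "wff D A"
  shows "prov D (Imp G (Imp A B))"
proof -
  have B: "wff D B" using wff_deriv[OF assms(1)] by simp
  have "prov D (Imp (Imp A (And G A)) (Imp A B))"
    by (rule prov_mp[OF prov_S prov_wkn]) (use assms B in auto)
  then show ?thesis
    by (rule prov_trans[OF prov_andI, rotated 2]) (use assms in auto)
qed

section \<open>Quantifier laws\<close>

lemma prov_gen: "prov D A \<Longrightarrow> prov D (All x A)"
  by (rule deriv.allI) auto

lemma prov_inst:
  assumes "wff D A" "wt D t" "ty_of t = snd x" "free_for t x A"
  shows "prov D (Imp (All x A) (subst x t A))"
proof (rule deriv.impI)
  have "deriv D {All x A} (All x A)" by (rule deriv.hyp) (simp_all add: assms)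
  then show "deriv D {All x A} (subst x t A)" by (rule deriv.allE) (use assms in auto)
qed (simp add: assms)

lemma substt_self [simp]: "substt x (V x) t = t"
  by (induction t) auto

lemma subst_self [simp]: "subst x (V x) A = A"
  by (induction A) auto

lemma free_for_self [simp]: "free_for (V x) x A"
  by (induction A) auto

text \<open>The universal closure \<open>All x (Imp A B)\<close> serves as a hypothesis:
  \<open>x\<close> is bound in it and not free in \<open>A\<close>, so \<open>allI\<close> applies
  under both hypotheses. The closure is then discharged by \<open>prov_gen\<close>.\<close>

lemma prov_gen_imp:
  assumes p: "prov D (Imp A B)" and x: "x \<notin> fv A"
  shows "prov D (Imp A (All x B))"
proof -
  have w: "wff D A" "wff D B" using wff_deriv[OF p] by auto
  have "deriv D {A, All x (Imp A B)} (Imp A B)"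
    using deriv.allE[OF deriv.hyp, of x "Imp A B" "{A, All x (Imp A B)}" D "V x"] w by simp
  then have "deriv D {A, All x (Imp A B)} B"
    by (rule deriv.impE) (simp add: deriv.hyp w)
  then have "deriv D {A, All x (Imp A B)} (All x B)"
    by (rule deriv.allI) (auto simp: x)
  then have "prov D (Imp (All x (Imp A B)) (Imp A (All x B)))"
    by (intro deriv.impI) (auto simp: w)
  then show ?thesis using prov_gen[OF p] prov_mp by blast
qed

section \<open>Simultaneous substitution with renaming of bound variables\<close>

fun ssubt :: "(var \<Rightarrow> tm) \<Rightarrow> tm \<Rightarrow> tm" where
  "ssubt \<rho> (V x) = \<rho> x"
| "ssubt \<rho> (C c) = C c"
| "ssubt \<rho> (s \<cdot> t) = ssubt \<rho> s \<cdot> ssubt \<rho> t"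

text \<open>Bound variables are renamed by a fixed map \<open>f\<close>, free ones are replaced
  through \<open>\<rho>\<close>. Once the values of \<open>f\<close> are kept apart from the
  variables in the range of \<open>\<rho>\<close>, capture is impossible and no fresh names have to
  be chosen along the recursion.\<close>

fun ssub :: "(var \<Rightarrow> var) \<Rightarrow> (var \<Rightarrow> tm) \<Rightarrow> fm \<Rightarrow> fm" where
  "ssub f \<rho> (Eq s t) = Eq (ssubt \<rho> s) (ssubt \<rho> t)"
| "ssub f \<rho> (St t) = St (ssubt \<rho> t)"
| "ssub f \<rho> Bot = Bot"
| "ssub f \<rho> (Imp A B) = Imp (ssub f \<rho> A) (ssub f \<rho> B)"
| "ssub f \<rho> (All x A) = All (f x) (ssub f (\<rho>(x := V (f x))) A)"

fun bnd :: "fm \<Rightarrow> var set" where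
  "bnd (Imp A B) = bnd A \<union> bnd B"
| "bnd (All x A) = insert x (bnd A)"
| "bnd _ = {}"

lemma finite_fvt [simp]: "finite (fvt t)"
  by (induction t) auto

lemma finite_fv [simp]: "finite (fv A)"
  by (induction A) auto

lemma finite_bnd [simp]: "finite (bnd A)"
  by (induction A) auto

lemma ssubt_V [simp]: "ssubt V t = t"
  by (induction t) auto

lemma ssub_id [simp]: "ssub (\<lambda>x. x) V A = A"
  by (induction A) (auto simp: fun_upd_idem)

lemma ssubt_cong: "(\<And>x. x \<in> fvt t \<Longrightarrow> \<rho> x = \<rho>' x) \<Longrightarrow> ssubt \<rho> t = ssubt \<rho>' t"
  by (induction t) auto

lemma ssub_cong: "(\<And>x. x \<in> fv A \<Longrightarrow> \<rho> x = \<rho>' x) \<Longrightarrow> ssub f \<rho> A = ssub f \<rho>' A"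
proof (induction A arbitrary: \<rho> \<rho>')
  case (Eq s t)
  have "ssubt \<rho> s = ssubt \<rho>' s" "ssubt \<rho> t = ssubt \<rho>' t"
    by (rule ssubt_cong, simp add: Eq)+
  then show ?case by simp
next
  case (St t)
  have "ssubt \<rho> t = ssubt \<rho>' t" by (rule ssubt_cong, simp add: St)
  then show ?case by simp
next
  case (Imp A B)
  have "ssub f \<rho> A = ssub f \<rho>' A" "ssub f \<rho> B = ssub f \<rho>' B"
    by (rule Imp.IH, simp add: Imp.prems)+
  then show ?case by simp
next
  case (All x A)
  have "ssub f (\<rho>(x := V (f x))) A = ssub f (\<rho>'(x := V (f x))) A"
    by (rule All.IH) (use All.prems in simp)
  then show ?case by simp
qed simp

lemma fvt_ssubt: "fvt (ssubt \<rho> t) = (\<Union>x\<in>fvt t. fvt (\<rho> x))"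
  by (induction t) auto

lemma fv_ssub: "fv (ssub f \<rho> A) \<subseteq> (\<Union>x\<in>fv A. fvt (\<rho> x))"
proof (induction A arbitrary: \<rho>)
  case (Imp A B)
  show ?case using Imp.IH[of \<rho>] by auto
next
  case (All x A)
  have "(\<Union>y\<in>fv A. fvt ((\<rho>(x := V (f x))) y)) \<subseteq> insert (f x) (\<Union>y\<in>fv A - {x}. fvt (\<rho> y))"
    by (auto split: if_splits)
  with All have "fv (ssub f (\<rho>(x := V (f x))) A) \<subseteq> insert (f x) (\<Union>y\<in>fv A - {x}. fvt (\<rho> y))"
    by (rule subset_trans)
  then show ?case by auto
qed (simp_all add: fvt_ssubt)

lemma wt_ssubt: "wt D t \<Longrightarrow> (\<And>x. x \<in> fvt t \<Longrightarrow> wt D (\<rho> x) \<and> ty_of (\<rho> x) = snd x) \<Longrightarrow>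
    wt D (ssubt \<rho> t) \<and> ty_of (ssubt \<rho> t) = ty_of t"
  by (induction t) auto

lemma wff_ssub: "wff D A \<Longrightarrow> (\<And>x. snd (f x) = snd x) \<Longrightarrow>
    (\<And>x. x \<in> fv A \<Longrightarrow> wt D (\<rho> x) \<and> ty_of (\<rho> x) = snd x) \<Longrightarrow> wff D (ssub f \<rho> A)"
proof (induction A arbitrary: \<rho>)
  case (Eq s t)
  then show ?case using wt_ssubt[of D s \<rho>] wt_ssubt[of D t \<rho>] by simp
next
  case (St t)
  then show ?case using wt_ssubt[of D t \<rho>] by simp
next
  case (All x A)
  have "wff D (ssub f (\<rho>(x := V (f x))) A)"
    by (rule All.IH) (use All.prems in auto)
  then show ?case by simp
qed simp_all

lemma substt_ssubt: "(\<And>y. y \<in> fvt s \<Longrightarrow> y \<noteq> x \<Longrightarrow> v \<notin> fvt (\<rho> y)) \<Longrightarrow>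
    substt v t (ssubt (\<rho>(x := V v)) s) = ssubt (\<rho>(x := t)) s"
proof (induction s)
  case (V y)
  have "v \<notin> fvt r \<Longrightarrow> substt v t r = r" for r by (induction r) auto
  with V show ?case by auto
qed auto

lemma subst_notfree: "v \<notin> fv A \<Longrightarrow> subst v t A = A"
proof -
  have *: "v \<notin> fvt r \<Longrightarrow> substt v t r = r" for r by (induction r) auto
  show "v \<notin> fv A \<Longrightarrow> subst v t A = A" by (induction A) (auto simp: *)
qed

text \<open>The free occurrences of \<open>v\<close> are precisely those that replace
  \<open>x\<close>, so substituting for \<open>v\<close> amounts to changing \<open>\<rho>\<close>
  at \<open>x\<close>. The second condition keeps the renamed binders away from \<open>v\<close> and
  \<open>t\<close>.\<close>

lemma subst_ssub:
  assumes "inj f"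
  shows "(\<And>y. y \<in> fv A - {x} \<Longrightarrow> v \<notin> fvt (\<rho> y)) \<Longrightarrow>
    (\<And>w. w \<in> bnd A \<Longrightarrow> w \<noteq> x \<Longrightarrow> f w \<noteq> v \<and> f w \<notin> fvt t) \<Longrightarrow>
    subst v t (ssub f (\<rho>(x := V v)) A) = ssub f (\<rho>(x := t)) A \<and>
    free_for t v (ssub f (\<rho>(x := V v)) A)"
proof (induction A arbitrary: \<rho>)
  case (All w B)
  show ?case
  proof (cases "w = x")
    case True
    \<comment> \<open>The quantifier shadows \<open>x\<close>, so the value of \<open>\<rho>\<close>
      at \<open>x\<close> does not reach the body.\<close>
    have "v \<notin> fv (ssub f (\<rho>(x := V v)) (All w B))"
    proof
      assume "v \<in> fv (ssub f (\<rho>(x := V v)) (All w B))"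
      from subsetD[OF fv_ssub this] obtain y
        where "y \<in> fv B - {x}" "v \<in> fvt ((\<rho>(x := V v)) y)" unfolding True by auto
      with All.prems(1)[of y] show False by (simp add: True)
    qed
    moreover have "ssub f (\<rho>(x := r)) (All w B) = All (f x) (ssub f (\<rho>(x := V (f x))) B)" for r
      by (simp add: True)
    ultimately show ?thesis
      using subst_notfree by (metis free_for.simps(2))
  next
    case False
    have "subst v t (ssub f ((\<rho>(w := V (f w)))(x := V v)) B) = ssub f ((\<rho>(w := V (f w)))(x := t)) B \<and>
      free_for t v (ssub f ((\<rho>(w := V (f w)))(x := V v)) B)"
      by (rule All.IH) (use All.prems False in auto)
    moreover have "ssub f (\<rho>(x := r)) (All w B) = All (f w) (ssub f (\<rho>(w := V (f w), x := r)) B)" for r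
      by (simp only: ssub.simps fun_upd_twist[OF False])
    moreover have "v \<noteq> f w" "f w \<notin> fvt t" using All.prems(2)[of w] False by auto
    ultimately show ?thesis by (simp only: subst.simps free_for.simps if_False) simp
  qed
next
  case (Eq s u)
  then show ?case using substt_ssubt[of s x v \<rho> t] substt_ssubt[of u x v \<rho> t]
    by (simp only: ssub.simps subst.simps free_for.simps fv.simps Un_iff Diff_iff singleton_iff simp_thms)
next
  case (St s)
  then show ?case using substt_ssubt[of s x v \<rho> t]
    by (simp only: ssub.simps subst.simps free_for.simps fv.simps Diff_iff singleton_iff simp_thms)
qed simp_all

text \<open>Odd names are set aside for free variables: Henkin witnesses are chosen among them,
  whereas the term model renames all bound variables to even names.\<close>

lemma ex_fresh: "finite F \<Longrightarrow> \<exists>x :: var. snd x = \<sigma> \<and> odd (fst x) \<and> x \<notin> F"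
proof -
  assume "finite F"
  have "inj (\<lambda>n :: nat. (Suc (2 * n), \<sigma>))" by (auto intro: injI)
  then have "infinite (range (\<lambda>n :: nat. (Suc (2 * n), \<sigma>)))" by (simp add: finite_image_iff)
  then obtain x where "x \<in> range (\<lambda>n :: nat. (Suc (2 * n), \<sigma>))" "x \<notin> F"
    using \<open>finite F\<close> finite_subset[of _ F] by blast
  then show ?thesis by (intro exI[of _ x]) auto
qed

text \<open>The body is compared under a third, completely fresh variable in place of the two bound ones.\<close>

lemma prov_alpha:
  assumes "wff D A" "inj f" "inj g" "\<And>x. snd (f x) = snd x" "\<And>x. snd (g x) = snd x"
    and "\<And>x. x \<in> fv A \<Longrightarrow> wt D (\<rho> x) \<and> ty_of (\<rho> x) = snd x"
    and "\<And>x w. x \<in> fv A \<Longrightarrow> w \<in> bnd A \<Longrightarrow> f w \<notin> fvt (\<rho> x) \<and> g w \<notin> fvt (\<rho> x)"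
  shows "prov D (Imp (ssub f \<rho> A) (ssub g \<rho> A))"
  using assms
proof (induction A arbitrary: f g \<rho>)
  case (Imp A B)
  \<comment> \<open>The antecedent needs the renaming in the opposite direction, hence the symmetric
    roles of \<open>f\<close> and \<open>g\<close> in the assumptions.\<close>
  have 1: "prov D (Imp (ssub g \<rho> A) (ssub f \<rho> A))"
    by (rule Imp.IH(1)) (use Imp.prems in simp_all)
  have 2: "prov D (Imp (ssub f \<rho> B) (ssub g \<rho> B))"
    by (rule Imp.IH(2)) (use Imp.prems in simp_all)
  let ?I = "Imp (ssub f \<rho> A) (ssub f \<rho> B)"
  have w: "wff D ?I" using wff_deriv[OF 1] wff_deriv[OF 2] by simp
  then have w': "wff D (ssub g \<rho> A)" using wff_deriv[OF 1] by simp
  have a: "prov D (Imp ?I (Imp (ssub g \<rho> A) ?I))"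
    by (rule prov_K[OF w w'])
  have "prov D (Imp (Imp (ssub g \<rho> A) ?I) (Imp (Imp (ssub g \<rho> A) (ssub f \<rho> A)) (Imp (ssub g \<rho> A) (ssub f \<rho> B))))"
    by (rule prov_S) (use w w' in auto)
  from prov_mp_under[OF prov_trans[OF a this] prov_wkn[OF 1 w]]
  have b: "prov D (Imp ?I (Imp (ssub g \<rho> A) (ssub f \<rho> B)))" .
  have "prov D (Imp (Imp (ssub g \<rho> A) (ssub f \<rho> B)) (Imp (ssub g \<rho> A) (ssub g \<rho> B)))"
    by (rule prov_mp[OF prov_S prov_wkn]) (use 2 wff_deriv[OF 2] w' in auto)
  from prov_trans[OF b this] show ?case by simp
next
  case (All x A)
  let ?F = "fv A \<union> f ` bnd (All x A) \<union> g ` bnd (All x A) \<union> (\<Union>y\<in>fv A. fvt (\<rho> y))"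
  have "finite ?F" by simp
  then obtain z where z: "snd z = snd x" "z \<notin> ?F" using ex_fresh[of ?F "snd x"] by blast
  have P1: "wff D A" using All.prems(1) by simp
  have P2: "wt D (\<rho> y) \<and> ty_of (\<rho> y) = snd y" if "y \<in> fv A" "y \<noteq> x" for y
    by (rule All.prems(6)) (use that in simp)
  have P3: "f w \<notin> fvt (\<rho> y) \<and> g w \<notin> fvt (\<rho> y)" if "y \<in> fv A" "y \<noteq> x" "w \<in> insert x (bnd A)" for y w
    by (rule All.prems(7)) (use that in simp_all)
  note P = P1 P2 P3
  have Z1: "f w \<noteq> z \<and> g w \<noteq> z" if "w \<in> insert x (bnd A)" for w
    using z(2) that by auto
  have Z2: "z \<notin> fvt (\<rho> y)" if "y \<in> fv A" for y
    using z(2) that by simp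
  note Z = Z1 Z2
  have IH: "prov D (Imp (ssub f (\<rho>(x := V z)) A) (ssub g (\<rho>(x := V z)) A))"
  proof (rule All.IH[OF P(1) All.prems(2-5)])
    fix y w assume y: "y \<in> fv A"
    show "wt D ((\<rho>(x := V z)) y) \<and> ty_of ((\<rho>(x := V z)) y) = snd y"
      using P(2)[OF y] z(1) by (cases "y = x") simp_all
    assume "w \<in> bnd A"
    then show "f w \<notin> fvt ((\<rho>(x := V z)) y) \<and> g w \<notin> fvt ((\<rho>(x := V z)) y)"
      using P(3)[OF y] Z(1)[of w] by (cases "y = x") simp_all
  qed
  have sf: "subst (f x) (V z) (ssub f (\<rho>(x := V (f x))) A) = ssub f (\<rho>(x := V z)) A \<and>
      free_for (V z) (f x) (ssub f (\<rho>(x := V (f x))) A)"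
    by (rule subst_ssub) (use All.prems(2,3) P(3)[of _ x] Z in \<open>simp_all add: inj_eq\<close>)
  have sg: "subst z (V (g x)) (ssub g (\<rho>(x := V z)) A) = ssub g (\<rho>(x := V (g x))) A \<and>
      free_for (V (g x)) z (ssub g (\<rho>(x := V z)) A)"
    by (rule subst_ssub) (use All.prems(2,3) P(3)[of _ x] Z in \<open>simp_all add: inj_eq\<close>)
  have wf: "wff D (ssub f (\<rho>(x := V (f x))) A)" "wff D (ssub g (\<rho>(x := V z)) A)"
    by (rule wff_ssub; use All.prems(4,5) P z(1) in simp)+
  have "prov D (Imp (ssub f \<rho> (All x A)) (ssub f (\<rho>(x := V z)) A))"
    using prov_inst[OF wf(1), of "V z" "f x"] sf z(1) All.prems(4) by simp
  then have "prov D (Imp (ssub f \<rho> (All x A)) (ssub g (\<rho>(x := V z)) A))"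
    using IH by (rule prov_trans)
  then have 1: "prov D (Imp (ssub f \<rho> (All x A)) (All z (ssub g (\<rho>(x := V z)) A)))"
  proof (rule prov_gen_imp)
    have "z \<notin> (\<Union>y\<in>fv A - {x}. fvt (\<rho> y))" using Z(2) by simp
    with fv_ssub[of f \<rho> "All x A"] show "z \<notin> fv (ssub f \<rho> (All x A))" by auto
  qed
  have 2: "prov D (Imp (All z (ssub g (\<rho>(x := V z)) A)) (ssub g (\<rho>(x := V (g x))) A))"
    using prov_inst[OF wf(2), of "V (g x)" z] sg z(1) All.prems(5) by simp
  have "(\<Union>y\<in>fv A. fvt ((\<rho>(x := V z)) y)) \<subseteq> insert z (\<Union>y\<in>fv A - {x}. fvt (\<rho> y))"
    by (auto split: if_splits)
  with fv_ssub[of g "\<rho>(x := V z)" A]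
  have "fv (All z (ssub g (\<rho>(x := V z)) A)) \<subseteq> (\<Union>y\<in>fv A - {x}. fvt (\<rho> y))"
    by auto
  moreover have "g x \<notin> (\<Union>y\<in>fv A - {x}. fvt (\<rho> y))" using P(3)[of _ x] by simp
  ultimately have "g x \<notin> fv (All z (ssub g (\<rho>(x := V z)) A))" by (rule contra_subsetD)
  from prov_trans[OF 1 prov_gen_imp[OF 2 this]] show ?case by simp
next
  case (Eq s t)
  have "wff D (ssub f \<rho> (Eq s t))" by (rule wff_ssub[OF Eq(1) Eq(4)]) (use Eq(6) in simp)
  then show ?case by (simp add: prov_refl)
next
  case (St t)
  have "wff D (ssub f \<rho> (St t))" by (rule wff_ssub[OF St(1) St(4)]) (use St(6) in simp)
  then show ?case by (simp add: prov_refl)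
qed (simp add: prov_refl)

section \<open>Interpretations\<close>

lemma fvt_monusT [simp]: "fvt monusT = {}"
  by (simp add: monusT_def predT_def rec_def Let_def)

lemma bound_fvt: "(i, \<sigma>) \<in> fvt t \<Longrightarrow> i < bound t"
  by (induction t) auto

text \<open>Nothing is assumed. The same evaluation serves the term model, where equality and
  standardness are membership in a theory, and its quotient, where equality is identity.\<close>

locale interp =
  fixes dom :: "ty \<Rightarrow> 'a set" and ap :: "'a \<Rightarrow> 'a \<Rightarrow> 'a" (infixl "\<odot>" 200)
    and cs :: "const \<Rightarrow> 'a" and eqn :: "'a \<Rightarrow> 'a \<Rightarrow> bool" and st :: "'a \<Rightarrow> bool"
begin

primrec val :: "(var \<Rightarrow> 'a) \<Rightarrow> tm \<Rightarrow> 'a" where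
  "val \<rho> (V x) = \<rho> x"
| "val \<rho> (C c) = cs c"
| "val \<rho> (s \<cdot> t) = val \<rho> s \<odot> val \<rho> t"

primrec sat :: "(var \<Rightarrow> 'a) \<Rightarrow> fm \<Rightarrow> bool" where
  "sat \<rho> (Eq s t) \<longleftrightarrow> eqn (val \<rho> s) (val \<rho> t)"
| "sat \<rho> (St t) \<longleftrightarrow> st (val \<rho> t)"
| "sat \<rho> Bot \<longleftrightarrow> False"
| "sat \<rho> (Imp A B) \<longleftrightarrow> (sat \<rho> A \<longrightarrow> sat \<rho> B)"
| "sat \<rho> (All x A) \<longleftrightarrow> (\<forall>d\<in>dom (snd x). sat (\<rho>(x := d)) A)"

definition env :: "(var \<Rightarrow> 'a) \<Rightarrow> bool" where "env \<rho> \<longleftrightarrow> (\<forall>x. \<rho> x \<in> dom (snd x))"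

lemma env_upd [simp]: "env \<rho> \<Longrightarrow> d \<in> dom (snd x) \<Longrightarrow> env (\<rho>(x := d))"
  by (simp add: env_def del: split_paired_All)

lemma sat_Neg [simp]: "sat \<rho> (Neg A) \<longleftrightarrow> \<not> sat \<rho> A"
  and sat_And [simp]: "sat \<rho> (And A B) \<longleftrightarrow> sat \<rho> A \<and> sat \<rho> B"
  and sat_Iff [simp]: "sat \<rho> (Iff A B) \<longleftrightarrow> (sat \<rho> A \<longleftrightarrow> sat \<rho> B)"
  and sat_Ex [simp]: "sat \<rho> (Ex x A) \<longleftrightarrow> (\<exists>d\<in>dom (snd x). sat (\<rho>(x := d)) A)"
  and sat_AllSt [simp]: "sat \<rho> (AllSt x A) \<longleftrightarrow> (\<forall>d\<in>dom (snd x). st d \<longrightarrow> sat (\<rho>(x := d)) A)"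
  and sat_ExSt [simp]: "sat \<rho> (ExSt x A) \<longleftrightarrow> (\<exists>d\<in>dom (snd x). st d \<and> sat (\<rho>(x := d)) A)"
  and sat_BAll [simp]: "sat \<rho> (BAll x t A) \<longleftrightarrow> (\<forall>d\<in>dom (snd x). sat (\<rho>(x := d)) (lt (V x) t) \<longrightarrow> sat (\<rho>(x := d)) A)"
  and sat_BEx [simp]: "sat \<rho> (BEx x t A) \<longleftrightarrow> (\<exists>d\<in>dom (snd x). sat (\<rho>(x := d)) (lt (V x) t) \<and> sat (\<rho>(x := d)) A)"
  by (auto simp: Neg_def And_def Iff_def Ex_def AllSt_def ExSt_def BAll_def BEx_def)

lemma val_cong: "(\<And>x. x \<in> fvt t \<Longrightarrow> \<rho> x = \<rho>' x) \<Longrightarrow> val \<rho> t = val \<rho>' t"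
  by (induction t) auto

lemma val_closed: "fvt t = {} \<Longrightarrow> val \<rho> t = val \<rho>' t"
  by (rule val_cong) simp

lemma sat_cong: "(\<And>x. x \<in> fv A \<Longrightarrow> \<rho> x = \<rho>' x) \<Longrightarrow> sat \<rho> A = sat \<rho>' A"
proof (induction A arbitrary: \<rho> \<rho>')
  case (Eq s t)
  have "val \<rho> s = val \<rho>' s" "val \<rho> t = val \<rho>' t" by (rule val_cong, simp add: Eq)+
  then show ?case by simp
next
  case (St t)
  have "val \<rho> t = val \<rho>' t" by (rule val_cong, simp add: St)
  then show ?case by simp
next
  case (Imp A B)
  have "sat \<rho> A = sat \<rho>' A" "sat \<rho> B = sat \<rho>' B" by (rule Imp.IH, simp add: Imp.prems)+
  then show ?case by simp
next
  case (All x A)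
  have "sat (\<rho>(x := d)) A = sat (\<rho>'(x := d)) A" for d
    by (rule All.IH) (use All.prems in simp)
  then show ?case by simp
qed simp

lemma sat_foldr_All: "sat \<rho> (foldr All xs A) \<Longrightarrow> env \<rho> \<Longrightarrow> sat \<rho> A"
proof (induction xs)
  case (Cons x xs)
  then have "sat (\<rho>(x := \<rho> x)) (foldr All xs A)" by (simp only: foldr.simps o_apply sat.simps env_def)
  with Cons show ?case by simp
qed simp

text \<open>Evaluating the formula \<open>lt\<close> itself makes the order available before any
  arithmetic has been established. The environment sends \<open>(0, N)\<close> to \<open>a\<close>
  and every other variable to \<open>b\<close>.\<close>

definition LT :: "'a \<Rightarrow> 'a \<Rightarrow> bool" where
  "LT a b \<longleftrightarrow> sat ((\<lambda>_. b)((0, N) := a)) (lt (V (0, N)) (V (1, N)))"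

primrec ex :: "ty \<Rightarrow> 'a \<Rightarrow> 'a \<Rightarrow> bool" where
  "ex N a b \<longleftrightarrow> eqn a b"
| "ex (\<sigma> \<rightarrow> \<tau>) a b \<longleftrightarrow> (\<forall>d\<in>dom \<sigma>. ex \<tau> (a \<odot> d) (b \<odot> d))"
| "ex (Sq \<sigma>) a b \<longleftrightarrow> eqn (cs (Len \<sigma>) \<odot> a) (cs (Len \<sigma>) \<odot> b) \<and>
     (\<forall>i\<in>dom N. LT i (cs (Len \<sigma>) \<odot> a) \<longrightarrow> ex \<sigma> (cs (Proj \<sigma>) \<odot> a \<odot> i) (cs (Proj \<sigma>) \<odot> b \<odot> i))"

lemma sat_lt: "sat \<rho> (lt s t) \<longleftrightarrow> LT (val \<rho> s) (val \<rho> t)"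
  unfolding LT_def lt_def leq_def by (simp add: val_closed[OF fvt_monusT, of \<rho> "(\<lambda>_. val \<rho> t)((0, N) := val \<rho> s)"])

lemma val_fresh [simp]: "bound t \<le> i \<Longrightarrow> val (\<rho>((i, \<sigma>) := d)) t = val \<rho> t"
  by (rule val_cong) (use bound_fvt in fastforce)

lemma val_fresh1 [simp]: "val (\<rho>((fresh s t, \<sigma>) := d)) s = val \<rho> s"
  and val_fresh2 [simp]: "val (\<rho>((fresh s t, \<sigma>) := d)) t = val \<rho> t"
  by (simp_all add: fresh_def)

lemma sat_eqf: "sat \<rho> (eqf \<tau> s t) \<longleftrightarrow> ex \<tau> (val \<rho> s) (val \<rho> t)"
  by (induction \<tau> arbitrary: \<rho> s t) (simp_all add: Let_def sat_lt)

lemma sat_eq: "sat \<rho> (eq s t) \<longleftrightarrow> ex (ty_of s) (val \<rho> s) (val \<rho> t)"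
  by (simp add: eq_def sat_eqf)

lemma sat_mem: "sat \<rho> (mem s t) \<longleftrightarrow> (\<exists>i\<in>dom N. LT i (cs (Len (ty_of s)) \<odot> val \<rho> t) \<and>
    ex (ty_of s) (val \<rho> s) (cs (Proj (ty_of s)) \<odot> val \<rho> t \<odot> i))"
  by (simp add: mem_def Let_def sat_lt sat_eq)

end

text \<open>Soundness is an assumption: the term model satisfies every theorem because it is built
  from a theory, and the quotient inherits this. \<open>env_ex\<close> says that every type is
  inhabited.\<close>

locale pre_model = interp +
  fixes D :: specs
  assumes ap_type: "f \<in> dom (\<sigma> \<rightarrow> \<tau>) \<Longrightarrow> a \<in> dom \<sigma> \<Longrightarrow> f \<odot> a \<in> dom \<tau>"
    and cs_type: "wt D (C c) \<Longrightarrow> cs c \<in> dom (const_ty c)"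
    and sound: "prov D A \<Longrightarrow> env \<rho> \<Longrightarrow> sat \<rho> A"
    and env_ex: "\<exists>\<rho>. env \<rho>"
begin

lemma val_type: "wt D t \<Longrightarrow> env \<rho> \<Longrightarrow> val \<rho> t \<in> dom (ty_of t)"
proof (induction t)
  case (V x)
  then show ?case by (simp add: env_def del: split_paired_All)
next
  case (C c)
  then show ?case using cs_type by simp
next
  case (App s t)
  then show ?case using ap_type by fastforce
qed

lemma ax: "RCA0\<Omega>_axiom D A \<Longrightarrow> wff D A \<Longrightarrow> env \<rho> \<Longrightarrow> sat \<rho> A"
  by (rule sound[OF deriv.ax])

end

locale model = pre_model dom ap cs "(=)" st D
  for dom :: "ty \<Rightarrow> 'a set" and ap (infixl "\<odot>" 200) and cs st D +
  assumes ex_eq: "a \<in> dom \<sigma> \<Longrightarrow> b \<in> dom \<sigma> \<Longrightarrow> ex \<sigma> a b \<Longrightarrow> a = b"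

section \<open>Henkin construction\<close>

instance ty :: countable by countable_datatype
instance const :: countable by countable_datatype
instance tm :: countable by countable_datatype
instance fm :: countable by countable_datatype

definition consistent :: "specs \<Rightarrow> fm \<Rightarrow> bool" where
  "consistent D G \<longleftrightarrow> wff D G \<and> \<not> prov D (Imp G Bot)"

definition fresh_var :: "fm \<Rightarrow> var \<Rightarrow> fm \<Rightarrow> var" where
  "fresh_var G x B = (SOME y. snd y = snd x \<and> odd (fst y) \<and> y \<notin> insert x (fv G \<union> fv B \<union> bnd B))"

lemma fresh_var:
  "snd (fresh_var G x B) = snd x" "odd (fst (fresh_var G x B))"
  "fresh_var G x B \<notin> insert x (fv G \<union> fv B \<union> bnd B)"
  using someI_ex[OF ex_fresh[of "insert x (fv G \<union> fv B \<union> bnd B)" "snd x"]]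
  unfolding fresh_var_def by simp_all

text \<open>The fresh variable stands for a counterexample to \<open>All x B\<close>, provided there
  is one.\<close>

definition witness :: "fm \<Rightarrow> var \<Rightarrow> fm \<Rightarrow> fm" where
  "witness G x B = Imp (subst x (V (fresh_var G x B)) B) (All x B)"

fun henkin :: "fm \<Rightarrow> fm \<Rightarrow> fm" where
  "henkin G (All x B) = And G (witness G x B)"
| "henkin G _ = G"

lemma subst_ssub_id:
  assumes "\<And>w. w \<in> bnd B \<Longrightarrow> w \<noteq> x \<Longrightarrow> w \<notin> fvt t"
  shows "subst x t B = ssub (\<lambda>x. x) (V(x := t)) B" "free_for t x B"
  using subst_ssub[of "\<lambda>x. x" B x x V t] assms by auto

lemma wff_witness: "wff D (All x B) \<Longrightarrow> wff D (witness G x B)"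
  using wff_subst[of D B "V (fresh_var G x B)" x] fresh_var(1)[of G x B]
  by (simp add: witness_def)

text \<open>As \<open>y\<close> occurs neither free nor bound in \<open>B\<close>, replacing it by
  \<open>x\<close> undoes the first substitution.\<close>

lemma prov_unsubst:
  assumes "wff D B" and y: "snd y = snd x" "y \<notin> insert x (fv B \<union> bnd B)"
  shows "prov D (Imp (All y (subst x (V y) B)) (All x B))"
proof -
  have 1: "subst x (V y) B = ssub (\<lambda>x. x) (V(x := V y)) B"
    by (rule subst_ssub_id) (use y in auto)
  have "subst y (V x) (ssub (\<lambda>x. x) (V(x := V y)) B) = ssub (\<lambda>x. x) (V(x := V x)) B \<and>
    free_for (V x) y (ssub (\<lambda>x. x) (V(x := V y)) B)"
    by (rule subst_ssub) (use y in auto)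
  then have 2: "subst y (V x) (subst x (V y) B) = B" "free_for (V x) y (subst x (V y) B)"
    by (simp_all add: 1 fun_upd_idem)
  have w: "wff D (subst x (V y) B)" using wff_subst[OF assms(1), of "V y" x] y(1) by simp
  have "fv (subst x (V y) B) \<subseteq> insert y (fv B - {x})"
    using fv_ssub[of "\<lambda>x. x" "V(x := V y)" B] unfolding 1 by (auto split: if_splits)
  then have "x \<notin> fv (All y (subst x (V y) B))" using y(2) by auto
  then show ?thesis
    using prov_gen_imp prov_inst[OF w, of "V x" y] 2 y(1) by simp
qed

text \<open>If \<open>G\<close> refuted the witness formula, it would prove the instance at the
  fresh variable and refute \<open>All x B\<close>; generalising over that variable makes
  \<open>G\<close> prove \<open>All x B\<close> as well.\<close>

lemma consistent_witness:
  assumes "consistent D G" "wff D (All x B)"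
  shows "consistent D (And G (witness G x B))"
proof -
  let ?y = "fresh_var G x B"
  let ?P = "subst x (V ?y) B"
  have w: "wff D G" "wff D ?P" "wff D (All x B)" "wff D B" "wff D (witness G x B)"
    using assms wff_witness[OF assms(2)] by (auto simp: witness_def consistent_def)
  have False if "prov D (Imp (And G (witness G x B)) Bot)"
  proof -
    have n: "prov D (Imp G (Neg (witness G x B)))"
      using prov_curry[OF that w(1,5)] by (simp add: Neg_def)
    have "prov D (Imp G ?P)" "prov D (Imp G (Neg (All x B)))"
      using prov_trans[OF n[unfolded witness_def] prov_neg_imp1[OF w(2,3)]]
        prov_trans[OF n[unfolded witness_def] prov_neg_imp2[OF w(2,3)]] by simp_all
    moreover have "prov D (Imp (All ?y ?P) (All x B))"
      by (rule prov_unsubst) (use w fresh_var in auto)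
    moreover have "?y \<notin> fv G" using fresh_var(3)[of G x B] by simp
    ultimately have "prov D (Imp G (All x B))" "prov D (Imp G (Imp (All x B) Bot))"
      using prov_trans prov_gen_imp by (blast, simp add: Neg_def)
    then have "prov D (Imp G Bot)" using prov_mp_under by blast
    then show False using assms(1) by (simp add: consistent_def)
  qed
  then show ?thesis using w by (auto simp: consistent_def)
qed

lemma consistent_henkin: "consistent D G \<Longrightarrow> wff D A \<Longrightarrow> consistent D (henkin G A)"
  by (cases A) (auto simp: consistent_witness simp del: wff.simps)

lemma henkin_imp: "wff D G \<Longrightarrow> wff D A \<Longrightarrow> prov D (Imp (henkin G A) G)"
  by (cases A) (auto intro: prov_refl simp: prov_and1 wff_witness)

section \<open>Extension to a complete theory with witnesses\<close>

definition decide :: "specs \<Rightarrow> fm \<Rightarrow> fm \<Rightarrow> fm" where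
  "decide D G A = (if consistent D (And G A) then And G A else And G (Neg A))"

lemma consistent_decide:
  assumes "consistent D G" "wff D A" shows "consistent D (decide D G A)"
proof (rule ccontr)
  assume "\<not> consistent D (decide D G A)"
  then have "prov D (Imp (And G A) Bot)" "prov D (Imp (And G (Neg A)) Bot)"
    using assms by (auto simp: decide_def consistent_def split: if_splits)
  then have "prov D (Imp G Bot)"
    using assms by (intro prov_contra[of D G A] prov_curry) (auto simp: consistent_def)
  then show False using assms(1) by (simp add: consistent_def)
qed

text \<open>Stage \<open>Suc (to_nat A)\<close> settles a well-formed \<open>A\<close>. A universal
  formula receives its witness just before it is decided, so \<open>T_complete\<close> and
  \<open>T_witness\<close> can both point to that stage.\<close>

primrec chain :: "specs \<Rightarrow> fm \<Rightarrow> nat \<Rightarrow> fm" where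
  "chain D G 0 = G"
| "chain D G (Suc n) = (let A = from_nat n in
     if wff D A then decide D (henkin (chain D G n) A) A else chain D G n)"

locale henkin_theory =
  fixes D G
  assumes con: "consistent D G"
begin

definition T :: "fm set" where "T = {A. \<exists>n. prov D (Imp (chain D G n) A)}"

lemma con_chain: "consistent D (chain D G n)"
  by (induction n) (simp_all add: con Let_def consistent_decide consistent_henkin)

lemma wff_chain: "wff D (chain D G n)"
  using con_chain by (simp add: consistent_def)

lemma chain_Suc: "prov D (Imp (chain D G (Suc n)) (chain D G n))"
proof (cases "wff D (from_nat n)")
  case True
  let ?A = "from_nat n :: fm" and ?H = "henkin (chain D G n) (from_nat n)"
  have "consistent D ?H" using con_chain True consistent_henkin by blast
  then have "prov D (Imp (decide D ?H ?A) ?H)"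
    using True by (simp add: decide_def prov_and1 consistent_def)
  then show ?thesis using True prov_trans[OF _ henkin_imp[OF wff_chain True]] by (simp add: Let_def)
qed (simp add: Let_def prov_refl wff_chain)

lemma chain_mono: "m \<le> n \<Longrightarrow> prov D (Imp (chain D G n) (chain D G m))"
proof (induction n rule: dec_induct)
  case base
  show ?case by (rule prov_refl[OF wff_chain])
next
  case (step n)
  show ?case by (rule prov_trans[OF chain_Suc step.IH])
qed

lemma T_wff: "A \<in> T \<Longrightarrow> wff D A"
  by (auto simp: T_def dest: wff_deriv)

lemma T_prov: "prov D A \<Longrightarrow> A \<in> T"
  by (auto simp: T_def intro: prov_wkn wff_chain)

lemma T_mp:
  assumes "Imp A B \<in> T" "A \<in> T" shows "B \<in> T"
proof -
  from assms obtain m n where "prov D (Imp (chain D G m) (Imp A B))" "prov D (Imp (chain D G n) A)"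
    by (auto simp: T_def)
  then have "prov D (Imp (chain D G (max m n)) (Imp A B))" "prov D (Imp (chain D G (max m n)) A)"
    using prov_trans[OF chain_mono] by (meson max.cobounded1, meson max.cobounded2)
  then show ?thesis unfolding T_def by (blast intro: prov_mp_under)
qed

lemma T_base: "G \<in> T"
  using prov_refl[OF wff_chain[of 0]] by (auto simp: T_def intro!: exI[of _ 0])

lemma T_Bot: "Bot \<notin> T"
  using con_chain by (simp add: T_def consistent_def)

lemma T_complete:
  assumes "wff D A" shows "A \<in> T \<or> Neg A \<in> T"
proof -
  let ?n = "to_nat A" and ?H = "henkin (chain D G (to_nat A)) A"
  have w: "wff D ?H" using consistent_henkin[OF con_chain assms] by (simp add: consistent_def)
  have "chain D G (Suc ?n) = decide D ?H A" using assms by simp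
  then have "prov D (Imp (chain D G (Suc ?n)) A) \<or> prov D (Imp (chain D G (Suc ?n)) (Neg A))"
    using prov_and2[OF w assms] prov_and2[OF w, of "Neg A"] assms by (auto simp: decide_def)
  then show ?thesis unfolding T_def by blast
qed

lemma T_Imp: "wff D A \<Longrightarrow> wff D B \<Longrightarrow> Imp A B \<in> T \<longleftrightarrow> (A \<in> T \<longrightarrow> B \<in> T)"
proof (intro iffI)
  assume w: "wff D A" "wff D B" and i: "A \<in> T \<longrightarrow> B \<in> T"
  show "Imp A B \<in> T"
  proof (rule ccontr)
    assume "Imp A B \<notin> T"
    then have n: "Neg (Imp A B) \<in> T" using T_complete[of "Imp A B"] w by auto
    have "A \<in> T" "Neg B \<in> T"
      using T_mp[OF T_prov[OF prov_neg_imp1[OF w]] n] T_mp[OF T_prov[OF prov_neg_imp2[OF w]] n] by auto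
    then show False using i T_mp T_Bot unfolding Neg_def by blast
  qed
qed (auto intro: T_mp)

lemma T_witness:
  assumes "wff D (All x B)"
  obtains y where "snd y = snd x" "odd (fst y)" "Imp (subst x (V y) B) (All x B) \<in> T"
proof -
  let ?A = "All x B" and ?G = "chain D G (to_nat (All x B))"
  have w: "wff D (henkin ?G ?A)" using consistent_henkin[OF con_chain assms] by (simp add: consistent_def)
  have "chain D G (Suc (to_nat ?A)) = decide D (henkin ?G ?A) ?A"
    using assms by (simp add: Let_def)
  then have "prov D (Imp (chain D G (Suc (to_nat ?A))) (henkin ?G ?A))"
    using w assms by (simp add: decide_def prov_and1 del: henkin.simps)
  moreover have "prov D (Imp (henkin ?G ?A) (witness ?G x B))"
    using prov_and2[OF wff_chain wff_witness[OF assms]] by simp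
  ultimately have "witness ?G x B \<in> T" unfolding T_def using prov_trans by blast
  then show thesis using that[of "fresh_var ?G x B"] fresh_var by (simp add: witness_def)
qed

section \<open>The term model and its truth lemma\<close>

definition dom1 :: "ty \<Rightarrow> tm set" where
  "dom1 \<tau> = {t. wt D t \<and> ty_of t = \<tau> \<and> (\<forall>v\<in>fvt t. odd (fst v))}"

text \<open>Bound variables become even, while the terms in the domains have odd free variables
  only. Thus elements of the model can be substituted under any quantifier.\<close>

definition dbl :: "var \<Rightarrow> var" where "dbl x = (2 * fst x, snd x)"

lemma dbl: "inj dbl" "snd (dbl x) = snd x" "even (fst (dbl x))"
  by (auto simp: dbl_def inj_def prod_eq_iff)

sublocale tm: interp dom1 App C "\<lambda>s t. Eq s t \<in> T" "\<lambda>t. St t \<in> T" .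

lemma val_eq_ssubt: "tm.val \<rho> t = ssubt \<rho> t"
  by (induction t) simp_all

text \<open>For a quantifier, the witness variable from \<open>T_witness\<close> has an odd name and
  so is an element of the term model; conversely, every element is a term that can be substituted
  without capture.\<close>

lemma truth: "wff D A \<Longrightarrow> tm.env \<rho> \<Longrightarrow> tm.sat \<rho> A \<longleftrightarrow> ssub dbl \<rho> A \<in> T"
proof (induction A arbitrary: \<rho>)
  case (Imp A B)
  have r: "wt D (\<rho> x) \<and> ty_of (\<rho> x) = snd x" for x
  proof -
    have "\<rho> x \<in> dom1 (snd x)" using Imp.prems(2) by (simp add: tm.env_def del: split_paired_All)
    then show ?thesis by (simp add: dom1_def)
  qed
  have "wff D (ssub dbl \<rho> A)" "wff D (ssub dbl \<rho> B)"
    using Imp.prems(1) r by (auto intro!: wff_ssub simp: dbl(2))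
  then show ?case using Imp by (simp add: T_Imp)
next
  case (All x A)
  let ?B = "ssub dbl (\<rho>(x := V (dbl x))) A"
  have r: "\<rho> y \<in> dom1 (snd y)" for y
    using All.prems(2) by (simp add: tm.env_def del: split_paired_All)
  have wB: "wff D ?B"
    by (rule wff_ssub) (use All.prems(1) r in \<open>auto simp: dbl(2) dom1_def\<close>)
  have sub: "subst (dbl x) d ?B = ssub dbl (\<rho>(x := d)) A \<and> free_for d (dbl x) ?B"
    if "d \<in> dom1 (snd x)" for d
  proof (rule subst_ssub[OF dbl(1)])
    show "dbl x \<notin> fvt (\<rho> y)" for y using r[of y] dbl(3)[of x] by (auto simp: dom1_def)
    show "dbl w \<noteq> dbl x \<and> dbl w \<notin> fvt d" if "w \<noteq> x" for w
      using that \<open>d \<in> dom1 (snd x)\<close> dbl(3)[of w] injD[OF dbl(1), of w x] by (auto simp: dom1_def)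
  qed
  have "(\<forall>d\<in>dom1 (snd x). subst (dbl x) d ?B \<in> T) \<longleftrightarrow> All (dbl x) ?B \<in> T"
  proof
    assume *: "\<forall>d\<in>dom1 (snd x). subst (dbl x) d ?B \<in> T"
    from wB have "wff D (All (dbl x) ?B)" by simp
    then obtain y where y: "snd y = snd (dbl x)" "odd (fst y)" "Imp (subst (dbl x) (V y) ?B) (All (dbl x) ?B) \<in> T"
      by (rule T_witness)
    then have "V y \<in> dom1 (snd x)" by (simp add: dom1_def dbl(2))
    then show "All (dbl x) ?B \<in> T" using * y(3) T_mp by blast
  next
    assume *: "All (dbl x) ?B \<in> T"
    show "\<forall>d\<in>dom1 (snd x). subst (dbl x) d ?B \<in> T"
    proof (rule ballI)
      fix d assume d: "d \<in> dom1 (snd x)"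
      then have p: "prov D (Imp (All (dbl x) ?B) (subst (dbl x) d ?B))"
        by (intro prov_inst[OF wB]) (use sub[OF d] in \<open>simp_all add: dom1_def dbl(2)\<close>)
      show "subst (dbl x) d ?B \<in> T" by (rule T_mp[OF T_prov[OF p] *])
    qed
  qed
  moreover have "tm.sat (\<rho>(x := d)) A \<longleftrightarrow> subst (dbl x) d ?B \<in> T" if d: "d \<in> dom1 (snd x)" for d
  proof -
    have "wff D A" using All.prems(1) by simp
    from All.IH[OF this tm.env_upd[OF All.prems(2) d]] show ?thesis
      unfolding sub[OF d, THEN conjunct1] .
  qed
  ultimately have "(\<forall>d\<in>dom1 (snd x). tm.sat (\<rho>(x := d)) A) \<longleftrightarrow> All (dbl x) ?B \<in> T"
    by (simp only: ball_simps cong: ball_cong)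
  then show ?case by (simp only: tm.sat.simps ssub.simps)
qed (simp_all add: val_eq_ssubt T_Bot)

text \<open>\<open>truth\<close> speaks of the renamed formula, derivability of the original one;
  alpha-conversion connects the two. For a sentence the values of \<open>\<rho>\<close> are
  irrelevant.\<close>

lemma prov_closed_ssub:
  assumes "wff D A" "fv A = {}"
  shows "prov D (Imp A (ssub dbl \<rho> A))"
proof -
  have "prov D (Imp (ssub (\<lambda>x. x) V A) (ssub dbl V A))"
    by (rule prov_alpha) (use assms dbl in auto)
  then show ?thesis using ssub_cong[of A V \<rho> dbl] assms(2) by simp
qed

lemma T_closed:
  assumes "A \<in> T" "fv A = {}" "tm.env \<rho>" shows "tm.sat \<rho> A"
proof -
  have "ssub dbl \<rho> A \<in> T"
    by (rule T_mp[OF T_prov[OF prov_closed_ssub[OF T_wff[OF assms(1)] assms(2)]] assms(1)])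
  then show ?thesis by (simp only: truth[OF T_wff[OF assms(1)] assms(3)])
qed

lemma prov_closure: "prov D A \<Longrightarrow> prov D (foldr All xs A)"
  by (induction xs) (simp_all add: prov_gen)

lemma fv_foldr_All: "fv (foldr All xs A) = fv A - set xs"
  by (induction xs) auto

text \<open>\<open>T_closed\<close> is limited to sentences, so an open theorem is first closed
  universally.\<close>

lemma tm_sound:
  assumes p: "prov D A" and e: "tm.env \<rho>" shows "tm.sat \<rho> A"
proof -
  obtain xs where xs: "set xs = fv A" using finite_list[OF finite_fv] by blast
  have "tm.sat \<rho> (foldr All xs A)"
    by (rule T_closed[OF T_prov[OF prov_closure[OF p]] _ e]) (simp add: fv_foldr_All xs)
  then show ?thesis by (rule tm.sat_foldr_All[OF _ e])
qed

end

sublocale henkin_theory \<subseteq> tm: pre_model dom1 App C "\<lambda>s t. Eq s t \<in> T" "\<lambda>t. St t \<in> T" D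
proof
  show "tm.sat \<rho> A" if "prov D A" "tm.env \<rho>" for A \<rho> using tm_sound that .
  show "\<exists>\<rho>. tm.env \<rho>"
    by (rule exI[of _ "\<lambda>x. V (Suc (2 * fst x), snd x)"]) (simp add: tm.env_def dom1_def)
qed (auto simp: dom1_def)

section \<open>The extensional quotient\<close>

lemma ty_of_monusT [simp]: "ty_of monusT = N \<rightarrow> N \<rightarrow> N" and wt_monusT [simp]: "wt D monusT"
  by (simp_all add: monusT_def predT_def rec_def Let_def)

lemma wff_leq [simp]: "wff D (leq s t) \<longleftrightarrow> wt D s \<and> wt D t \<and> ty_of s = N \<and> ty_of t = N"
  by (auto simp: leq_def ty_of_monusT wt_monusT)

lemma wff_lt [simp]: "wff D (lt s t) \<longleftrightarrow> wt D s \<and> wt D t \<and> ty_of s = N \<and> ty_of t = N"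
  by (auto simp: lt_def)

lemma wff_eqf: "wt D s \<Longrightarrow> wt D t \<Longrightarrow> ty_of s = \<tau> \<Longrightarrow> ty_of t = \<tau> \<Longrightarrow> wff D (eqf \<tau> s t)"
  by (induction \<tau> arbitrary: s t) (simp_all add: Let_def BAll_def)

lemma wff_eq: "wt D s \<Longrightarrow> wt D t \<Longrightarrow> ty_of t = ty_of s \<Longrightarrow> wff D (eq s t)"
  by (simp add: eq_def wff_eqf)

context pre_model
begin

section \<open>Extensional equality is a congruence\<close>

abbreviation v0 :: tm where "v0 \<equiv> V (0, N)"
abbreviation v1 :: tm where "v1 \<equiv> V (1, N)"
abbreviation v2 :: tm where "v2 \<equiv> V (2, N)"

lemma eqn_refl: "a \<in> dom N \<Longrightarrow> eqn a a"
proof -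
  obtain \<rho> where e: "env \<rho>" using env_ex by blast
  assume a: "a \<in> dom N"
  have "sat (\<rho>((0, N) := a)) (Eq v0 v0)"
    by (rule ax[OF RCA0\<Omega>_axiom.base[OF RCA0\<omega>_axiom.eq_refl]]) (simp_all add: e a)
  then show ?thesis by simp
qed

lemma eqn_sym: "eqn a b \<Longrightarrow> a \<in> dom N \<Longrightarrow> b \<in> dom N \<Longrightarrow> eqn b a"
proof -
  obtain \<rho> where e: "env \<rho>" using env_ex by blast
  assume a: "eqn a b" "a \<in> dom N" "b \<in> dom N"
  have "sat (\<rho>((0, N) := a, (1, N) := b)) (Imp (Eq v0 v1) (Eq v1 v0))"
    by (rule ax[OF RCA0\<Omega>_axiom.base[OF RCA0\<omega>_axiom.eq_sym]]) (simp_all add: e a)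
  then show ?thesis using a by simp
qed

lemma eqn_trans: "eqn a b \<Longrightarrow> eqn b c \<Longrightarrow> a \<in> dom N \<Longrightarrow> b \<in> dom N \<Longrightarrow> c \<in> dom N \<Longrightarrow> eqn a c"
proof -
  obtain \<rho> where e: "env \<rho>" using env_ex by blast
  assume a: "eqn a b" "eqn b c" "a \<in> dom N" "b \<in> dom N" "c \<in> dom N"
  have "sat (\<rho>((0, N) := a, (1, N) := b, (2, N) := c)) (Imp (Eq v0 v1) (Imp (Eq v1 v2) (Eq v0 v2)))"
    by (rule ax[OF RCA0\<Omega>_axiom.base[OF RCA0\<omega>_axiom.eq_trans]]) (simp_all add: e a)
  then show ?thesis using a by simp
qed

lemma ex_arg:
  assumes "u \<in> dom (\<sigma> \<rightarrow> \<tau>)" "a \<in> dom \<sigma>" "b \<in> dom \<sigma>" "ex \<sigma> a b"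
  shows "ex \<tau> (u \<odot> a) (u \<odot> b)"
proof -
  obtain \<rho> where e: "env \<rho>" using env_ex by blast
  let ?\<rho> = "\<rho>((0, \<sigma>) := a, (1, \<sigma>) := b, (2, \<sigma> \<rightarrow> \<tau>) := u)"
  let ?s = "V (0, \<sigma>)" and ?t = "V (1, \<sigma>)" and ?u = "V (2, \<sigma> \<rightarrow> \<tau>)"
  let ?A = "Imp (eq ?s ?t) (eq (?u \<cdot> ?s) (?u \<cdot> ?t))"
  have "env ?\<rho>" by (simp add: e assms)
  moreover have "wff D ?A" by (simp add: wff_eq)
  ultimately have "sat ?\<rho> ?A"
    by (intro ax[OF RCA0\<Omega>_axiom.base[OF RCA0\<omega>_axiom.extensionality]])
  then show ?thesis using assms(4) by (simp add: sat_eq)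
qed

lemma LT_iff: "LT i n \<longleftrightarrow> eqn (val \<rho> monusT \<odot> (cs Succ \<odot> i) \<odot> n) (cs Zero)"
  using val_closed[OF fvt_monusT, of \<rho> "(\<lambda>_. n)((0, N) := i)"] by (simp add: LT_def lt_def leq_def)

lemma Zero_dom: "cs Zero \<in> dom N"
  and Succ_dom: "a \<in> dom N \<Longrightarrow> cs Succ \<odot> a \<in> dom N"
  and Len_dom: "s \<in> dom (Sq \<sigma>) \<Longrightarrow> cs (Len \<sigma>) \<odot> s \<in> dom N"
  and Proj_dom: "s \<in> dom (Sq \<sigma>) \<Longrightarrow> i \<in> dom N \<Longrightarrow> cs (Proj \<sigma>) \<odot> s \<odot> i \<in> dom \<sigma>"
  using cs_type[of Zero] ap_type[OF cs_type[of Succ, simplified]]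
    ap_type[OF cs_type[of "Len \<sigma>", simplified]] ap_type[OF ap_type[OF cs_type[of "Proj \<sigma>", simplified]]]
  by simp_all

text \<open>The bound in \<open>ex\<close> at a sequence type is the length of the left argument.
  Symmetry and transitivity have to exchange it for an equal length, and equality is not yet
  identity here.\<close>

lemma LT_cong:
  assumes "eqn n m" "LT i n" "i \<in> dom N" "n \<in> dom N" "m \<in> dom N" shows "LT i m"
proof -
  obtain \<rho> where e: "env \<rho>" using env_ex by blast
  let ?u = "val \<rho> monusT \<odot> (cs Succ \<odot> i)"
  have u: "?u \<in> dom (N \<rightarrow> N)"
    using val_type[OF wt_monusT e] ap_type Succ_dom[OF assms(3)] by (simp add: ty_of_monusT)
  have "eqn (?u \<odot> m) (?u \<odot> n)"
    using ex_arg[OF u assms(5,4)] eqn_sym[OF assms(1,4,5)] by simp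
  then show ?thesis
    using eqn_trans assms(2) ap_type[OF u assms(4)] ap_type[OF u assms(5)] Zero_dom
    unfolding LT_iff[of _ _ \<rho>] by blast
qed

lemma ex_refl: "a \<in> dom \<tau> \<Longrightarrow> ex \<tau> a a"
  by (induction \<tau> arbitrary: a) (simp_all add: eqn_refl ap_type Len_dom Proj_dom)

lemma ex_sym: "ex \<tau> a b \<Longrightarrow> a \<in> dom \<tau> \<Longrightarrow> b \<in> dom \<tau> \<Longrightarrow> ex \<tau> b a"
proof (induction \<tau> arbitrary: a b)
  case N
  then show ?case by (simp add: eqn_sym)
next
  case (Fn \<sigma> \<tau>)
  then show ?case by (simp add: ap_type)
next
  case (Sq \<sigma>)
  have l: "eqn (cs (Len \<sigma>) \<odot> b) (cs (Len \<sigma>) \<odot> a)"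
    using Sq.prems by (simp add: eqn_sym Len_dom)
  have "ex \<sigma> (cs (Proj \<sigma>) \<odot> b \<odot> i) (cs (Proj \<sigma>) \<odot> a \<odot> i)"
    if "i \<in> dom N" "LT i (cs (Len \<sigma>) \<odot> b)" for i
    using LT_cong[OF l that(2,1)] that Sq by (simp add: Len_dom Proj_dom)
  with l show ?case by simp
qed

lemma ex_trans: "ex \<tau> a b \<Longrightarrow> ex \<tau> b c \<Longrightarrow> a \<in> dom \<tau> \<Longrightarrow> b \<in> dom \<tau> \<Longrightarrow> c \<in> dom \<tau> \<Longrightarrow> ex \<tau> a c"
proof (induction \<tau> arbitrary: a b c)
  case N
  then show ?case unfolding ex.simps using eqn_trans by blast
next
  case (Fn \<sigma> \<tau>)
  show ?case unfolding ex.simps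
  proof
    fix d assume d: "d \<in> dom \<sigma>"
    show "ex \<tau> (a \<odot> d) (c \<odot> d)"
      using Fn.prems d by (intro Fn.IH(2)[of "a \<odot> d" "b \<odot> d" "c \<odot> d"]) (simp_all add: ap_type)
  qed
next
  case (Sq \<sigma>)
  have l: "eqn (cs (Len \<sigma>) \<odot> a) (cs (Len \<sigma>) \<odot> b)" "eqn (cs (Len \<sigma>) \<odot> b) (cs (Len \<sigma>) \<odot> c)"
    using Sq.prems by simp_all
  have "ex \<sigma> (cs (Proj \<sigma>) \<odot> a \<odot> i) (cs (Proj \<sigma>) \<odot> c \<odot> i)"
    if i: "i \<in> dom N" "LT i (cs (Len \<sigma>) \<odot> a)" for i
  proof (rule Sq.IH)
    show "ex \<sigma> (cs (Proj \<sigma>) \<odot> a \<odot> i) (cs (Proj \<sigma>) \<odot> b \<odot> i)" using Sq.prems i by simp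
    have "LT i (cs (Len \<sigma>) \<odot> b)" using LT_cong[OF l(1) i(2,1)] Sq.prems by (simp add: Len_dom)
    then show "ex \<sigma> (cs (Proj \<sigma>) \<odot> b \<odot> i) (cs (Proj \<sigma>) \<odot> c \<odot> i)" using Sq.prems i by simp
  qed (use i Sq.prems in \<open>simp_all add: Proj_dom\<close>)
  moreover have "eqn (cs (Len \<sigma>) \<odot> a) (cs (Len \<sigma>) \<odot> c)"
    by (rule eqn_trans[OF l]) (use Sq.prems in \<open>simp_all add: Len_dom\<close>)
  ultimately show ?case by simp
qed

lemma ex_ap:
  assumes "ex (\<sigma> \<rightarrow> \<tau>) f g" "ex \<sigma> a b" "f \<in> dom (\<sigma> \<rightarrow> \<tau>)" "g \<in> dom (\<sigma> \<rightarrow> \<tau>)" "a \<in> dom \<sigma>" "b \<in> dom \<sigma>"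
  shows "ex \<tau> (f \<odot> a) (g \<odot> b)"
proof (rule ex_trans)
  show "ex \<tau> (f \<odot> a) (g \<odot> a)" using assms by simp
  show "ex \<tau> (g \<odot> a) (g \<odot> b)" using assms(4,5,6,2) by (rule ex_arg)
qed (use assms ap_type in blast)+

lemma ex_st:
  assumes "ex \<sigma> a b" "st a" "a \<in> dom \<sigma>" "b \<in> dom \<sigma>" shows "st b"
proof -
  obtain \<rho> where e: "env \<rho>" using env_ex by blast
  let ?\<rho> = "\<rho>((0, \<sigma>) := a, (1, \<sigma>) := b)"
  let ?s = "V (0, \<sigma>)" and ?t = "V (1, \<sigma>)"
  have "sat ?\<rho> (Imp (And (St ?s) (eq ?s ?t)) (St ?t))"
    by (rule ax[OF RCA0\<Omega>_axiom.st_eq]) (simp_all add: e assms wff_eq)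
  then show ?thesis using assms by (simp add: sat_eq)
qed

text \<open>The tag keeps elements of different types apart and tells \<open>qap\<close> the type of
  the result.\<close>

definition cls :: "ty \<Rightarrow> 'a \<Rightarrow> ty \<times> 'a set" where "cls \<tau> a = (\<tau>, {b \<in> dom \<tau>. ex \<tau> a b})"

definition rep_of :: "ty \<times> 'a set \<Rightarrow> 'a" where "rep_of x = (SOME a. a \<in> snd x)"

definition qdom :: "ty \<Rightarrow> (ty \<times> 'a set) set" where "qdom \<tau> = cls \<tau> ` dom \<tau>"

definition qap :: "ty \<times> 'a set \<Rightarrow> ty \<times> 'a set \<Rightarrow> ty \<times> 'a set" where
  "qap x y = (case fst x of \<sigma> \<rightarrow> \<tau> \<Rightarrow> cls \<tau> (rep_of x \<odot> rep_of y) | _ \<Rightarrow> x)"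

definition qcs :: "const \<Rightarrow> ty \<times> 'a set" where "qcs c = cls (const_ty c) (cs c)"

definition qst :: "ty \<times> 'a set \<Rightarrow> bool" where "qst x \<longleftrightarrow> st (rep_of x)"

lemma ball_qdom: "(\<forall>x\<in>qdom \<tau>. P x) \<longleftrightarrow> (\<forall>a\<in>dom \<tau>. P (cls \<tau> a))"
  by (simp add: qdom_def)

lemma cls_eq_iff:
  assumes ab: "a \<in> dom \<tau>" "b \<in> dom \<tau>"
  shows "cls \<tau> a = cls \<tau> b \<longleftrightarrow> ex \<tau> a b"
proof
  assume "cls \<tau> a = cls \<tau> b"
  then have "{c \<in> dom \<tau>. ex \<tau> a c} = {c \<in> dom \<tau>. ex \<tau> b c}" by (simp add: cls_def)
  with ab ex_refl[OF ab(2)] show "ex \<tau> a b" by blast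
next
  assume e: "ex \<tau> a b"
  have "ex \<tau> a c \<longleftrightarrow> ex \<tau> b c" if "c \<in> dom \<tau>" for c
    using ex_trans[OF e _ ab that] ex_trans[OF ex_sym[OF e ab] _ ab(2,1) that] by blast
  then have "{c \<in> dom \<tau>. ex \<tau> a c} = {c \<in> dom \<tau>. ex \<tau> b c}" by (simp cong: conj_cong)
  then show "cls \<tau> a = cls \<tau> b" by (simp only: cls_def)
qed

lemma rep_of_cls:
  assumes "a \<in> dom \<tau>" shows "rep_of (cls \<tau> a) \<in> dom \<tau>" "ex \<tau> a (rep_of (cls \<tau> a))"
proof -
  have "rep_of (cls \<tau> a) \<in> {b \<in> dom \<tau>. ex \<tau> a b}"
    unfolding rep_of_def cls_def snd_conv by (rule someI[of _ a]) (simp add: assms ex_refl)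
  then show "rep_of (cls \<tau> a) \<in> dom \<tau>" "ex \<tau> a (rep_of (cls \<tau> a))" by simp_all
qed

lemma qap_cls:
  assumes "f \<in> dom (\<sigma> \<rightarrow> \<tau>)" "a \<in> dom \<sigma>"
  shows "qap (cls (\<sigma> \<rightarrow> \<tau>) f) (cls \<sigma> a) = cls \<tau> (f \<odot> a)"
proof -
  have "qap (cls (\<sigma> \<rightarrow> \<tau>) f) (cls \<sigma> a) = cls \<tau> (rep_of (cls (\<sigma> \<rightarrow> \<tau>) f) \<odot> rep_of (cls \<sigma> a))"
    by (simp add: qap_def cls_def)
  also have "\<dots> = cls \<tau> (f \<odot> a)"
  proof (subst cls_eq_iff)
    show "ex \<tau> (rep_of (cls (\<sigma> \<rightarrow> \<tau>) f) \<odot> rep_of (cls \<sigma> a)) (f \<odot> a)"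
      by (rule ex_ap[OF ex_sym[OF rep_of_cls(2)[OF assms(1)]] ex_sym[OF rep_of_cls(2)[OF assms(2)]]])
        (simp_all add: assms rep_of_cls(1))
  qed (rule ap_type[OF rep_of_cls(1)[OF assms(1)] rep_of_cls(1)[OF assms(2)]] ap_type[OF assms])+
  finally show ?thesis .
qed

lemma qst_cls: "a \<in> dom \<tau> \<Longrightarrow> qst (cls \<tau> a) \<longleftrightarrow> st a"
  unfolding qst_def using rep_of_cls[of a \<tau>] ex_st[of \<tau> a "rep_of (cls \<tau> a)"]
    ex_st[of \<tau> "rep_of (cls \<tau> a)" a] ex_sym[of \<tau> a "rep_of (cls \<tau> a)"] by blast

interpretation q: interp qdom qap qcs "(=)" qst .

lemma qval: "wt D t \<Longrightarrow> env \<rho> \<Longrightarrow> q.val (\<lambda>x. cls (snd x) (\<rho> x)) t = cls (ty_of t) (val \<rho> t)"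
proof (induction t)
  case (App s t)
  then obtain \<tau> where "ty_of s = (ty_of t \<rightarrow> \<tau>)" by auto
  with App val_type[of s \<rho>] val_type[of t \<rho>] show ?case by (simp add: qap_cls)
qed (simp_all add: qcs_def)

lemma qsat: "wff D A \<Longrightarrow> env \<rho> \<Longrightarrow> q.sat (\<lambda>x. cls (snd x) (\<rho> x)) A \<longleftrightarrow> sat \<rho> A"
proof (induction A arbitrary: \<rho>)
  case (Eq s t)
  then show ?case using val_type[of s \<rho>] val_type[of t \<rho>] by (simp add: qval cls_eq_iff)
next
  case (St t)
  then show ?case using val_type[of t \<rho>] by (simp add: qval qst_cls)
next
  case (All x A)
  have "q.sat ((\<lambda>y. cls (snd y) (\<rho> y))(x := cls (snd x) d)) A \<longleftrightarrow> sat (\<rho>(x := d)) A"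
    if d: "d \<in> dom (snd x)" for d
  proof -
    have e: "(\<lambda>y. cls (snd y) (\<rho> y))(x := cls (snd x) d) = (\<lambda>y. cls (snd y) ((\<rho>(x := d)) y))"
      by (rule HOL.ext) simp
    have "wff D A" using All.prems(1) by simp
    then show ?thesis unfolding e by (rule All.IH[OF _ env_upd[OF All.prems(2) d]])
  qed
  then show ?case by (simp add: ball_qdom)
qed simp_all

lemma q_env: "q.env r \<Longrightarrow> \<exists>\<rho>. env \<rho> \<and> r = (\<lambda>x. cls (snd x) (\<rho> x))"
proof -
  assume "q.env r"
  then have "\<forall>x. \<exists>a. a \<in> dom (snd x) \<and> r x = cls (snd x) a"
    unfolding q.env_def qdom_def by blast
  then obtain \<rho> where "\<forall>x. \<rho> x \<in> dom (snd x) \<and> r x = cls (snd x) (\<rho> x)" by metis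
  then show ?thesis unfolding env_def by (intro exI[of _ \<rho>]) (auto simp del: split_paired_All)
qed

lemma q_env_cls: "env \<rho> \<Longrightarrow> q.env (\<lambda>x. cls (snd x) (\<rho> x))"
  unfolding q.env_def env_def by (simp add: qdom_def del: split_paired_All)

lemma model_quotient: "model qdom qap qcs qst D"
proof
  show "qap f a \<in> qdom \<tau>" if "f \<in> qdom (\<sigma> \<rightarrow> \<tau>)" "a \<in> qdom \<sigma>" for f \<sigma> \<tau> a
    using that by (auto simp: qdom_def qap_cls ap_type)
  show "qcs c \<in> qdom (const_ty c)" if "wt D (C c)" for c
    using cs_type[OF that] by (simp add: qcs_def qdom_def)
  show "q.sat r A" if "prov D A" "q.env r" for A r
    using q_env[OF that(2)] sound[OF that(1)] qsat[OF wff_deriv[OF that(1)]] by auto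
  show "\<exists>r. q.env r" using env_ex q_env_cls by blast
  show "a = b" if ab: "a \<in> qdom \<sigma>" "b \<in> qdom \<sigma>" "q.ex \<sigma> a b" for a b \<sigma>
  proof -
    obtain r where r: "env r" using env_ex by blast
    obtain a' b' where a': "a' \<in> dom \<sigma>" "a = cls \<sigma> a'" and b': "b' \<in> dom \<sigma>" "b = cls \<sigma> b'"
      using ab by (auto simp: qdom_def)
    define \<rho> where "\<rho> = r((0, \<sigma>) := a', (1, \<sigma>) := b')"
    have \<rho>: "env \<rho>" "\<rho> (0, \<sigma>) = a'" "\<rho> (1, \<sigma>) = b'"
      by (simp_all add: \<rho>_def r a' b')
    \<comment> \<open>Extensional equality is expressed by a formula, so \<open>qsat\<close> carries
      it over to the quotient without an induction on the type.\<close>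
    let ?A = "eq (V (0, \<sigma>)) (V (1, \<sigma>))"
    have "q.sat (\<lambda>x. cls (snd x) (\<rho> x)) ?A \<longleftrightarrow> sat \<rho> ?A"
      by (rule qsat[OF _ \<rho>(1)]) (simp add: wff_eq)
    then have "q.ex \<sigma> a b \<longleftrightarrow> ex \<sigma> a' b'"
      by (simp add: q.sat_eq sat_eq a'(2) b'(2) \<rho>(2,3) del: One_nat_def)
    then show "a = b" using ab(3) cls_eq_iff a' b' by simp
  qed
qed

end

text \<open>The countermodel to an unprovable sentence is the quotient of the term model for its
  negation, so validity is demanded on the carrier type of that quotient alone.\<close>

theorem completeness:
  assumes "wff D A" "fv A = {}"
    and valid: "\<And>dom ap cs st \<rho>. model (dom :: ty \<Rightarrow> (ty \<times> tm set) set) ap cs st D \<Longrightarrow>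
      interp.env dom \<rho> \<Longrightarrow> interp.sat dom ap cs (=) st \<rho> A"
  shows "prov D A"
proof (rule ccontr)
  assume "\<not> prov D A"
  then have "consistent D (Neg A)"
    using assms(1) prov_mp[OF prov_dn[OF assms(1)]] by (auto simp: consistent_def Neg_def)
  then interpret henkin_theory D "Neg A" by unfold_locales
  obtain \<rho> where e: "tm.env \<rho>" using tm.env_ex by blast
  then have "tm.sat \<rho> (Neg A)" using T_closed[OF T_base] assms(2) by simp
  then have "\<not> interp.sat tm.qdom tm.qap tm.qcs (=) tm.qst (\<lambda>x. tm.cls (snd x) (\<rho> x)) A"
    using tm.qsat[OF assms(1) e] by simp
  then show False using valid[OF tm.model_quotient tm.q_env_cls[OF e]] by blast
qed

section \<open>Combinatory terms in a model\<close>

lemma ty_lam [simp]: "ty_of (lam x t) = (snd x \<rightarrow> ty_of t)"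
  by (induction t) auto

lemma wt_lam [simp]: "wt D t \<Longrightarrow> wt D (lam x t)"
proof (induction t)
  case (C c)
  then show ?case by (cases c) auto
qed auto

lemma fvt_lam [simp]: "fvt (lam x t) = fvt t - {x}"
  by (induction t) auto

declare lam.simps [simp del]

definition nsgT :: tm where
  "nsgT = (let n = (0, N); r = (1, N); k = (2, N) in lam n (rec (V n) (suc zero) (lam r (lam k zero))))"

definition sgT :: tm where
  "sgT = (let n = (0, N); r = (1, N); k = (2, N) in lam n (rec (V n) zero (lam r (lam k (suc zero)))))"

definition condT :: tm where
  "condT = (let a = (0, N); b = (1, N); c = (2, N); r = (3, N); k = (4, N) in
     lam a (lam b (lam c (rec (V a) (V b) (lam r (lam k (V c)))))))"

definition sumT :: tm where
  "sumT = (let f = (0, T1); n = (1, N); r = (2, N); k = (3, N) in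
     lam f (lam n (rec (V n) zero (lam r (lam k (plusT \<cdot> V r \<cdot> (V f \<cdot> V k)))))))"

context pre_model
begin

text \<open>An arbitrary well-typed environment; closed terms, for which \<open>cv\<close> is meant,
  do not depend on it.\<close>

definition e0 :: "var \<Rightarrow> 'a" where "e0 = (SOME \<rho>. env \<rho>)"

lemma env_e0 [simp]: "env e0"
  unfolding e0_def using env_ex by (rule someI_ex)

definition cv :: "tm \<Rightarrow> 'a" where "cv t = val e0 t"

lemma cv_type: "wt D t \<Longrightarrow> cv t \<in> dom (ty_of t)"
  by (simp add: cv_def val_type)

lemma val_cv: "fvt t = {} \<Longrightarrow> val \<rho> t = cv t"
  unfolding cv_def by (rule val_closed)

lemma val_dom [simp]: "wt D t \<Longrightarrow> ty_of t = \<tau> \<Longrightarrow> env \<rho> \<Longrightarrow> val \<rho> t \<in> dom \<tau>"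
  using val_type by blast

lemma cv_st: "wt D t \<Longrightarrow> fvt t = {} \<Longrightarrow> st (cv t)"
  using ax[OF RCA0\<Omega>_axiom.st_closed, of t e0] by (simp add: cv_def)

lemma st_ap:
  assumes "st f" "st a" "f \<in> dom (\<sigma> \<rightarrow> \<tau>)" "a \<in> dom \<sigma>" shows "st (f \<odot> a)"
proof -
  let ?f = "V (0, \<sigma> \<rightarrow> \<tau>)" and ?a = "V (1, \<sigma>)"
  have "sat (e0((0, \<sigma> \<rightarrow> \<tau>) := f, (1, \<sigma>) := a)) (Imp (And (St ?f) (St ?a)) (St (?f \<cdot> ?a)))"
    by (rule ax[OF RCA0\<Omega>_axiom.st_app]) (simp_all add: assms)
  then show ?thesis using assms by simp
qed

end

context model
begin

lemma ex_iff: "a \<in> dom \<sigma> \<Longrightarrow> b \<in> dom \<sigma> \<Longrightarrow> ex \<sigma> a b \<longleftrightarrow> a = b"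
  using ex_eq ex_refl by blast

lemma funext:
  assumes "f \<in> dom (\<sigma> \<rightarrow> \<tau>)" "g \<in> dom (\<sigma> \<rightarrow> \<tau>)" "\<And>a. a \<in> dom \<sigma> \<Longrightarrow> f \<odot> a = g \<odot> a"
  shows "f = g"
  by (rule ex_eq[OF assms(1,2)]) (use assms(3) ex_refl[OF ap_type[OF assms(2)]] in simp)

lemma sat_eq_iff:
  "wt D s \<Longrightarrow> wt D t \<Longrightarrow> ty_of t = ty_of s \<Longrightarrow> env \<rho> \<Longrightarrow> sat \<rho> (eq s t) \<longleftrightarrow> val \<rho> s = val \<rho> t"
  by (simp add: sat_eq ex_iff)

lemma K_eq:
  assumes "a \<in> dom \<sigma>" "b \<in> dom \<tau>" shows "cs (K \<sigma> \<tau>) \<odot> a \<odot> b = a"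
proof -
  define \<rho> where "\<rho> = e0((0, \<sigma>) := a, (1, \<tau>) := b)"
  have \<rho>: "env \<rho>" "\<rho> (0, \<sigma>) = a" "\<rho> (1, \<tau>) = b" by (simp_all add: \<rho>_def assms)
  have "sat \<rho> (eq (C (K \<sigma> \<tau>) \<cdot> V (0, \<sigma>) \<cdot> V (1, \<tau>)) (V (0, \<sigma>)))"
    by (rule ax[OF RCA0\<Omega>_axiom.base[OF RCA0\<omega>_axiom.comb_K] _ \<rho>(1)]) (simp add: wff_eq)
  then show ?thesis using \<rho> by (simp add: sat_eq_iff)
qed

lemma S_eq:
  assumes "a \<in> dom (\<rho> \<rightarrow> \<sigma> \<rightarrow> \<tau>)" "b \<in> dom (\<rho> \<rightarrow> \<sigma>)" "c \<in> dom \<rho>"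
  shows "cs (S \<rho> \<sigma> \<tau>) \<odot> a \<odot> b \<odot> c = a \<odot> c \<odot> (b \<odot> c)"
proof -
  let ?a = "(0, \<rho> \<rightarrow> \<sigma> \<rightarrow> \<tau>)" and ?b = "(1, \<rho> \<rightarrow> \<sigma>)" and ?c = "(2, \<rho>)"
  define e where "e = e0(?a := a, ?b := b, ?c := c)"
  have e: "env e" "e ?a = a" "e ?b = b" "e ?c = c" by (simp_all add: e_def assms)
  have "sat e (eq (C (S \<rho> \<sigma> \<tau>) \<cdot> V ?a \<cdot> V ?b \<cdot> V ?c) (V ?a \<cdot> V ?c \<cdot> (V ?b \<cdot> V ?c)))"
    by (rule ax[OF RCA0\<Omega>_axiom.base[OF RCA0\<omega>_axiom.comb_S] _ e(1)]) (simp add: wff_eq)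
  then show ?thesis using e by (simp add: sat_eq_iff)
qed

text \<open>Beta-conversion for bracket abstraction: \<open>S K K\<close> acts as the identity,
  \<open>K\<close> absorbs the argument where \<open>x\<close> does not occur, and \<open>S\<close>
  distributes it over an application.\<close>

lemma val_lam [simp]:
  "wt D t \<Longrightarrow> env \<rho> \<Longrightarrow> d \<in> dom (snd x) \<Longrightarrow> val \<rho> (lam x t) \<odot> d = val (\<rho>(x := d)) t"
proof (induction t)
  case (V y)
  have I: "cs (S \<sigma> (\<sigma> \<rightarrow> \<sigma>) \<sigma>) \<odot> cs (K \<sigma> (\<sigma> \<rightarrow> \<sigma>)) \<odot> cs (K \<sigma> \<sigma>) \<odot> d = d" if "d \<in> dom \<sigma>" for \<sigma> d
  proof -
    have k: "cs (K \<sigma> (\<sigma> \<rightarrow> \<sigma>)) \<in> dom (\<sigma> \<rightarrow> (\<sigma> \<rightarrow> \<sigma>) \<rightarrow> \<sigma>)" "cs (K \<sigma> \<sigma>) \<in> dom (\<sigma> \<rightarrow> \<sigma> \<rightarrow> \<sigma>)"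
      using cs_type[of "K \<sigma> (\<sigma> \<rightarrow> \<sigma>)"] cs_type[of "K \<sigma> \<sigma>"] by simp_all
    show ?thesis using S_eq[OF k that] K_eq[OF that ap_type[OF k(2) that]] by simp
  qed
  have "\<rho> y \<in> dom (snd y)" using V(2) unfolding env_def by blast
  then show ?case using V I K_eq by (simp add: lam.simps)
next
  case (C c)
  then show ?case using K_eq[OF cs_type[OF C(1)]] by (simp add: lam.simps)
next
  case (App s t)
  show ?case
  proof (cases "x \<in> fvt (s \<cdot> t)")
    case True
    obtain \<tau> where \<tau>: "ty_of s = ty_of t \<rightarrow> \<tau>" "wt D s" "wt D t" using App.prems(1) by auto
    have "val \<rho> (lam x s) \<in> dom (snd x \<rightarrow> ty_of t \<rightarrow> \<tau>)" "val \<rho> (lam x t) \<in> dom (snd x \<rightarrow> ty_of t)"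
      using \<tau> App.prems(2) by simp_all
    from S_eq[OF this App.prems(3)] True App \<tau> show ?thesis by (auto simp: lam.simps)
  next
    case False
    have "val \<rho> (s \<cdot> t) \<in> dom (ty_of (s \<cdot> t))" using App.prems val_type by blast
    note K_eq[OF this App.prems(3)]
    moreover have "val (\<rho>(x := d)) (s \<cdot> t) = val \<rho> (s \<cdot> t)" using False by (intro val_cong) auto
    moreover have "val \<rho> (lam x (s \<cdot> t)) = cs (K (ty_of (s \<cdot> t)) (snd x)) \<odot> val \<rho> (s \<cdot> t)"
      using False by (simp only: lam.simps if_False val.simps)
    ultimately show ?thesis by (simp only:)
  qed
qed

lemma cv_lam: "wt D t \<Longrightarrow> d \<in> dom (snd x) \<Longrightarrow> cv (lam x t) \<odot> d = val (e0(x := d)) t"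
  by (simp add: cv_def)

section \<open>Arithmetic in a model\<close>

abbreviation Num :: "'a set" where "Num \<equiv> dom N"
abbreviation Z :: 'a where "Z \<equiv> cs Zero"
abbreviation Su :: "'a \<Rightarrow> 'a" where "Su a \<equiv> cs Succ \<odot> a"
abbreviation Rc :: "'a \<Rightarrow> 'a \<Rightarrow> 'a \<Rightarrow> 'a" where "Rc n b h \<equiv> cs Rec \<odot> n \<odot> b \<odot> h"

declare Zero_dom [simp] Succ_dom [simp]

lemma Rc_Z [simp]: "b \<in> Num \<Longrightarrow> h \<in> dom (N \<rightarrow> N \<rightarrow> N) \<Longrightarrow> Rc Z b h = b"
proof -
  assume a: "b \<in> Num" "h \<in> dom (N \<rightarrow> N \<rightarrow> N)"
  let ?h = "(1, N \<rightarrow> N \<rightarrow> N)"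
  define e where "e = e0((0, N) := b, ?h := h)"
  have e: "env e" "e (0, N) = b" "e ?h = h" by (simp_all add: e_def a)
  have "sat e (Eq (rec zero (V (0, N)) (V ?h)) (V (0, N)))"
    by (rule ax[OF RCA0\<Omega>_axiom.base[OF RCA0\<omega>_axiom.rec_zero] _ e(1)]) (simp add: rec_def)
  then show ?thesis using e by (simp add: rec_def)
qed

lemma Rc_Su [simp]: "n \<in> Num \<Longrightarrow> b \<in> Num \<Longrightarrow> h \<in> dom (N \<rightarrow> N \<rightarrow> N) \<Longrightarrow> Rc (Su n) b h = h \<odot> Rc n b h \<odot> n"
proof -
  assume a: "n \<in> Num" "b \<in> Num" "h \<in> dom (N \<rightarrow> N \<rightarrow> N)"
  let ?h = "(1, N \<rightarrow> N \<rightarrow> N)"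
  define e where "e = e0((0, N) := b, ?h := h, (2, N) := n)"
  have e: "env e" "e (0, N) = b" "e ?h = h" "e (2, N) = n" by (simp_all add: e_def a)
  have "sat e (Eq (rec (suc (V (2, N))) (V (0, N)) (V ?h)) (V ?h \<cdot> rec (V (2, N)) (V (0, N)) (V ?h) \<cdot> V (2, N)))"
    by (rule ax[OF RCA0\<Omega>_axiom.base[OF RCA0\<omega>_axiom.rec_suc] _ e(1)]) (simp add: rec_def)
  then show ?thesis using e by (simp add: rec_def)
qed

lemma Rc_dom [simp]:
  assumes "n \<in> Num" "b \<in> Num" "h \<in> dom (N \<rightarrow> N \<rightarrow> N)" shows "Rc n b h \<in> Num"
proof -
  have "cs Rec \<in> dom (N \<rightarrow> N \<rightarrow> (N \<rightarrow> N \<rightarrow> N) \<rightarrow> N)" using cs_type[of Rec] by simp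
  then show ?thesis using assms by (blast intro: ap_type)
qed

lemma Su_Z [simp]: "a \<in> Num \<Longrightarrow> Su a \<noteq> Z"
proof -
  assume a: "a \<in> Num"
  have "sat (e0((0, N) := a)) (Neg (Eq (suc v0) zero))"
    by (rule ax[OF RCA0\<Omega>_axiom.base[OF RCA0\<omega>_axiom.suc_not_zero]]) (simp_all add: a)
  then show ?thesis by simp
qed

lemma Su_inj [simp]: "a \<in> Num \<Longrightarrow> b \<in> Num \<Longrightarrow> Su a = Su b \<longleftrightarrow> a = b"
proof -
  assume a: "a \<in> Num" "b \<in> Num"
  have "sat (e0((0, N) := a, (1, N) := b)) (Imp (Eq (suc v0) (suc v1)) (Eq v0 v1))"
    by (rule ax[OF RCA0\<Omega>_axiom.base[OF RCA0\<omega>_axiom.suc_inj]]) (simp_all add: a)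
  then show ?thesis by auto
qed

text \<open>Induction formulas contain terms of the object language, so functions of HOL may enter
  them only through functionals of the model that serve as parameters.\<close>

definition Rep :: "ty \<Rightarrow> ty \<Rightarrow> ('a \<Rightarrow> 'a) \<Rightarrow> bool" where
  "Rep \<sigma> \<tau> f \<longleftrightarrow> (\<exists>F\<in>dom (\<sigma> \<rightarrow> \<tau>). \<forall>a\<in>dom \<sigma>. F \<odot> a = f a)"

lemma Rep_val:
  assumes "wt D t" "env \<rho>" shows "Rep (snd x) (ty_of t) (\<lambda>a. val (\<rho>(x := a)) t)"
  unfolding Rep_def by (rule bexI[of _ "val \<rho> (lam x t)"]) (simp_all add: assms)

lemma Rep_const: "c \<in> dom \<tau> \<Longrightarrow> Rep \<sigma> \<tau> (\<lambda>a. c)"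
proof -
  assume "c \<in> dom \<tau>"
  then have "env (e0((0, \<tau>) := c))" by simp
  from Rep_val[OF _ this, of "V (0, \<tau>)" "(1, \<sigma>)"] show ?thesis by simp
qed

lemma Rep_id: "Rep \<sigma> \<sigma> (\<lambda>a. a)"
  using Rep_val[OF _ env_e0, of "V (0, \<sigma>)" "(0, \<sigma>)"] by simp

lemma Rep_app:
  assumes "Rep \<sigma> (\<rho> \<rightarrow> \<tau>) f" "Rep \<sigma> \<rho> g" shows "Rep \<sigma> \<tau> (\<lambda>a. f a \<odot> g a)"
proof -
  obtain F G where F: "F \<in> dom (\<sigma> \<rightarrow> \<rho> \<rightarrow> \<tau>)" "\<And>a. a \<in> dom \<sigma> \<Longrightarrow> F \<odot> a = f a"
    and G: "G \<in> dom (\<sigma> \<rightarrow> \<rho>)" "\<And>a. a \<in> dom \<sigma> \<Longrightarrow> G \<odot> a = g a"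
    using assms unfolding Rep_def by blast
  have "cs (S \<sigma> \<rho> \<tau>) \<odot> F \<odot> G \<in> dom (\<sigma> \<rightarrow> \<tau>)"
    using ap_type[OF ap_type[OF cs_type[of "S \<sigma> \<rho> \<tau>", simplified] F(1)] G(1)] .
  then show ?thesis unfolding Rep_def
    by (rule bexI[rotated]) (simp add: S_eq[OF F(1) G(1)] F(2) G(2))
qed

lemma Rep_app1: "F \<in> dom (\<rho> \<rightarrow> \<tau>) \<Longrightarrow> Rep \<sigma> \<rho> g \<Longrightarrow> Rep \<sigma> \<tau> (\<lambda>a. F \<odot> g a)"
  by (rule Rep_app[OF Rep_const])

lemma Rep_app2: "F \<in> dom (\<rho> \<rightarrow> \<rho>' \<rightarrow> \<tau>) \<Longrightarrow> Rep \<sigma> \<rho> f \<Longrightarrow> Rep \<sigma> \<rho>' g \<Longrightarrow> Rep \<sigma> \<tau> (\<lambda>a. F \<odot> f a \<odot> g a)"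
  by (rule Rep_app[OF Rep_app1])

text \<open>Quantifier-free induction is only available for formulas; all uses have this shape.\<close>

lemma induction:
  assumes r: "Rep N N f" "Rep N N g" "Rep N N f1" "Rep N N g1" "Rep N N f2" "Rep N N g2"
    and 0: "f Z = g Z \<Longrightarrow> f1 Z = g1 Z \<or> f2 Z = g2 Z"
    and Su: "\<And>a. a \<in> Num \<Longrightarrow> (f a = g a \<Longrightarrow> f1 a = g1 a \<or> f2 a = g2 a) \<Longrightarrow>
      f (Su a) = g (Su a) \<Longrightarrow> f1 (Su a) = g1 (Su a) \<or> f2 (Su a) = g2 (Su a)"
    and n: "n \<in> Num" "f n = g n"
  shows "f1 n = g1 n \<or> f2 n = g2 n"
proof -
  obtain F1 where F1: "F1 \<in> dom T1" "\<And>a. a \<in> Num \<Longrightarrow> F1 \<odot> a = f a"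
    using r(1) unfolding Rep_def by blast
  obtain F2 where F2: "F2 \<in> dom T1" "\<And>a. a \<in> Num \<Longrightarrow> F2 \<odot> a = g a"
    using r(2) unfolding Rep_def by blast
  obtain F3 where F3: "F3 \<in> dom T1" "\<And>a. a \<in> Num \<Longrightarrow> F3 \<odot> a = f1 a"
    using r(3) unfolding Rep_def by blast
  obtain F4 where F4: "F4 \<in> dom T1" "\<And>a. a \<in> Num \<Longrightarrow> F4 \<odot> a = g1 a"
    using r(4) unfolding Rep_def by blast
  obtain F5 where F5: "F5 \<in> dom T1" "\<And>a. a \<in> Num \<Longrightarrow> F5 \<odot> a = f2 a"
    using r(5) unfolding Rep_def by blast
  obtain F6 where F6: "F6 \<in> dom T1" "\<And>a. a \<in> Num \<Longrightarrow> F6 \<odot> a = g2 a"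
    using r(6) unfolding Rep_def by blast
  note F = F1(1) F2(1) F3(1) F4(1) F5(1) F6(1) and Fe = F1(2) F2(2) F3(2) F4(2) F5(2) F6(2)
  define \<rho> where "\<rho> = e0((2, T1) := F1, (3, T1) := F2, (4, T1) := F3, (5, T1) := F4, (6, T1) := F5, (7, T1) := F6)"
  have \<rho>: "env \<rho>" "\<rho> (2, T1) = F1" "\<rho> (3, T1) = F2" "\<rho> (4, T1) = F3" "\<rho> (5, T1) = F4" "\<rho> (6, T1) = F5" "\<rho> (7, T1) = F6"
    by (simp_all add: \<rho>_def F)
  \<comment> \<open>The disjunction is written with negation and implication, and the six functions
    are free variables, so the formula is quantifier-free.\<close>
  define A where "A = Imp (Eq (V (2, T1) \<cdot> v0) (V (3, T1) \<cdot> v0))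
    (Imp (Neg (Eq (V (4, T1) \<cdot> v0) (V (5, T1) \<cdot> v0))) (Eq (V (6, T1) \<cdot> v0) (V (7, T1) \<cdot> v0)))"
  let ?I = "Imp (subst (0, N) zero A) (Imp (All (0, N) (Imp A (subst (0, N) (suc v0) A))) (All (0, N) A))"
  have "quantifier_free A" by (simp add: A_def Neg_def)
  moreover have "wff D ?I" by (simp add: A_def Neg_def)
  ultimately have "sat \<rho> ?I"
    using \<rho>(1) by (intro ax[OF RCA0\<Omega>_axiom.base[OF RCA0\<omega>_axiom.qf_induction]]) simp_all
  note I = this
  have P: "sat (\<rho>((0, N) := a)) A \<longleftrightarrow> (f a = g a \<longrightarrow> f1 a = g1 a \<or> f2 a = g2 a)" (is "_ \<longleftrightarrow> ?P a")
    if "a \<in> Num" for a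
    using that by (auto simp: A_def \<rho>(2-) Fe)
  have "sat \<rho> (subst (0, N) zero A)"
    using 0 by (auto simp: A_def \<rho>(2-) Fe Neg_def)
  moreover have "sat (\<rho>((0, N) := a)) (subst (0, N) (suc v0) A) \<longleftrightarrow> ?P (Su a)" if "a \<in> Num" for a
    using that by (auto simp: A_def \<rho>(2-) Fe Neg_def)
  ultimately have "\<forall>a\<in>Num. sat (\<rho>((0, N) := a)) A" using I P Su by auto
  then have "?P n" using P[OF n(1)] n(1) by blast
  then show ?thesis using n(2) by blast
qed

lemma induction_imp:
  assumes "Rep N N f" "Rep N N g" "Rep N N f1" "Rep N N g1"
    and "f Z = g Z \<Longrightarrow> f1 Z = g1 Z"
    and "\<And>a. a \<in> Num \<Longrightarrow> (f a = g a \<Longrightarrow> f1 a = g1 a) \<Longrightarrow> f (Su a) = g (Su a) \<Longrightarrow> f1 (Su a) = g1 (Su a)"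
    and "n \<in> Num" "f n = g n"
  shows "f1 n = g1 n"
proof -
  have "f1 n = g1 n \<or> f1 n = g1 n"
  proof (rule induction[of f g f1 g1 f1 g1 n, OF assms(1-4) assms(3,4) _ _ assms(7,8)])
    fix a assume a: "a \<in> Num" "f a = g a \<Longrightarrow> f1 a = g1 a \<or> f1 a = g1 a" "f (Su a) = g (Su a)"
    have "f1 a = g1 a" if "f a = g a" using a(2)[OF that] by simp
    from assms(6)[OF a(1) this a(3)] show "f1 (Su a) = g1 (Su a) \<or> f1 (Su a) = g1 (Su a)" by simp
  qed (use assms(5) in simp)
  then show ?thesis by simp
qed

lemma induction_or:
  assumes "Rep N N f1" "Rep N N g1" "Rep N N f2" "Rep N N g2"
    and "f1 Z = g1 Z \<or> f2 Z = g2 Z"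
    and "\<And>a. a \<in> Num \<Longrightarrow> f1 a = g1 a \<or> f2 a = g2 a \<Longrightarrow> f1 (Su a) = g1 (Su a) \<or> f2 (Su a) = g2 (Su a)"
    and "n \<in> Num"
  shows "f1 n = g1 n \<or> f2 n = g2 n"
  by (rule induction[of "\<lambda>a. a" "\<lambda>a. a" f1 g1 f2 g2 n, OF Rep_id Rep_id assms(1-4) assms(5) _ assms(7) refl])
    (use assms(6) in simp)

lemma induction_eq:
  assumes "Rep N N f" "Rep N N g" and "f Z = g Z"
    and "\<And>a. a \<in> Num \<Longrightarrow> f a = g a \<Longrightarrow> f (Su a) = g (Su a)"
    and "n \<in> Num"
  shows "f n = g n"
proof -
  have "f n = g n \<or> f n = g n"
    by (rule induction_or[of f g f g n, OF assms(1,2,1,2) _ _ assms(5)]) (use assms(3,4) in auto)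
  then show ?thesis by simp
qed

end

lemma arith_terms [simp]:
  "fvt predT = {}" "wt D predT" "ty_of predT = N \<rightarrow> N"
  "fvt plusT = {}" "wt D plusT" "ty_of plusT = N \<rightarrow> N \<rightarrow> N"
  "fvt triT = {}" "wt D triT" "ty_of triT = N \<rightarrow> N"
  "fvt pairT = {}" "wt D pairT" "ty_of pairT = N \<rightarrow> N \<rightarrow> N"
  "fvt segT = {}" "wt D segT" "ty_of segT = T1 \<rightarrow> N \<rightarrow> N"
  "fvt nsgT = {}" "wt D nsgT" "ty_of nsgT = N \<rightarrow> N"
  "fvt sgT = {}" "wt D sgT" "ty_of sgT = N \<rightarrow> N"
  "fvt condT = {}" "wt D condT" "ty_of condT = N \<rightarrow> N \<rightarrow> N \<rightarrow> N"
  "fvt sumT = {}" "wt D sumT" "ty_of sumT = T1 \<rightarrow> N \<rightarrow> N"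
  by (auto simp: predT_def monusT_def plusT_def triT_def pairT_def segT_def nsgT_def sgT_def
      condT_def sumT_def rec_def Let_def)

context pre_model
begin

lemma val_arith [simp]:
  "val \<rho> predT = cv predT" "val \<rho> monusT = cv monusT" "val \<rho> plusT = cv plusT"
  "val \<rho> triT = cv triT" "val \<rho> pairT = cv pairT" "val \<rho> segT = cv segT"
  "val \<rho> nsgT = cv nsgT" "val \<rho> sgT = cv sgT" "val \<rho> condT = cv condT" "val \<rho> sumT = cv sumT"
  by (simp_all add: val_cv)

lemma arith_dom [simp]:
  "cv predT \<in> dom (N \<rightarrow> N)" "cv monusT \<in> dom (N \<rightarrow> N \<rightarrow> N)" "cv plusT \<in> dom (N \<rightarrow> N \<rightarrow> N)"
  "cv triT \<in> dom (N \<rightarrow> N)" "cv pairT \<in> dom (N \<rightarrow> N \<rightarrow> N)" "cv segT \<in> dom (T1 \<rightarrow> N \<rightarrow> N)"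
  "cv nsgT \<in> dom (N \<rightarrow> N)" "cv sgT \<in> dom (N \<rightarrow> N)" "cv condT \<in> dom (N \<rightarrow> N \<rightarrow> N \<rightarrow> N)"
  "cv sumT \<in> dom (T1 \<rightarrow> N \<rightarrow> N)"
  using cv_type[of predT] cv_type[of monusT] cv_type[of plusT] cv_type[of triT] cv_type[of pairT]
    cv_type[of segT] cv_type[of nsgT] cv_type[of sgT] cv_type[of condT] cv_type[of sumT]
  by simp_all

lemma val_upd_notfree [simp]: "x \<notin> fvt t \<Longrightarrow> val (\<rho>(x := d)) t = val \<rho> t"
  by (rule val_cong) auto

lemma cs_Succ [simp]: "cs Succ \<in> dom (N \<rightarrow> N)"
  using cs_type[of Succ] by simp

end

context model
begin

declare One_nat_def [simp del]

abbreviation pl (infixl "\<oplus>" 65) where "a \<oplus> b \<equiv> cv plusT \<odot> a \<odot> b"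
abbreviation mi (infixl "\<ominus>" 65) where "a \<ominus> b \<equiv> cv monusT \<odot> a \<odot> b"
abbreviation le (infix "\<preceq>" 50) where "a \<preceq> b \<equiv> a \<ominus> b = Z"

lemma ap_N1 [simp]: "f \<in> dom (N \<rightarrow> N) \<Longrightarrow> a \<in> Num \<Longrightarrow> f \<odot> a \<in> Num"
  and ap_N2 [simp]: "f' \<in> dom (N \<rightarrow> N \<rightarrow> N) \<Longrightarrow> a \<in> Num \<Longrightarrow> b \<in> Num \<Longrightarrow> f' \<odot> a \<odot> b \<in> Num"
  and ap_N3 [simp]: "f'' \<in> dom (T1 \<rightarrow> N \<rightarrow> N) \<Longrightarrow> f \<in> dom (N \<rightarrow> N) \<Longrightarrow> b \<in> Num \<Longrightarrow> f'' \<odot> f \<odot> b \<in> Num"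
  by (blast intro: ap_type)+

section \<open>Recursion equations of the arithmetical terms\<close>

lemma pred_Z [simp]: "cv predT \<odot> Z = Z"
  and pred_Su [simp]: "a \<in> Num \<Longrightarrow> cv predT \<odot> Su a = a"
  by (simp_all add: predT_def cv_lam Let_def rec_def)

lemma monus_Z [simp]: "a \<in> Num \<Longrightarrow> a \<ominus> Z = a"
  and monus_Su: "a \<in> Num \<Longrightarrow> b \<in> Num \<Longrightarrow> a \<ominus> Su b = cv predT \<odot> (a \<ominus> b)"
  by (simp_all add: monusT_def cv_lam Let_def rec_def)

lemma plus_Z [simp]: "a \<in> Num \<Longrightarrow> a \<oplus> Z = a"
  and plus_Su [simp]: "a \<in> Num \<Longrightarrow> b \<in> Num \<Longrightarrow> a \<oplus> Su b = Su (a \<oplus> b)"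
  by (simp_all add: plusT_def cv_lam Let_def rec_def)

lemma tri_Z [simp]: "cv triT \<odot> Z = Z"
  and tri_Su [simp]: "a \<in> Num \<Longrightarrow> cv triT \<odot> Su a = cv triT \<odot> a \<oplus> Su a"
  by (simp_all add: triT_def cv_lam Let_def rec_def del: plus_Su)

lemma pair_eq: "a \<in> Num \<Longrightarrow> b \<in> Num \<Longrightarrow> cv pairT \<odot> a \<odot> b = cv triT \<odot> (a \<oplus> b) \<oplus> b"
  by (simp add: pairT_def cv_lam Let_def rec_def)

lemma seg_Z [simp]: "f \<in> dom T1 \<Longrightarrow> cv segT \<odot> f \<odot> Z = Z"
  and seg_Su [simp]: "f \<in> dom T1 \<Longrightarrow> n \<in> Num \<Longrightarrow>
    cv segT \<odot> f \<odot> Su n = Su (cv pairT \<odot> (cv segT \<odot> f \<odot> n) \<odot> (f \<odot> n))"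
  by (simp_all add: segT_def cv_lam Let_def rec_def)

lemma nsg_Z [simp]: "cv nsgT \<odot> Z = Su Z"
  and nsg_Su [simp]: "a \<in> Num \<Longrightarrow> cv nsgT \<odot> Su a = Z"
  by (simp_all add: nsgT_def cv_lam Let_def rec_def)

lemma sg_Z [simp]: "cv sgT \<odot> Z = Z"
  and sg_Su [simp]: "a \<in> Num \<Longrightarrow> cv sgT \<odot> Su a = Su Z"
  by (simp_all add: sgT_def cv_lam Let_def rec_def)

lemma cond_Z [simp]: "b \<in> Num \<Longrightarrow> c \<in> Num \<Longrightarrow> cv condT \<odot> Z \<odot> b \<odot> c = b"
  and cond_Su [simp]: "a \<in> Num \<Longrightarrow> b \<in> Num \<Longrightarrow> c \<in> Num \<Longrightarrow> cv condT \<odot> Su a \<odot> b \<odot> c = c"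
  by (simp_all add: condT_def cv_lam Let_def rec_def)

lemma sum_Z [simp]: "f \<in> dom T1 \<Longrightarrow> cv sumT \<odot> f \<odot> Z = Z"
  and sum_Su [simp]: "f \<in> dom T1 \<Longrightarrow> n \<in> Num \<Longrightarrow> cv sumT \<odot> f \<odot> Su n = cv sumT \<odot> f \<odot> n \<oplus> f \<odot> n"
  by (simp_all add: sumT_def cv_lam Let_def rec_def)

lemmas Rep_arith = Rep_const Rep_id Rep_app1[OF cs_Succ] Rep_app1[OF arith_dom(1)] Rep_app2[OF arith_dom(2)]
  Rep_app2[OF arith_dom(3)] Rep_app1[OF arith_dom(4)] Rep_app2[OF arith_dom(5)] Rep_app2[OF arith_dom(6)]
  Rep_app1[OF arith_dom(7)] Rep_app1[OF arith_dom(8)] Rep_app2[OF arith_dom(10)]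

text \<open>Naming the predecessor by \<open>predT\<close> removes the existential quantifier and
  makes induction applicable.\<close>

lemma num_cases:
  assumes "a \<in> Num" obtains "a = Z" | b where "b \<in> Num" "a = Su b"
proof -
  have "a = Z \<or> Su (cv predT \<odot> a) = a"
    by (rule induction_or[of "\<lambda>a. a" "\<lambda>a. Z" "\<lambda>a. Su (cv predT \<odot> a)" "\<lambda>a. a"])
      (auto intro!: Rep_arith simp: assms)
  then show thesis using that assms by (metis ap_N1 arith_dom(1))
qed

section \<open>Addition and the order given by truncated subtraction\<close>

lemma Z_plus [simp]: "a \<in> Num \<Longrightarrow> Z \<oplus> a = a"
  by (rule induction_eq[of "\<lambda>a. Z \<oplus> a" "\<lambda>a. a"]) (auto intro!: Rep_arith)

lemma Su_plus [simp]: "a \<in> Num \<Longrightarrow> b \<in> Num \<Longrightarrow> Su a \<oplus> b = Su (a \<oplus> b)"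
  by (rule induction_eq[of "\<lambda>b. Su a \<oplus> b" "\<lambda>b. Su (a \<oplus> b)"]) (auto intro!: Rep_arith)

lemma plus_comm: "a \<in> Num \<Longrightarrow> b \<in> Num \<Longrightarrow> a \<oplus> b = b \<oplus> a"
  by (rule induction_eq[of "\<lambda>b. a \<oplus> b" "\<lambda>b. b \<oplus> a"]) (auto intro!: Rep_arith)

lemma plus_assoc: "a \<in> Num \<Longrightarrow> b \<in> Num \<Longrightarrow> c \<in> Num \<Longrightarrow> a \<oplus> b \<oplus> c = a \<oplus> (b \<oplus> c)"
  by (rule induction_eq[of "\<lambda>c. a \<oplus> b \<oplus> c" "\<lambda>c. a \<oplus> (b \<oplus> c)"]) (auto intro!: Rep_arith)

lemma plus_cancel: "a \<in> Num \<Longrightarrow> b \<in> Num \<Longrightarrow> c \<in> Num \<Longrightarrow> a \<oplus> b = a \<oplus> c \<Longrightarrow> b = c"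
  by (rule induction_imp[of "\<lambda>a. a \<oplus> b" "\<lambda>a. a \<oplus> c" "\<lambda>a. b" "\<lambda>a. c" a]) (auto intro!: Rep_arith)

lemma plus_eq_Z: "a \<in> Num \<Longrightarrow> b \<in> Num \<Longrightarrow> a \<oplus> b = Z \<longleftrightarrow> a = Z \<and> b = Z"
  by (rule num_cases[of b]) auto

lemma monus_Su_Su [simp]: "a \<in> Num \<Longrightarrow> b \<in> Num \<Longrightarrow> Su a \<ominus> Su b = a \<ominus> b"
  by (rule induction_eq[of "\<lambda>b. Su a \<ominus> Su b" "\<lambda>b. a \<ominus> b" b]) (auto intro!: Rep_arith simp: monus_Su)

lemma Z_monus [simp]: "a \<in> Num \<Longrightarrow> Z \<preceq> a"
  by (rule induction_eq[of "\<lambda>a. Z \<ominus> a" "\<lambda>a. Z" a]) (auto intro!: Rep_arith simp: monus_Su)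

lemma plus_monus [simp]: "a \<in> Num \<Longrightarrow> c \<in> Num \<Longrightarrow> a \<oplus> c \<ominus> a = c"
  by (rule induction_eq[of "\<lambda>a. a \<oplus> c \<ominus> a" "\<lambda>a. c" a]) (auto intro!: Rep_arith)

lemma le_plus [simp]: "a \<in> Num \<Longrightarrow> c \<in> Num \<Longrightarrow> a \<preceq> a \<oplus> c"
  by (rule induction_eq[of "\<lambda>a. a \<ominus> (a \<oplus> c)" "\<lambda>a. Z" a]) (auto intro!: Rep_arith)

lemma monus_pos: "a \<in> Num \<Longrightarrow> b \<in> Num \<Longrightarrow> a \<preceq> b \<or> b \<oplus> (a \<ominus> b) = a"
proof (rule induction_or[of "\<lambda>b. a \<ominus> b" "\<lambda>b. Z" "\<lambda>b. b \<oplus> (a \<ominus> b)" "\<lambda>b. a" b])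
  fix b assume a: "a \<in> Num" "b \<in> Num" and IH: "a \<preceq> b \<or> b \<oplus> (a \<ominus> b) = a"
  have "a \<ominus> b \<in> Num" using a by simp
  then show "a \<preceq> Su b \<or> Su b \<oplus> (a \<ominus> Su b) = a"
    by (rule num_cases) (use a IH in \<open>auto simp: monus_Su\<close>)
qed (auto intro!: Rep_arith)

lemma le_imp_plus: "a \<in> Num \<Longrightarrow> b \<in> Num \<Longrightarrow> a \<preceq> b \<Longrightarrow> a \<oplus> (b \<ominus> a) = b"
proof (rule induction_imp[of "\<lambda>b. a \<ominus> b" "\<lambda>b. Z" "\<lambda>b. a \<oplus> (b \<ominus> a)" "\<lambda>b. b" b])
  fix b assume a: "a \<in> Num" "b \<in> Num" and IH: "a \<preceq> b \<Longrightarrow> a \<oplus> (b \<ominus> a) = b" and l: "a \<preceq> Su b"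
  have n: "a \<ominus> b \<in> Num" "b \<ominus> a \<in> Num" using a by simp_all
  from n(1) show "a \<oplus> (Su b \<ominus> a) = Su b"
  proof (rule num_cases)
    assume "a \<preceq> b"
    then have "a \<oplus> Su (b \<ominus> a) = Su b" using a IH by simp
    then show ?thesis using plus_monus[of a "Su (b \<ominus> a)"] a by simp
  next
    \<comment> \<open>Here \<open>a \<ominus> b\<close> is positive while
      \<open>a \<ominus> Su b\<close> is zero, so \<open>a\<close> is exactly
      \<open>Su b\<close>.\<close>
    fix d assume d: "d \<in> Num" "a \<ominus> b = Su d"
    then have "d = Z" using l a by (simp add: monus_Su)
    then have "a = Su b" using monus_pos[OF a] d a by simp
    then show ?thesis using plus_monus[of a Z] a by simp
  qed
qed (auto intro!: Rep_arith)

text \<open>The order is an equation between terms and may thus occur in inductions; the form with a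
  difference, better suited to calculation, contains a quantifier and may not.\<close>

lemma le_iff: "a \<in> Num \<Longrightarrow> b \<in> Num \<Longrightarrow> a \<preceq> b \<longleftrightarrow> (\<exists>c\<in>Num. b = a \<oplus> c)"
  using le_imp_plus[of a b] by (metis ap_N2 arith_dom(2) le_plus)

lemma le_refl [simp]: "a \<in> Num \<Longrightarrow> a \<preceq> a"
  using le_plus[of a Z] by simp

lemma le_trans:
  assumes "a \<in> Num" "b \<in> Num" "c \<in> Num" "a \<preceq> b" "b \<preceq> c" shows "a \<preceq> c"
proof -
  obtain d e where d: "d \<in> Num" "b = a \<oplus> d" and e: "e \<in> Num" "c = b \<oplus> e"
    using assms le_iff by metis
  then have "c = a \<oplus> (d \<oplus> e)" using assms(1) by (simp add: plus_assoc)
  then show ?thesis using assms(1) d e by simp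
qed

lemma le_total: "a \<in> Num \<Longrightarrow> b \<in> Num \<Longrightarrow> a \<preceq> b \<or> b \<preceq> a"
  by (metis monus_pos le_plus ap_N2 arith_dom(2))

lemma le_antisym:
  assumes "a \<in> Num" "b \<in> Num" "a \<preceq> b" "b \<preceq> a" shows "a = b"
proof -
  obtain c d where c: "c \<in> Num" "b = a \<oplus> c" and d: "d \<in> Num" "a = b \<oplus> d"
    using assms le_iff by metis
  have "a \<oplus> c \<oplus> d = a" by (simp only: c(2)[symmetric] d(2)[symmetric])
  then have "a \<oplus> Z = a \<oplus> (c \<oplus> d)" by (simp only: plus_assoc[OF assms(1) c(1) d(1)] plus_Z[OF assms(1)])
  then have "Z = c \<oplus> d" by (rule plus_cancel[rotated 3]) (use assms(1) c(1) d(1) in simp_all)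
  then have "c = Z" using plus_eq_Z[OF c(1) d(1)] by simp
  then show "a = b" using c(2) assms(1) by simp
qed

lemma le_Su: "a \<in> Num \<Longrightarrow> a \<preceq> Su a"
  using le_plus[of a "Su Z"] by simp

lemma not_Su_le: "a \<in> Num \<Longrightarrow> \<not> Su a \<preceq> a"
  by (metis le_antisym le_Su plus_cancel plus_Z plus_Su Su_Z Zero_dom Succ_dom)

lemma le_Su_iff: "a \<in> Num \<Longrightarrow> b \<in> Num \<Longrightarrow> a \<preceq> Su b \<longleftrightarrow> a \<preceq> b \<or> a = Su b"
proof
  assume a: "a \<in> Num" "b \<in> Num" "a \<preceq> Su b"
  then obtain c where c: "c \<in> Num" "Su b = a \<oplus> c" by (auto simp: le_iff)
  from c(1) show "a \<preceq> b \<or> a = Su b" by (rule num_cases) (use a c in auto)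
qed (use le_trans[of a b "Su b"] le_Su in auto)

lemma not_le: "a \<in> Num \<Longrightarrow> b \<in> Num \<Longrightarrow> \<not> a \<preceq> b \<Longrightarrow> Su b \<preceq> a"
  using le_total[of a "Su b"] le_Su_iff[of a b] by fastforce

end

section \<open>Codes of finite binary sequences and bounded search\<close>

text \<open>\<open>lstT\<close>: the least zero of \<open>f\<close> below \<open>n\<close>, or \<open>n\<close> if there is none.\<close>

definition lstT :: tm where
  "lstT = (let f = (0, T1); n = (1, N); r = (2, N); k = (3, N) in
     lam f (lam n (rec (V n) zero (lam r (lam k (plusT \<cdot> V r \<cdot> (sgT \<cdot> (V f \<cdot> V r))))))))"

definition dblT :: tm where
  "dblT = (let n = (0, N); r = (1, N); k = (2, N) in lam n (rec (V n) zero (lam r (lam k (suc (suc (V r)))))))"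

definition parT :: tm where
  "parT = (let n = (0, N); r = (1, N); k = (2, N) in lam n (rec (V n) zero (lam r (lam k (nsgT \<cdot> V r)))))"

text \<open>The integer part of \<open>n / 2\<close>: it grows by one when passing from an odd
  number to the next.\<close>

definition halfT :: tm where
  "halfT = (let n = (0, N); r = (1, N); k = (2, N) in
     lam n (rec (V n) zero (lam r (lam k (plusT \<cdot> V r \<cdot> (parT \<cdot> V k))))))"

text \<open>\<open>cdT f n\<close> has the binary digits \<open>sg (f 0), \<dots>, sg (f (n - 1))\<close>, most significant first;
  \<open>decT c n\<close> recovers the sequence.\<close>

definition cdT :: tm where
  "cdT = (let f = (0, T1); n = (1, N); r = (2, N); k = (3, N) in
     lam f (lam n (rec (V n) zero (lam r (lam k (plusT \<cdot> (dblT \<cdot> V r) \<cdot> (sgT \<cdot> (V f \<cdot> V k))))))))"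

text \<open>A right shift: the last \<open>n\<close> binary digits of \<open>c\<close> are
  dropped.\<close>

definition hsT :: tm where
  "hsT = (let c = (0, N); n = (1, N); r = (2, N); k = (3, N) in
     lam c (lam n (rec (V n) (V c) (lam r (lam k (halfT \<cdot> V r))))))"

definition decT :: tm where
  "decT = (let c = (0, N); n = (1, N); i = (2, N) in
     lam c (lam n (lam i (parT \<cdot> (hsT \<cdot> V c \<cdot> (monusT \<cdot> V n \<cdot> suc (V i)))))))"

lemma code_terms [simp]:
  "fvt lstT = {}" "wt D lstT" "ty_of lstT = T1 \<rightarrow> N \<rightarrow> N"
  "fvt dblT = {}" "wt D dblT" "ty_of dblT = N \<rightarrow> N"
  "fvt parT = {}" "wt D parT" "ty_of parT = N \<rightarrow> N"
  "fvt halfT = {}" "wt D halfT" "ty_of halfT = N \<rightarrow> N"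
  "fvt cdT = {}" "wt D cdT" "ty_of cdT = T1 \<rightarrow> N \<rightarrow> N"
  "fvt hsT = {}" "wt D hsT" "ty_of hsT = N \<rightarrow> N \<rightarrow> N"
  "fvt decT = {}" "wt D decT" "ty_of decT = N \<rightarrow> N \<rightarrow> T1"
  by (auto simp: lstT_def dblT_def parT_def halfT_def cdT_def hsT_def decT_def rec_def Let_def)

context pre_model
begin

lemma val_code [simp]:
  "val \<rho> lstT = cv lstT" "val \<rho> dblT = cv dblT" "val \<rho> parT = cv parT" "val \<rho> halfT = cv halfT"
  "val \<rho> cdT = cv cdT" "val \<rho> hsT = cv hsT" "val \<rho> decT = cv decT"
  by (simp_all add: val_cv)

lemma code_dom [simp]:
  "cv lstT \<in> dom (T1 \<rightarrow> N \<rightarrow> N)" "cv dblT \<in> dom (N \<rightarrow> N)" "cv parT \<in> dom (N \<rightarrow> N)"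
  "cv halfT \<in> dom (N \<rightarrow> N)" "cv cdT \<in> dom (T1 \<rightarrow> N \<rightarrow> N)" "cv hsT \<in> dom (N \<rightarrow> N \<rightarrow> N)"
  "cv decT \<in> dom (N \<rightarrow> N \<rightarrow> T1)"
  using cv_type[of lstT] cv_type[of dblT] cv_type[of parT] cv_type[of halfT] cv_type[of cdT]
    cv_type[of hsT] cv_type[of decT]
  by simp_all

end

context model
begin

section \<open>Monotonicity and injectivity of the pairing function\<close>

lemma plus_mono1: "a \<in> Num \<Longrightarrow> b \<in> Num \<Longrightarrow> c \<in> Num \<Longrightarrow> a \<preceq> b \<Longrightarrow> c \<oplus> a \<preceq> c \<oplus> b"
proof -
  assume a: "a \<in> Num" "b \<in> Num" "c \<in> Num" "a \<preceq> b"
  then obtain d where d: "d \<in> Num" "b = a \<oplus> d" by (auto simp: le_iff)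
  then have "c \<oplus> b = c \<oplus> a \<oplus> d" using a by (simp add: plus_assoc)
  then show "c \<oplus> a \<preceq> c \<oplus> b" using a d by simp
qed

lemma plus_mono2: "a \<in> Num \<Longrightarrow> b \<in> Num \<Longrightarrow> c \<in> Num \<Longrightarrow> a \<preceq> b \<Longrightarrow> a \<oplus> c \<preceq> b \<oplus> c"
  using plus_mono1[of a b c] by (simp add: plus_comm[of _ c])

lemma plus_mono:
  assumes "a \<in> Num" "b \<in> Num" "c \<in> Num" "d \<in> Num" "a \<preceq> b" "c \<preceq> d" shows "a \<oplus> c \<preceq> b \<oplus> d"
  by (rule le_trans[of _ "b \<oplus> c"]) (simp_all add: assms plus_mono1 plus_mono2)

lemma le_plus2: "a \<in> Num \<Longrightarrow> b \<in> Num \<Longrightarrow> a \<preceq> b \<oplus> a"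
  using le_plus[of a b] by (simp only: plus_comm)

lemma tri_mono: "a \<in> Num \<Longrightarrow> c \<in> Num \<Longrightarrow> cv triT \<odot> a \<preceq> cv triT \<odot> (a \<oplus> c)"
proof (rule induction_eq[of "\<lambda>c. cv triT \<odot> a \<ominus> cv triT \<odot> (a \<oplus> c)" "\<lambda>c. Z"])
  fix c assume a: "a \<in> Num" "c \<in> Num" "cv triT \<odot> a \<preceq> cv triT \<odot> (a \<oplus> c)"
  show "cv triT \<odot> a \<preceq> cv triT \<odot> (a \<oplus> Su c)"
    by (rule le_trans[of _ "cv triT \<odot> (a \<oplus> c)"]) (use a in \<open>simp_all del: plus_Su add: plus_Su[of a c]\<close>)
qed (auto intro!: Rep_arith)

text \<open>The pairs with sum \<open>s\<close> have codes between \<open>triT s\<close> and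
  \<open>triT s + s\<close>, and the codes for the next sum start at
  \<open>triT s + s + 1\<close>.\<close>

lemma pair_less:
  assumes n: "a \<in> Num" "b \<in> Num" "a' \<in> Num" "b' \<in> Num" and l: "Su (a \<oplus> b) \<preceq> a' \<oplus> b'"
  shows "cv pairT \<odot> a \<odot> b \<noteq> cv pairT \<odot> a' \<odot> b'"
proof
  assume e: "cv pairT \<odot> a \<odot> b = cv pairT \<odot> a' \<odot> b'"
  let ?t = "cv triT \<odot> (a \<oplus> b)"
  obtain c where c: "c \<in> Num" "a' \<oplus> b' = Su (a \<oplus> b) \<oplus> c"
    using l n by (auto simp: le_iff)
  have "cv triT \<odot> Su (a \<oplus> b) \<preceq> cv triT \<odot> (a' \<oplus> b')"
    unfolding c(2) by (rule tri_mono) (use n c in simp_all)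
  then have "Su (?t \<oplus> (a \<oplus> b)) \<preceq> cv triT \<odot> (a' \<oplus> b')"
    using n by simp
  moreover have "cv triT \<odot> (a' \<oplus> b') \<preceq> cv pairT \<odot> a \<odot> b"
    unfolding e pair_eq[OF n(3,4)] using n by simp
  moreover have "cv pairT \<odot> a \<odot> b \<preceq> ?t \<oplus> (a \<oplus> b)"
    unfolding pair_eq[OF n(1,2)] using n by (intro plus_mono1 le_plus2) simp_all
  ultimately have "Su (?t \<oplus> (a \<oplus> b)) \<preceq> ?t \<oplus> (a \<oplus> b)"
    using le_trans[of "Su (?t \<oplus> (a \<oplus> b))" "cv triT \<odot> (a' \<oplus> b')" "cv pairT \<odot> a \<odot> b"]
      le_trans[of "Su (?t \<oplus> (a \<oplus> b))" "cv pairT \<odot> a \<odot> b" "?t \<oplus> (a \<oplus> b)"] n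
    by (simp del: plus_Su monus_Su_Su)
  then show False using not_Su_le[of "?t \<oplus> (a \<oplus> b)"] n by simp
qed

text \<open>Codes of pairs with different sums differ by \<open>pair_less\<close>, so the sums agree
  and the triangular parts of the codes cancel.\<close>

lemma pair_inj:
  assumes n: "a \<in> Num" "b \<in> Num" "a' \<in> Num" "b' \<in> Num"
    and e: "cv pairT \<odot> a \<odot> b = cv pairT \<odot> a' \<odot> b'"
  shows "a = a' \<and> b = b'"
proof -
  have d: "a \<oplus> b \<in> Num" "a' \<oplus> b' \<in> Num" using n by simp_all
  have 1: "a \<oplus> b \<preceq> a' \<oplus> b'"
    using not_le[OF d] pair_less[OF n(3,4,1,2)] e[symmetric] by blast
  have 2: "a' \<oplus> b' \<preceq> a \<oplus> b"
    using not_le[OF d(2,1)] pair_less[OF n] e by blast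
  from le_antisym[OF d 1 2] have s: "a \<oplus> b = a' \<oplus> b'" .
  have "cv triT \<odot> (a \<oplus> b) \<oplus> b = cv triT \<odot> (a \<oplus> b) \<oplus> b'"
    using e unfolding pair_eq[OF n(1,2)] pair_eq[OF n(3,4)] s .
  then have b: "b = b'" by (rule plus_cancel[rotated 3]) (use n in simp_all)
  have "b \<oplus> a = b \<oplus> a'" using s plus_comm[OF n(2,1)] plus_comm[OF n(2,3)] b by simp
  then have "a = a'" by (rule plus_cancel[rotated 3]) (use n in simp_all)
  with b show ?thesis by simp
qed

section \<open>Initial segments and finite sums\<close>

lemma seg_cong:
  assumes "f \<in> dom T1" "g \<in> dom T1" "n \<in> Num" "\<And>i. i \<in> Num \<Longrightarrow> Su i \<preceq> n \<Longrightarrow> f \<odot> i = g \<odot> i"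
  shows "cv segT \<odot> f \<odot> n = cv segT \<odot> g \<odot> n"
\<comment> \<open>The bound \<open>k \<preceq> n\<close> belongs to the induction formula; the
  agreement of \<open>f\<close> and \<open>g\<close> is universally quantified and stays
  outside.\<close>
proof (rule induction_imp[of "\<lambda>k. k \<ominus> n" "\<lambda>k. Z" "\<lambda>k. cv segT \<odot> f \<odot> k" "\<lambda>k. cv segT \<odot> g \<odot> k" n])
  fix k assume k: "k \<in> Num" "k \<preceq> n \<Longrightarrow> cv segT \<odot> f \<odot> k = cv segT \<odot> g \<odot> k" "Su k \<preceq> n"
  have "k \<preceq> n" by (rule le_trans[of k "Su k" n]) (use k assms(3) le_Su in simp_all)
  then show "cv segT \<odot> f \<odot> Su k = cv segT \<odot> g \<odot> Su k"
    using k assms by simp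
qed (use assms in \<open>auto intro!: Rep_arith\<close>)

text \<open>Injectivity of pairing strips the last entry from both codes; the surplus length
  \<open>c\<close> is removed one entry at a time.\<close>

lemma seg_le:
  assumes n: "f \<in> dom T1" "g \<in> dom T1" "n \<in> Num" "k \<in> Num" "k \<preceq> n"
    and e: "cv segT \<odot> f \<odot> n = cv segT \<odot> g \<odot> n"
  shows "cv segT \<odot> f \<odot> k = cv segT \<odot> g \<odot> k"
proof -
  obtain c where c: "c \<in> Num" "n = k \<oplus> c" using n by (auto simp: le_iff)
  show ?thesis
  proof (rule induction_imp[of "\<lambda>c. cv segT \<odot> f \<odot> (k \<oplus> c)" "\<lambda>c. cv segT \<odot> g \<odot> (k \<oplus> c)"
        "\<lambda>c. cv segT \<odot> f \<odot> k" "\<lambda>c. cv segT \<odot> g \<odot> k" c])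
    fix c assume a: "c \<in> Num" "cv segT \<odot> f \<odot> (k \<oplus> c) = cv segT \<odot> g \<odot> (k \<oplus> c) \<Longrightarrow> cv segT \<odot> f \<odot> k = cv segT \<odot> g \<odot> k"
      "cv segT \<odot> f \<odot> (k \<oplus> Su c) = cv segT \<odot> g \<odot> (k \<oplus> Su c)"
    have "cv pairT \<odot> (cv segT \<odot> f \<odot> (k \<oplus> c)) \<odot> (f \<odot> (k \<oplus> c)) = cv pairT \<odot> (cv segT \<odot> g \<odot> (k \<oplus> c)) \<odot> (g \<odot> (k \<oplus> c))"
      using a(1,3) n by simp
    then have "cv segT \<odot> f \<odot> (k \<oplus> c) = cv segT \<odot> g \<odot> (k \<oplus> c)"
      by (rule pair_inj[THEN conjunct1, rotated 4]) (use a(1) n in simp_all)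
    then show "cv segT \<odot> f \<odot> k = cv segT \<odot> g \<odot> k" by (rule a(2))
  qed (use n c(1) e in \<open>auto intro!: Rep_arith simp: c(2)\<close>)
qed

lemma sum_ge:
  assumes "f \<in> dom T1" "k \<in> Num" "n \<in> Num" "Su k \<preceq> n"
  shows "f \<odot> k \<preceq> cv sumT \<odot> f \<odot> n"
proof -
  obtain c where c: "c \<in> Num" "n = Su k \<oplus> c" using assms le_iff[of "Su k" n] by auto
  have "f \<odot> k \<preceq> cv sumT \<odot> f \<odot> (Su k \<oplus> c)"
  proof (rule induction_eq[of "\<lambda>c. f \<odot> k \<ominus> cv sumT \<odot> f \<odot> (Su k \<oplus> c)" "\<lambda>c. Z" c])
    show "f \<odot> k \<preceq> cv sumT \<odot> f \<odot> (Su k \<oplus> Z)" using assms by (simp add: le_plus2 del: Su_plus)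
    fix c assume c: "c \<in> Num" "f \<odot> k \<preceq> cv sumT \<odot> f \<odot> (Su k \<oplus> c)"
    show "f \<odot> k \<preceq> cv sumT \<odot> f \<odot> (Su k \<oplus> Su c)"
      by (rule le_trans[of _ "cv sumT \<odot> f \<odot> (Su k \<oplus> c)"]) (use c assms in \<open>simp_all del: Su_plus\<close>)
  qed (use assms c in \<open>auto intro!: Rep_arith\<close>)
  then show ?thesis using c by simp
qed

lemma sum_Z_D:
  assumes "f \<in> dom T1" "k \<in> Num" "n \<in> Num" "cv sumT \<odot> f \<odot> n = Z" "Su k \<preceq> n" shows "f \<odot> k = Z"
  using sum_ge[OF assms(1-3,5)] assms by simp

text \<open>Together with \<open>sum_Z_D\<close> this turns a bounded universal quantifier into one
  equation, which a closed term can decide.\<close>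

lemma sum_eq_Z:
  assumes "f \<in> dom T1" "n \<in> Num" "\<And>k. k \<in> Num \<Longrightarrow> Su k \<preceq> n \<Longrightarrow> f \<odot> k = Z"
  shows "cv sumT \<odot> f \<odot> n = Z"
proof (rule induction_imp[of "\<lambda>k. k \<ominus> n" "\<lambda>k. Z" "\<lambda>k. cv sumT \<odot> f \<odot> k" "\<lambda>k. Z" n])
  fix k assume k: "k \<in> Num" "k \<preceq> n \<Longrightarrow> cv sumT \<odot> f \<odot> k = Z" "Su k \<preceq> n"
  have "k \<preceq> n" by (rule le_trans[of k "Su k" n]) (use k assms(2) le_Su in simp_all)
  then show "cv sumT \<odot> f \<odot> Su k = Z" using k assms by simp
qed (use assms in \<open>auto intro!: Rep_arith\<close>)

lemma sg_le [simp]: "a \<in> Num \<Longrightarrow> cv sgT \<odot> a \<preceq> Su Z"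
  by (rule num_cases[of a]) auto

lemma sg_id: "a \<in> Num \<Longrightarrow> a \<preceq> Su Z \<Longrightarrow> cv sgT \<odot> a = a"
  by (auto simp: le_Su_iff)

section \<open>Recursion equations for search, digits and codes\<close>

lemma lst_Z [simp]: "f \<in> dom T1 \<Longrightarrow> cv lstT \<odot> f \<odot> Z = Z"
  and lst_Su [simp]: "f \<in> dom T1 \<Longrightarrow> n \<in> Num \<Longrightarrow>
    cv lstT \<odot> f \<odot> Su n = cv lstT \<odot> f \<odot> n \<oplus> cv sgT \<odot> (f \<odot> (cv lstT \<odot> f \<odot> n))"
  by (simp_all add: lstT_def cv_lam Let_def rec_def)

lemma dbl_Z [simp]: "cv dblT \<odot> Z = Z"
  and dbl_Su [simp]: "n \<in> Num \<Longrightarrow> cv dblT \<odot> Su n = Su (Su (cv dblT \<odot> n))"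
  by (simp_all add: dblT_def cv_lam Let_def rec_def)

lemma par_Z [simp]: "cv parT \<odot> Z = Z"
  and par_Su [simp]: "n \<in> Num \<Longrightarrow> cv parT \<odot> Su n = cv nsgT \<odot> (cv parT \<odot> n)"
  by (simp_all add: parT_def cv_lam Let_def rec_def)

lemma half_Z [simp]: "cv halfT \<odot> Z = Z"
  and half_Su [simp]: "n \<in> Num \<Longrightarrow> cv halfT \<odot> Su n = cv halfT \<odot> n \<oplus> cv parT \<odot> n"
  by (simp_all add: halfT_def cv_lam Let_def rec_def)

lemma cd_Z [simp]: "f \<in> dom T1 \<Longrightarrow> cv cdT \<odot> f \<odot> Z = Z"
  and cd_Su [simp]: "f \<in> dom T1 \<Longrightarrow> n \<in> Num \<Longrightarrow>
    cv cdT \<odot> f \<odot> Su n = cv dblT \<odot> (cv cdT \<odot> f \<odot> n) \<oplus> cv sgT \<odot> (f \<odot> n)"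
  by (simp_all add: cdT_def cv_lam Let_def rec_def)

lemma hs_Z [simp]: "c \<in> Num \<Longrightarrow> cv hsT \<odot> c \<odot> Z = c"
  and hs_Su [simp]: "c \<in> Num \<Longrightarrow> n \<in> Num \<Longrightarrow> cv hsT \<odot> c \<odot> Su n = cv halfT \<odot> (cv hsT \<odot> c \<odot> n)"
  by (simp_all add: hsT_def cv_lam Let_def rec_def)

lemma dec_eq: "c \<in> Num \<Longrightarrow> n \<in> Num \<Longrightarrow> i \<in> Num \<Longrightarrow>
    cv decT \<odot> c \<odot> n \<odot> i = cv parT \<odot> (cv hsT \<odot> c \<odot> (n \<ominus> Su i))"
  by (simp add: decT_def cv_lam Let_def rec_def)

lemma dec_dom [simp]: "c \<in> Num \<Longrightarrow> n \<in> Num \<Longrightarrow> cv decT \<odot> c \<odot> n \<in> dom T1"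
  using ap_type[OF ap_type[OF code_dom(7)]] .

lemmas Rep_code = Rep_arith Rep_app2[OF code_dom(1)] Rep_app1[OF code_dom(2)] Rep_app1[OF code_dom(3)]
  Rep_app1[OF code_dom(4)] Rep_app2[OF code_dom(5)] Rep_app2[OF code_dom(6)]

section \<open>Decoding inverts coding\<close>

lemma par_dbl [simp]: "c \<in> Num \<Longrightarrow> cv parT \<odot> (cv dblT \<odot> c) = Z"
  by (rule induction_eq[of "\<lambda>c. cv parT \<odot> (cv dblT \<odot> c)" "\<lambda>c. Z"]) (auto intro!: Rep_code)

lemma half_dbl [simp]: "c \<in> Num \<Longrightarrow> cv halfT \<odot> (cv dblT \<odot> c) = c"
  by (rule induction_eq[of "\<lambda>c. cv halfT \<odot> (cv dblT \<odot> c)" "\<lambda>c. c"]) (auto intro!: Rep_code)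

lemma half_digit [simp]: "c \<in> Num \<Longrightarrow> a \<in> Num \<Longrightarrow> cv halfT \<odot> (cv dblT \<odot> c \<oplus> cv sgT \<odot> a) = c"
  and par_digit [simp]: "c \<in> Num \<Longrightarrow> a \<in> Num \<Longrightarrow> cv parT \<odot> (cv dblT \<odot> c \<oplus> cv sgT \<odot> a) = cv sgT \<odot> a"
  by (rule num_cases[of a]; simp)+

lemma par_le: "a \<in> Num \<Longrightarrow> cv parT \<odot> a \<preceq> Su Z"
proof -
  assume a: "a \<in> Num"
  have n: "b \<in> Num \<Longrightarrow> cv nsgT \<odot> b \<preceq> Su Z" for b by (rule num_cases[of b]) auto
  show ?thesis by (rule num_cases[OF a]) (auto simp: n)
qed

lemma hs_half: "c \<in> Num \<Longrightarrow> k \<in> Num \<Longrightarrow> cv hsT \<odot> (cv halfT \<odot> c) \<odot> k = cv halfT \<odot> (cv hsT \<odot> c \<odot> k)"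
  by (rule induction_eq[of "\<lambda>k. cv hsT \<odot> (cv halfT \<odot> c) \<odot> k" "\<lambda>k. cv halfT \<odot> (cv hsT \<odot> c \<odot> k)"])
    (auto intro!: Rep_code)

text \<open>One halving removes the digit added last; \<open>hs_half\<close> moves it inside the
  other shifts, so that the induction on \<open>k\<close> goes through.\<close>

lemma hs_cd: "f \<in> dom T1 \<Longrightarrow> a \<in> Num \<Longrightarrow> k \<in> Num \<Longrightarrow> cv hsT \<odot> (cv cdT \<odot> f \<odot> (a \<oplus> k)) \<odot> k = cv cdT \<odot> f \<odot> a"
  by (rule induction_eq[of "\<lambda>k. cv hsT \<odot> (cv cdT \<odot> f \<odot> (a \<oplus> k)) \<odot> k" "\<lambda>k. cv cdT \<odot> f \<odot> a"])
    (auto intro!: Rep_code simp: hs_half[symmetric])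

text \<open>After \<open>n \<ominus> Su i\<close> shifts the code of the first \<open>Su i\<close>
  digits is left, and its parity is the digit with index \<open>i\<close>. The sign occurs because
  \<open>cdT\<close> stores signs only.\<close>

lemma dec_cd:
  assumes "f \<in> dom T1" "n \<in> Num" "i \<in> Num" "Su i \<preceq> n"
  shows "cv decT \<odot> (cv cdT \<odot> f \<odot> n) \<odot> n \<odot> i = cv sgT \<odot> (f \<odot> i)"
proof -
  obtain k where k: "k \<in> Num" "n = Su i \<oplus> k" using assms le_iff[of "Su i" n] by auto
  have "n \<ominus> Su i = k" unfolding k(2) using assms k(1) by (intro plus_monus) simp_all
  then have "cv decT \<odot> (cv cdT \<odot> f \<odot> n) \<odot> n \<odot> i = cv parT \<odot> (cv hsT \<odot> (cv cdT \<odot> f \<odot> n) \<odot> k)"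
    using assms by (simp add: dec_eq)
  also have "cv hsT \<odot> (cv cdT \<odot> f \<odot> n) \<odot> k = cv cdT \<odot> f \<odot> Su i"
    unfolding k(2) using assms k(1) by (intro hs_cd) simp_all
  finally show ?thesis using assms by simp
qed

lemma dbl_mono: "a \<in> Num \<Longrightarrow> b \<in> Num \<Longrightarrow> a \<preceq> b \<Longrightarrow> cv dblT \<odot> a \<preceq> cv dblT \<odot> b"
proof -
  assume a: "a \<in> Num" "b \<in> Num" "a \<preceq> b"
  then obtain c where c: "c \<in> Num" "b = a \<oplus> c" by (auto simp: le_iff)
  have "cv dblT \<odot> (a \<oplus> c) = cv dblT \<odot> a \<oplus> cv dblT \<odot> c"
    by (rule induction_eq[of "\<lambda>c. cv dblT \<odot> (a \<oplus> c)" "\<lambda>c. cv dblT \<odot> a \<oplus> cv dblT \<odot> c" c])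
      (use a c in \<open>auto intro!: Rep_code\<close>)
  then show ?thesis using a c by simp
qed

lemma cd_le:
  assumes "f \<in> dom T1" "g \<in> dom T1" "n \<in> Num" "\<And>i. i \<in> Num \<Longrightarrow> g \<odot> i = Su Z"
  shows "cv cdT \<odot> f \<odot> n \<preceq> cv cdT \<odot> g \<odot> n"
proof (rule induction_eq[of "\<lambda>n. cv cdT \<odot> f \<odot> n \<ominus> cv cdT \<odot> g \<odot> n" "\<lambda>n. Z" n])
  fix n assume n: "n \<in> Num" "cv cdT \<odot> f \<odot> n \<preceq> cv cdT \<odot> g \<odot> n"
  then show "cv cdT \<odot> f \<odot> Su n \<preceq> cv cdT \<odot> g \<odot> Su n"
    using assms by (simp add: plus_mono dbl_mono del: plus_Su)
qed (use assms in \<open>auto intro!: Rep_code\<close>)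

section \<open>Bounded search\<close>

lemma lst_le:
  assumes "f \<in> dom T1" "n \<in> Num" shows "cv lstT \<odot> f \<odot> n \<preceq> n"
proof (rule induction_eq[of "\<lambda>n. cv lstT \<odot> f \<odot> n \<ominus> n" "\<lambda>n. Z" n])
  fix n assume n: "n \<in> Num" "cv lstT \<odot> f \<odot> n \<preceq> n"
  then have "cv lstT \<odot> f \<odot> n \<oplus> cv sgT \<odot> (f \<odot> (cv lstT \<odot> f \<odot> n)) \<preceq> n \<oplus> Su Z"
    using assms by (intro plus_mono) simp_all
  then show "cv lstT \<odot> f \<odot> Su n \<preceq> Su n" using n assms by simp
qed (use assms in \<open>auto intro!: Rep_code\<close>)

text \<open>The counter advances as long as \<open>f\<close> is nonzero at it and stays put
  otherwise, so a counter that has fallen behind the number of steps rests on a zero.\<close>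

lemma lst_zero:
  assumes "f \<in> dom T1" "n \<in> Num" shows "cv lstT \<odot> f \<odot> n = n \<or> f \<odot> (cv lstT \<odot> f \<odot> n) = Z"
proof (rule induction_or[of "\<lambda>n. cv lstT \<odot> f \<odot> n" "\<lambda>n. n" "\<lambda>n. f \<odot> (cv lstT \<odot> f \<odot> n)" "\<lambda>n. Z" n])
  fix n assume n: "n \<in> Num" and IH: "cv lstT \<odot> f \<odot> n = n \<or> f \<odot> (cv lstT \<odot> f \<odot> n) = Z"
  have "f \<odot> (cv lstT \<odot> f \<odot> n) \<in> Num" using assms n by simp
  then show "cv lstT \<odot> f \<odot> Su n = Su n \<or> f \<odot> (cv lstT \<odot> f \<odot> Su n) = Z"
    by (rule num_cases) (use IH n assms in auto)
qed (use assms in \<open>auto intro!: Rep_code Rep_app1[OF assms(1)]\<close>)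

text \<open>The counter passes \<open>k\<close> only if \<open>f\<close> is nonzero there. The
  inequation is proved as the equation \<open>sg (f k) = 1\<close>, the shape that
  \<open>induction_imp\<close> requires.\<close>

lemma lst_least:
  assumes "f \<in> dom T1" "n \<in> Num" "k \<in> Num" "Su k \<preceq> cv lstT \<odot> f \<odot> n"
  shows "f \<odot> k \<noteq> Z"
proof -
  have "cv sgT \<odot> (f \<odot> k) = Su Z"
  proof (rule induction_imp[of "\<lambda>n. Su k \<ominus> cv lstT \<odot> f \<odot> n" "\<lambda>n. Z" "\<lambda>n. cv sgT \<odot> (f \<odot> k)" "\<lambda>n. Su Z" n])
    fix n assume n: "n \<in> Num" and IH: "Su k \<preceq> cv lstT \<odot> f \<odot> n \<Longrightarrow> cv sgT \<odot> (f \<odot> k) = Su Z"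
      and l: "Su k \<preceq> cv lstT \<odot> f \<odot> Su n"
    have "f \<odot> (cv lstT \<odot> f \<odot> n) \<in> Num" using assms n by simp
    then show "cv sgT \<odot> (f \<odot> k) = Su Z"
    proof (rule num_cases)
      assume "f \<odot> (cv lstT \<odot> f \<odot> n) = Z"
      then show ?thesis using IH l n assms(1) by simp
    next
      fix d assume d: "d \<in> Num" "f \<odot> (cv lstT \<odot> f \<odot> n) = Su d"
      then have "Su k \<preceq> Su (cv lstT \<odot> f \<odot> n)" using l n assms(1) by simp
      then have "Su k \<preceq> cv lstT \<odot> f \<odot> n \<or> k = cv lstT \<odot> f \<odot> n"
        using le_Su_iff[of "Su k" "cv lstT \<odot> f \<odot> n"] assms n by simp
      then show ?thesis using IH d by auto
    qed
  qed (use assms in \<open>auto intro!: Rep_code Rep_app1[OF assms(1)]\<close>)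
  then show ?thesis using Su_Z[OF Zero_dom] by (auto simp del: Su_Z)
qed

end

section \<open>The principles in a model\<close>

definition zerosT :: tm where "zerosT = C (K N N) \<cdot> zero"
definition onesT :: tm where "onesT = C (K N N) \<cdot> suc zero"

definition neT :: tm where
  "neT = (let a = (0, N); b = (1, N) in
     lam a (lam b (plusT \<cdot> (monusT \<cdot> V a \<cdot> V b) \<cdot> (monusT \<cdot> V b \<cdot> V a))))"

text \<open>\<open>badT \<phi> x n c d\<close> is nonzero iff the binary sequences coded by \<open>c\<close> and \<open>d\<close> (of length \<open>x\<close>)
  show that \<open>n\<close> is not a modulus of \<open>\<phi>\<close>; \<open>testT\<close> sums this over all codes for length \<open>x\<close>.\<close>

definition badT :: tm where
  "badT = (let \<phi> = (0, T2); x = (1, N); n = (2, N); c = (3, N); d = (4, N) in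
     lam \<phi> (lam x (lam n (lam c (lam d (condT \<cdot>
       (neT \<cdot> (segT \<cdot> (decT \<cdot> V c \<cdot> V x) \<cdot> V n) \<cdot> (segT \<cdot> (decT \<cdot> V d \<cdot> V x) \<cdot> V n)) \<cdot>
       (neT \<cdot> (V \<phi> \<cdot> (decT \<cdot> V c \<cdot> V x)) \<cdot> (V \<phi> \<cdot> (decT \<cdot> V d \<cdot> V x))) \<cdot> zero))))))"

definition testT :: tm where
  "testT = (let \<phi> = (0, T2); x = (1, N); n = (2, N); c = (3, N); d = (4, N);
       b = suc (cdT \<cdot> onesT \<cdot> V x) in
     lam \<phi> (lam x (lam n
       (sumT \<cdot> lam c (sumT \<cdot> lam d (badT \<cdot> V \<phi> \<cdot> V x \<cdot> V n \<cdot> V c \<cdot> V d) \<cdot> b) \<cdot> b))))"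

text \<open>The number \<open>\<Omega> \<phi>\<close> has a double role: it is the length at which
  sequences are coded and the value returned by an unsuccessful search.\<close>

definition xiT :: tm where
  "xiT = (let \<Omega> = (0, T3); \<phi> = (1, T2) in
     lam \<Omega> (lam \<phi> (lstT \<cdot> (testT \<cdot> V \<phi> \<cdot> (V \<Omega> \<cdot> V \<phi>)) \<cdot> (V \<Omega> \<cdot> V \<phi>))))"

text \<open>\<open>Proj\<close> applied to a sequence is itself a function on numbers and can be
  summed as it stands. The sum is at least as large as the unknown entry that is a modulus.\<close>

definition psiT :: tm where
  "psiT = (let F = (0, T2 \<rightarrow> Sq N); \<phi> = (1, T2) in
     lam F (lam \<phi> (sumT \<cdot> (C (Proj N) \<cdot> (V F \<cdot> V \<phi>)) \<cdot> (C (Len N) \<cdot> (V F \<cdot> V \<phi>)))))"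

definition sgfT :: tm where
  "sgfT = (let f = (0, T1); i = (1, N) in lam f (lam i (sgT \<cdot> (V f \<cdot> V i))))"

text \<open>Nonzero exactly where \<open>f\<close> exceeds 1, that is, where \<open>f\<close>
  differs from its truncation \<open>sgfT\<close>.\<close>

definition excessT :: tm where
  "excessT = (let f = (0, T1); i = (1, N) in lam f (lam i (sgT \<cdot> (predT \<cdot> (V f \<cdot> V i)))))"

text \<open>A zero of \<open>\<alpha>\<close> selects the truncation, any other value selects
  \<open>f\<close>. Thus \<open>zerosT\<close> yields \<open>sgfT f\<close> and
  \<open>excessT f\<close> yields \<open>f\<close>.\<close>

definition mixT :: tm where
  "mixT = (let f = (0, T1); \<alpha> = (1, T1); i = (2, N) in
     lam f (lam \<alpha> (lam i (condT \<cdot> (V \<alpha> \<cdot> V i) \<cdot> (sgT \<cdot> (V f \<cdot> V i)) \<cdot> (V f \<cdot> V i)))))"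

definition phiT :: tm where
  "phiT = (let \<phi> = (0, T2); f = (1, T1); \<alpha> = (2, T1) in
     lam \<phi> (lam f (lam \<alpha> (V \<phi> \<cdot> (mixT \<cdot> V f \<cdot> V \<alpha>)))))"

lemma functional_terms [simp]:
  "fvt zerosT = {}" "wt D zerosT" "ty_of zerosT = T1"
  "fvt onesT = {}" "wt D onesT" "ty_of onesT = T1"
  "fvt neT = {}" "wt D neT" "ty_of neT = N \<rightarrow> N \<rightarrow> N"
  "fvt badT = {}" "wt D badT" "ty_of badT = T2 \<rightarrow> N \<rightarrow> N \<rightarrow> N \<rightarrow> N \<rightarrow> N"
  "fvt testT = {}" "wt D testT" "ty_of testT = T2 \<rightarrow> N \<rightarrow> N \<rightarrow> N"
  "fvt xiT = {}" "wt D xiT" "ty_of xiT = T3 \<rightarrow> T3"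
  "fvt psiT = {}" "wt D psiT" "ty_of psiT = (T2 \<rightarrow> Sq N) \<rightarrow> T3"
  "fvt sgfT = {}" "wt D sgfT" "ty_of sgfT = T1 \<rightarrow> T1"
  "fvt excessT = {}" "wt D excessT" "ty_of excessT = T1 \<rightarrow> T1"
  "fvt mixT = {}" "wt D mixT" "ty_of mixT = T1 \<rightarrow> T1 \<rightarrow> T1"
  "fvt phiT = {}" "wt D phiT" "ty_of phiT = T2 \<rightarrow> T1 \<rightarrow> T2"
  by (auto simp: zerosT_def onesT_def neT_def badT_def testT_def xiT_def psiT_def sgfT_def excessT_def
      mixT_def phiT_def rec_def Let_def)

lemma rel_Neg [simp]: "rel (Neg A) = Neg (rel A)"
  and rel_And [simp]: "rel (And A B) = And (rel A) (rel B)"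
  by (simp_all add: Neg_def And_def)

text \<open>These facts decide which quantifiers \<open>rel\<close> relativises. The one in
  \<open>binary\<close> is among them: its body \<open>leq\<close> is an equation, not an
  implication from \<open>lt\<close>.\<close>

lemma not_bounded [simp]:
  "snd x \<noteq> N \<Longrightarrow> \<not> is_bounded x A" "\<not> is_bounded x (leq s t)" "\<not> is_bounded x (All y A)"
  "\<not> is_bounded x (Imp (modulus s t) A)"
  by (auto simp: is_bounded_def leq_def lt_def modulus_def Let_def)

lemma rel_leq [simp]: "rel (leq s t) = leq s t"
  by (simp add: leq_def)

lemma wff_modulus [simp]:
  "wt D s \<Longrightarrow> ty_of s = T2 \<Longrightarrow> wt D t \<Longrightarrow> ty_of t = N \<Longrightarrow> wff D (modulus s t)"
  by (simp add: modulus_def binary_def seg_def Let_def)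

lemma fv_leq [simp]: "fv (leq s t) = fvt s \<union> fvt t"
  by (simp add: leq_def)

lemma fv_modulus [simp]: "fv (modulus s t) = fvt s \<union> fvt t - {(2, T1), (3, T1)}"
  by (auto simp: modulus_def binary_def seg_def Let_def)

lemma internal_modulus [simp]: "internal (modulus s t)"
  by (simp add: modulus_def binary_def seg_def Let_def leq_def And_def Neg_def)

context pre_model
begin

lemma val_functional [simp]:
  "val \<rho> zerosT = cv zerosT" "val \<rho> onesT = cv onesT" "val \<rho> neT = cv neT" "val \<rho> badT = cv badT"
  "val \<rho> testT = cv testT" "val \<rho> mixT = cv mixT"
  by (simp_all add: val_cv)

lemma functional_dom [simp]:
  "cv zerosT \<in> dom T1" "cv onesT \<in> dom T1" "cv neT \<in> dom (N \<rightarrow> N \<rightarrow> N)"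
  "cv badT \<in> dom (T2 \<rightarrow> N \<rightarrow> N \<rightarrow> N \<rightarrow> N \<rightarrow> N)" "cv testT \<in> dom (T2 \<rightarrow> N \<rightarrow> N \<rightarrow> N)"
  "cv xiT \<in> dom (T3 \<rightarrow> T3)" "cv psiT \<in> dom ((T2 \<rightarrow> Sq N) \<rightarrow> T3)" "cv sgfT \<in> dom (T1 \<rightarrow> T1)"
  "cv excessT \<in> dom (T1 \<rightarrow> T1)" "cv mixT \<in> dom (T1 \<rightarrow> T1 \<rightarrow> T1)" "cv phiT \<in> dom (T2 \<rightarrow> T1 \<rightarrow> T2)"
  using cv_type[of zerosT] cv_type[of onesT] cv_type[of neT] cv_type[of badT] cv_type[of testT]
    cv_type[of xiT] cv_type[of psiT] cv_type[of sgfT] cv_type[of excessT] cv_type[of mixT] cv_type[of phiT]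
  by simp_all

lemma functional_st [simp]:
  "st (cv zerosT)" "st (cv onesT)" "st (cv cdT)" "st (cv decT)"
  "st (cv xiT)" "st (cv psiT)" "st (cv sgfT)" "st (cv excessT)" "st (cv phiT)"
  by (simp_all add: cv_st)

end

context model
begin

lemma ap_T2 [simp]: "\<phi> \<in> dom T2 \<Longrightarrow> f \<in> dom T1 \<Longrightarrow> \<phi> \<odot> f \<in> Num"
  and ap_T3 [simp]: "\<Omega> \<in> dom T3 \<Longrightarrow> \<phi> \<in> dom T2 \<Longrightarrow> \<Omega> \<odot> \<phi> \<in> Num"
  and ap_T11 [simp]: "F \<in> dom (T1 \<rightarrow> T1) \<Longrightarrow> f \<in> dom T1 \<Longrightarrow> F \<odot> f \<in> dom T1"
  and ap_T111 [simp]: "F2 \<in> dom (T1 \<rightarrow> T1 \<rightarrow> T1) \<Longrightarrow> f \<in> dom T1 \<Longrightarrow> g \<in> dom T1 \<Longrightarrow> F2 \<odot> f \<odot> g \<in> dom T1"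
  and ap_test [simp]: "T \<in> dom (T2 \<rightarrow> N \<rightarrow> N \<rightarrow> N) \<Longrightarrow> \<phi> \<in> dom T2 \<Longrightarrow> n \<in> Num \<Longrightarrow> T \<odot> \<phi> \<odot> n \<in> dom T1"
  and ap_phi [simp]: "P \<in> dom (T2 \<rightarrow> T1 \<rightarrow> T2) \<Longrightarrow> \<phi> \<in> dom T2 \<Longrightarrow> f \<in> dom T1 \<Longrightarrow> P \<odot> \<phi> \<odot> f \<in> dom T2"
  by (blast intro: ap_type)+

lemma zeros_eq [simp]: "i \<in> Num \<Longrightarrow> cv zerosT \<odot> i = Z"
  and ones_eq [simp]: "i \<in> Num \<Longrightarrow> cv onesT \<odot> i = Su Z"
  by (simp_all add: zerosT_def onesT_def cv_def K_eq)

lemma ne_eq: "a \<in> Num \<Longrightarrow> b \<in> Num \<Longrightarrow> cv neT \<odot> a \<odot> b = Z \<longleftrightarrow> a = b"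
proof -
  assume a: "a \<in> Num" "b \<in> Num"
  then have "cv neT \<odot> a \<odot> b = (a \<ominus> b) \<oplus> (b \<ominus> a)"
    by (simp add: neT_def cv_lam Let_def)
  then show ?thesis using a le_antisym[OF a] by (auto simp: plus_eq_Z)
qed

lemma bad_Z:
  assumes "\<phi> \<in> dom T2" "x \<in> Num" "n \<in> Num" "c \<in> Num" "d \<in> Num"
  shows "cv badT \<odot> \<phi> \<odot> x \<odot> n \<odot> c \<odot> d = Z \<longleftrightarrow>
    (cv segT \<odot> (cv decT \<odot> c \<odot> x) \<odot> n = cv segT \<odot> (cv decT \<odot> d \<odot> x) \<odot> n \<longrightarrow>
     \<phi> \<odot> (cv decT \<odot> c \<odot> x) = \<phi> \<odot> (cv decT \<odot> d \<odot> x))"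
proof -
  let ?c = "cv decT \<odot> c \<odot> x" and ?d = "cv decT \<odot> d \<odot> x"
  let ?s = "cv neT \<odot> (cv segT \<odot> ?c \<odot> n) \<odot> (cv segT \<odot> ?d \<odot> n)" and ?p = "cv neT \<odot> (\<phi> \<odot> ?c) \<odot> (\<phi> \<odot> ?d)"
  have b: "cv badT \<odot> \<phi> \<odot> x \<odot> n \<odot> c \<odot> d = cv condT \<odot> ?s \<odot> ?p \<odot> Z"
    using assms by (simp add: badT_def cv_lam Let_def)
  have n: "?s \<in> Num" "?p \<in> Num" using assms by simp_all
  have s: "?s = Z \<longleftrightarrow> cv segT \<odot> ?c \<odot> n = cv segT \<odot> ?d \<odot> n" and p: "?p = Z \<longleftrightarrow> \<phi> \<odot> ?c = \<phi> \<odot> ?d"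
    using assms by (simp_all add: ne_eq)
  show ?thesis unfolding b s[symmetric] p[symmetric]
    by (rule num_cases[OF n(1)]) (use n(2) in simp_all)
qed

lemma test_Z:
  assumes "\<phi> \<in> dom T2" "x \<in> Num" "n \<in> Num"
  shows "cv testT \<odot> \<phi> \<odot> x \<odot> n = Z \<longleftrightarrow> (\<forall>c\<in>Num. \<forall>d\<in>Num. c \<preceq> cv cdT \<odot> cv onesT \<odot> x \<longrightarrow>
    d \<preceq> cv cdT \<odot> cv onesT \<odot> x \<longrightarrow> cv badT \<odot> \<phi> \<odot> x \<odot> n \<odot> c \<odot> d = Z)"
proof -
  let ?\<rho> = "e0((0, T2) := \<phi>, (1, N) := x, (2, N) := n)"
  let ?B = "cv cdT \<odot> cv onesT \<odot> x"
  let ?b = "suc (cdT \<cdot> onesT \<cdot> V (1, N))"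
  let ?i = "lam (4, N) (badT \<cdot> V (0, T2) \<cdot> V (1, N) \<cdot> V (2, N) \<cdot> V (3, N) \<cdot> V (4, N))"
  let ?G = "val ?\<rho> (lam (3, N) (sumT \<cdot> ?i \<cdot> ?b))"
  have B: "?B \<in> Num" using assms by simp
  have G: "?G \<in> dom T1" using assms by simp
  have t: "cv testT \<odot> \<phi> \<odot> x \<odot> n = cv sumT \<odot> ?G \<odot> Su ?B"
    using assms by (simp add: testT_def cv_lam Let_def)
  have I: "val (?\<rho>((3, N) := c)) ?i \<in> dom T1" "\<And>d. d \<in> Num \<Longrightarrow> val (?\<rho>((3, N) := c)) ?i \<odot> d = cv badT \<odot> \<phi> \<odot> x \<odot> n \<odot> c \<odot> d"
    "?G \<odot> c = cv sumT \<odot> val (?\<rho>((3, N) := c)) ?i \<odot> Su ?B" if "c \<in> Num" for c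
    using assms that by simp_all
  \<comment> \<open>The sum runs below \<open>Su ?B\<close>, so the code \<open>?B\<close> of the
    all-ones sequence is included.\<close>
  have "(\<forall>c\<in>Num. c \<preceq> ?B \<longrightarrow> ?G \<odot> c = Z) \<longleftrightarrow> cv sumT \<odot> ?G \<odot> Su ?B = Z"
    using sum_Z_D[OF G _ Succ_dom[OF B]] sum_eq_Z[OF G Succ_dom[OF B]] B by auto
  moreover have "(\<forall>d\<in>Num. d \<preceq> ?B \<longrightarrow> cv badT \<odot> \<phi> \<odot> x \<odot> n \<odot> c \<odot> d = Z) \<longleftrightarrow> ?G \<odot> c = Z" if c: "c \<in> Num" for c
    using sum_Z_D[OF I(1)[OF c] _ Succ_dom[OF B]] sum_eq_Z[OF I(1)[OF c] Succ_dom[OF B]] B I(2)[OF c]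
    unfolding I(3)[OF c] by auto
  ultimately show ?thesis unfolding t by blast
qed

lemma xi_eq:
  "\<Omega> \<in> dom T3 \<Longrightarrow> \<phi> \<in> dom T2 \<Longrightarrow>
    cv xiT \<odot> \<Omega> \<odot> \<phi> = cv lstT \<odot> (cv testT \<odot> \<phi> \<odot> (\<Omega> \<odot> \<phi>)) \<odot> (\<Omega> \<odot> \<phi>)"
  by (simp add: xiT_def cv_lam Let_def)

lemma psi_eq:
  "F \<in> dom (T2 \<rightarrow> Sq N) \<Longrightarrow> \<phi> \<in> dom T2 \<Longrightarrow>
    cv psiT \<odot> F \<odot> \<phi> = cv sumT \<odot> (cs (Proj N) \<odot> (F \<odot> \<phi>)) \<odot> (cs (Len N) \<odot> (F \<odot> \<phi>))"
  by (simp add: psiT_def cv_lam Let_def)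

lemma sgf_eq [simp]: "f \<in> dom T1 \<Longrightarrow> i \<in> Num \<Longrightarrow> cv sgfT \<odot> f \<odot> i = cv sgT \<odot> (f \<odot> i)"
  by (simp add: sgfT_def cv_lam Let_def)

lemma excess_eq [simp]: "f \<in> dom T1 \<Longrightarrow> i \<in> Num \<Longrightarrow> cv excessT \<odot> f \<odot> i = cv sgT \<odot> (cv predT \<odot> (f \<odot> i))"
  by (simp add: excessT_def cv_lam Let_def)

lemma mix_eq [simp]: "f \<in> dom T1 \<Longrightarrow> \<alpha> \<in> dom T1 \<Longrightarrow> i \<in> Num \<Longrightarrow>
    cv mixT \<odot> f \<odot> \<alpha> \<odot> i = cv condT \<odot> (\<alpha> \<odot> i) \<odot> (cv sgT \<odot> (f \<odot> i)) \<odot> (f \<odot> i)"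
  by (simp add: mixT_def cv_lam Let_def)

lemma phi_eq: "\<phi> \<in> dom T2 \<Longrightarrow> f \<in> dom T1 \<Longrightarrow> \<alpha> \<in> dom T1 \<Longrightarrow> cv phiT \<odot> \<phi> \<odot> f \<odot> \<alpha> = \<phi> \<odot> (cv mixT \<odot> f \<odot> \<alpha>)"
  by (simp add: phiT_def cv_lam Let_def)

section \<open>Semantic forms of the principles\<close>

definition Bin :: "'a \<Rightarrow> bool" where "Bin f \<longleftrightarrow> (\<forall>i\<in>Num. f \<odot> i \<preceq> Su Z)"
definition BinSt :: "'a \<Rightarrow> bool" where "BinSt f \<longleftrightarrow> (\<forall>i\<in>Num. st i \<longrightarrow> f \<odot> i \<preceq> Su Z)"

definition Mod :: "'a \<Rightarrow> 'a \<Rightarrow> bool" where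
  "Mod \<phi> n \<longleftrightarrow> (\<forall>f\<in>dom T1. \<forall>g\<in>dom T1. Bin f \<and> Bin g \<longrightarrow>
     cv segT \<odot> f \<odot> n = cv segT \<odot> g \<odot> n \<longrightarrow> \<phi> \<odot> f = \<phi> \<odot> g)"
text \<open>The value of the relativised \<open>modulus\<close>: the quantifiers over sequences are
  restricted, and so are those hidden in \<open>binary\<close>.\<close>

definition ModSt :: "'a \<Rightarrow> 'a \<Rightarrow> bool" where
  "ModSt \<phi> n \<longleftrightarrow> (\<forall>f\<in>dom T1. st f \<longrightarrow> (\<forall>g\<in>dom T1. st g \<longrightarrow> BinSt f \<and> BinSt g \<longrightarrow>
     cv segT \<odot> f \<odot> n = cv segT \<odot> g \<odot> n \<longrightarrow> \<phi> \<odot> f = \<phi> \<odot> g))"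

lemma sat_leq [simp]: "sat \<rho> (leq s t) \<longleftrightarrow> val \<rho> s \<preceq> val \<rho> t"
  by (simp add: leq_def)

lemma sat_modulus [simp]:
  assumes "{(2, T1), (3, T1)} \<inter> (fvt s \<union> fvt t) = {}"
  shows "sat \<rho> (modulus s t) \<longleftrightarrow> Mod (val \<rho> s) (val \<rho> t)"
  using assms by (simp add: modulus_def Let_def binary_def seg_def Mod_def Bin_def)

lemma sat_rel_modulus [simp]:
  assumes "{(2, T1), (3, T1)} \<inter> (fvt s \<union> fvt t) = {}"
  shows "sat \<rho> (rel (modulus s t)) \<longleftrightarrow> ModSt (val \<rho> s) (val \<rho> t)"
  using assms by (simp add: modulus_def Let_def binary_def seg_def ModSt_def BinSt_def)

lemma sat_MUC: "sat \<rho> MUC \<longleftrightarrow> (\<exists>\<Omega>\<in>dom T3. \<forall>\<phi>\<in>dom T2. Mod \<phi> (\<Omega> \<odot> \<phi>))"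
  by (simp add: MUC_def Let_def)

lemma sat_rel_MUC: "sat \<rho> (rel MUC) \<longleftrightarrow> (\<exists>\<Omega>\<in>dom T3. st \<Omega> \<and> (\<forall>\<phi>\<in>dom T2. st \<phi> \<longrightarrow> ModSt \<phi> (\<Omega> \<odot> \<phi>)))"
  by (simp add: MUC_def Let_def fm.simps Ex_def del: sat_Ex)

lemma sat_PP: "sat \<rho> \<PP> \<longleftrightarrow> (\<forall>\<phi>\<in>dom T2. st \<phi> \<longrightarrow> (\<exists>x\<in>Num. st x \<and> Mod \<phi> x))"
  by (simp add: \<PP>_def Let_def)

lemma sat_rel_M: "sat \<rho> (rel M) \<longleftrightarrow> (\<forall>\<phi>\<in>dom T2. st \<phi> \<longrightarrow> ModSt \<phi> (\<rho> (0, T3) \<odot> \<phi>) \<and>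
    (\<forall>m\<in>Num. st m \<longrightarrow> ModSt \<phi> m \<longrightarrow> \<rho> (0, T3) \<odot> \<phi> \<preceq> m))"
  by (simp add: M_def Let_def)

section \<open>The equivalences\<close>

lemma st_below: "a \<in> Num \<Longrightarrow> b \<in> Num \<Longrightarrow> st b \<Longrightarrow> a \<preceq> b \<Longrightarrow> st a"
proof -
  assume a: "a \<in> Num" "b \<in> Num" "st b" "a \<preceq> b"
  have "sat (e0((0, N) := a, (1, N) := b)) (Imp (And (St v1) (leq v0 v1)) (St v0))"
    by (rule ax[OF RCA0\<Omega>_axiom.st_below]) (simp_all add: a)
  then show "st a" using a by simp
qed

lemma st_index: "i \<in> Num \<Longrightarrow> n \<in> Num \<Longrightarrow> st n \<Longrightarrow> Su i \<preceq> n \<Longrightarrow> st i"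
  using st_below[of i n] le_trans[of i "Su i" n] le_Su[of i] by simp

lemma ModStD:
  "ModSt \<phi> n \<Longrightarrow> f \<in> dom T1 \<Longrightarrow> g \<in> dom T1 \<Longrightarrow> st f \<Longrightarrow> st g \<Longrightarrow> BinSt f \<Longrightarrow> BinSt g \<Longrightarrow>
    cv segT \<odot> f \<odot> n = cv segT \<odot> g \<odot> n \<Longrightarrow> \<phi> \<odot> f = \<phi> \<odot> g"
  unfolding ModSt_def by blast

lemma Bin_imp_BinSt: "Bin f \<Longrightarrow> BinSt f"
  by (simp add: Bin_def BinSt_def)

lemma Bin_sgf: "f \<in> dom T1 \<Longrightarrow> Bin (cv sgfT \<odot> f)"
  by (simp add: Bin_def)

lemma Bin_dec: "c \<in> Num \<Longrightarrow> n \<in> Num \<Longrightarrow> Bin (cv decT \<odot> c \<odot> n)"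
  by (simp add: Bin_def dec_eq par_le)

lemma st_dec:
  assumes "c \<in> Num" "n \<in> Num" "st c" "st n" shows "st (cv decT \<odot> c \<odot> n)"
  by (rule st_ap[of _ _ N T1], rule st_ap[of _ _ N "N \<rightarrow> T1"]) (simp_all add: assms ap_type[OF code_dom(7)])

lemma st_cd:
  assumes "f \<in> dom T1" "n \<in> Num" "st f" "st n" shows "st (cv cdT \<odot> f \<odot> n)"
  by (rule st_ap[of _ _ N N], rule st_ap[of _ _ T1 "N \<rightarrow> N"]) (simp_all add: assms ap_type[OF code_dom(5)])

text \<open>A segment of standard length reads standard arguments only, where \<open>f\<close> is
  binary and so unaffected by \<open>sgT\<close>.\<close>

lemma seg_sgf:
  assumes "f \<in> dom T1" "BinSt f" "n \<in> Num" "st n"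
  shows "cv segT \<odot> (cv sgfT \<odot> f) \<odot> n = cv segT \<odot> f \<odot> n"
proof (rule seg_cong)
  fix i assume i: "i \<in> Num" "Su i \<preceq> n"
  then have "f \<odot> i \<preceq> Su Z" using st_index[of i n] assms by (simp add: BinSt_def)
  then show "cv sgfT \<odot> f \<odot> i = f \<odot> i" using assms(1) i by (simp add: sg_id)
qed (use assms in simp_all)

text \<open>Below \<open>x\<close> decoding reproduces the sign of \<open>f\<close>. The arguments
  there are standard, so the sign is the value of \<open>f\<close> itself.\<close>

lemma seg_dec:
  assumes "f \<in> dom T1" "BinSt f" "x \<in> Num" "st x" "n \<in> Num" "n \<preceq> x"
  shows "cv segT \<odot> (cv decT \<odot> (cv cdT \<odot> f \<odot> x) \<odot> x) \<odot> n = cv segT \<odot> f \<odot> n"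
proof (rule seg_cong)
  fix i assume i: "i \<in> Num" "Su i \<preceq> n"
  have l: "Su i \<preceq> x" by (rule le_trans[of "Su i" n x]) (use i assms in simp_all)
  then have "f \<odot> i \<preceq> Su Z" using st_index[of i x] assms i by (simp add: BinSt_def)
  then show "cv decT \<odot> (cv cdT \<odot> f \<odot> x) \<odot> x \<odot> i = f \<odot> i"
    using dec_cd[OF assms(1,3) i(1) l] assms(1) i by (simp add: sg_id)
qed (use assms in simp_all)

text \<open>A standard \<open>f\<close> that is binary at standard arguments may fail to be binary, so \<open>\<PP>\<close> does not
  apply to it directly. Selecting pointwise between \<open>f\<close> and its truncation by means of a binary
  sequence \<open>\<alpha>\<close> turns \<open>\<phi>\<close> into a functional on Cantor space, to which it does apply; the
  sequences \<open>\<alpha>\<close> that select the truncation and \<open>f\<close> itself agree at standard arguments.\<close>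

lemma \<phi>_sgf:
  assumes PP: "\<And>\<phi>. \<phi> \<in> dom T2 \<Longrightarrow> st \<phi> \<Longrightarrow> \<exists>x\<in>Num. st x \<and> Mod \<phi> x"
    and \<phi>: "\<phi> \<in> dom T2" "st \<phi>" and f: "f \<in> dom T1" "st f" "BinSt f"
  shows "\<phi> \<odot> (cv sgfT \<odot> f) = \<phi> \<odot> f"
proof -
  let ?\<psi> = "cv phiT \<odot> \<phi> \<odot> f" and ?\<alpha> = "cv zerosT" and ?\<beta> = "cv excessT \<odot> f"
  have "st ?\<psi>"
    by (rule st_ap[of _ _ T1 T2], rule st_ap[of _ _ T2 "T1 \<rightarrow> T2"]) (simp_all add: \<phi> f ap_type[OF functional_dom(11)])
  then obtain x where x: "x \<in> Num" "st x" "Mod ?\<psi> x" using PP[of ?\<psi>] \<phi> f by auto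
  have "Bin ?\<alpha>" "Bin ?\<beta>" using f by (simp_all add: Bin_def)
  moreover have "cv segT \<odot> ?\<alpha> \<odot> x = cv segT \<odot> ?\<beta> \<odot> x"
  proof (rule seg_cong)
    fix i assume i: "i \<in> Num" "Su i \<preceq> x"
    then have "f \<odot> i \<preceq> Su Z" using st_index[of i x] x f by (simp add: BinSt_def)
    then have "f \<odot> i = Z \<or> f \<odot> i = Su Z" using le_Su_iff[of "f \<odot> i" Z] i f by simp
    then show "?\<alpha> \<odot> i = ?\<beta> \<odot> i" using i f by auto
  qed (use f x in simp_all)
  ultimately have "?\<psi> \<odot> ?\<alpha> = ?\<psi> \<odot> ?\<beta>" using x(3) f unfolding Mod_def by simp
  moreover have "cv mixT \<odot> f \<odot> ?\<alpha> = cv sgfT \<odot> f"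
    by (rule funext[of _ N N]) (use f in simp_all)
  moreover have "cv mixT \<odot> f \<odot> ?\<beta> = f"
  proof (rule funext[of _ N N])
    fix i assume i: "i \<in> Num"
    then have n: "f \<odot> i \<in> Num" using f by simp
    show "cv mixT \<odot> f \<odot> ?\<beta> \<odot> i = f \<odot> i"
    proof (rule num_cases[OF n])
      \<comment> \<open>For \<open>b = Z\<close> the excess is zero and the truncation is selected,
        which agrees with the value 1 of \<open>f\<close>; otherwise the excess is one and
        \<open>f\<close> is selected.\<close>
      fix b assume b: "b \<in> Num" "f \<odot> i = Su b"
      show ?thesis by (rule num_cases[OF b(1)]) (use i b f in simp_all)
    qed (use i f in simp)
  qed (use f in simp_all)
  ultimately show ?thesis using \<phi> f by (simp add: phi_eq)
qed

section \<open>The three implications\<close>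

lemma MUC_PP:
  assumes "sat \<rho> MUC" shows "sat \<rho> \<PP>"
proof -
  \<comment> \<open>Transfer concerns universal statements; applied to this negation, its
    contrapositive yields a standard fan functional.\<close>
  let ?A = "Neg (All (1, T2) (modulus (V (1, T2)) (V (0, T3) \<cdot> V (1, T2))))"
  have "sat e0 (Imp (foldr AllSt [(0, T3)] ?A) (foldr All [(0, T3)] ?A))"
    by (rule ax[OF RCA0\<Omega>_axiom.PF_TP]) (auto simp: Neg_def AllSt_def)
  then obtain \<Omega> where \<Omega>: "\<Omega> \<in> dom T3" "st \<Omega>" "\<And>\<phi>. \<phi> \<in> dom T2 \<Longrightarrow> Mod \<phi> (\<Omega> \<odot> \<phi>)"
    using assms by (auto simp: sat_MUC)
  show ?thesis unfolding sat_PP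
  proof (intro ballI HOL.impI)
    fix \<phi> assume \<phi>: "\<phi> \<in> dom T2" "st \<phi>"
    then have "st (\<Omega> \<odot> \<phi>)" using \<Omega> by (intro st_ap[of _ _ T2 N])
    then show "\<exists>x\<in>Num. st x \<and> Mod \<phi> x" using \<Omega> \<phi> by (intro bexI[of _ "\<Omega> \<odot> \<phi>"]) simp_all
  qed
qed

text \<open>Sequences with equal segments of length \<open>n\<close> have equal segments of length
  \<open>k\<close>, by \<open>seg_le\<close>.\<close>

lemma Mod_mono:
  assumes "Mod \<phi> k" "k \<in> Num" "n \<in> Num" "k \<preceq> n" shows "Mod \<phi> n"
  using assms seg_le[of _ _ n k] unfolding Mod_def by blast

text \<open>\<open>HAC_int\<close> does not choose a modulus; it gives a finite sequence of
  candidates, at least one of them correct. Membership is unfolded to an index below the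
  length.\<close>

lemma HAC_modulus:
  assumes "sat e0 \<PP>"
  obtains F where "F \<in> dom (T2 \<rightarrow> Sq N)" "st F"
    "\<And>\<phi>. \<phi> \<in> dom T2 \<Longrightarrow> st \<phi> \<Longrightarrow> \<exists>i\<in>Num. Su i \<preceq> cs (Len N) \<odot> (F \<odot> \<phi>) \<and> Mod \<phi> (cs (Proj N) \<odot> (F \<odot> \<phi>) \<odot> i)"
proof -
  let ?\<phi> = "(1, T2)" and ?y = "(4, N)" and ?F = "(5, T2 \<rightarrow> Sq N)"
  let ?A = "modulus (V ?\<phi>) (V ?y)"
  let ?C = "ExSt ?F (AllSt ?\<phi> (Ex ?y (And (mem (V ?y) (V ?F \<cdot> V ?\<phi>)) ?A)))"
  have "wff D (Imp (AllSt ?\<phi> (ExSt ?y ?A)) ?C)"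
    by (simp add: AllSt_def ExSt_def Ex_def mem_def Let_def BEx_def BAll_def wff_eq)
  then have "sat e0 (Imp (AllSt ?\<phi> (ExSt ?y ?A)) ?C)"
    by (intro ax[OF RCA0\<Omega>_axiom.HAC_int]) simp_all
  moreover have "sat e0 (AllSt ?\<phi> (ExSt ?y ?A))" using assms by (simp add: \<PP>_def Let_def)
  ultimately have "sat e0 ?C" by simp
  then obtain F where F: "F \<in> dom (T2 \<rightarrow> Sq N)" "st F"
    and *: "\<And>\<phi>. \<phi> \<in> dom T2 \<Longrightarrow> st \<phi> \<Longrightarrow> \<exists>y\<in>Num. (\<exists>i\<in>Num. LT i (cs (Len N) \<odot> (F \<odot> \<phi>)) \<and>
      y = cs (Proj N) \<odot> (F \<odot> \<phi>) \<odot> i) \<and> Mod \<phi> y"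
    by (auto simp: sat_mem)
  show thesis
  proof (rule that[OF F])
    fix \<phi> assume "\<phi> \<in> dom T2" "st \<phi>"
    from *[OF this] show "\<exists>i\<in>Num. Su i \<preceq> cs (Len N) \<odot> (F \<odot> \<phi>) \<and> Mod \<phi> (cs (Proj N) \<odot> (F \<odot> \<phi>) \<odot> i)"
      by (auto simp: LT_iff[of _ _ e0])
  qed
qed

lemma PP_rel_MUC:
  assumes "sat e0 \<PP>" shows "sat \<rho> (rel MUC)"
proof -
  note PP = assms[unfolded sat_PP, rule_format]
  obtain F where F: "F \<in> dom (T2 \<rightarrow> Sq N)" "st F"
    "\<And>\<phi>. \<phi> \<in> dom T2 \<Longrightarrow> st \<phi> \<Longrightarrow> \<exists>i\<in>Num. Su i \<preceq> cs (Len N) \<odot> (F \<odot> \<phi>) \<and> Mod \<phi> (cs (Proj N) \<odot> (F \<odot> \<phi>) \<odot> i)"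
    using HAC_modulus[OF assms] by blast
  let ?\<Psi> = "cv psiT \<odot> F"
  have \<Psi>: "?\<Psi> \<in> dom T3" "st ?\<Psi>"
    by (rule ap_type[OF functional_dom(7) F(1)]) (rule st_ap[OF functional_st(6) F(2) functional_dom(7) F(1)])
  have "ModSt \<phi> (?\<Psi> \<odot> \<phi>)" if \<phi>: "\<phi> \<in> dom T2" "st \<phi>" for \<phi>
  proof -
    let ?n = "?\<Psi> \<odot> \<phi>"
    have n: "?n \<in> Num" "st ?n" using \<Psi> \<phi> st_ap[OF \<Psi>(2) \<phi>(2) \<Psi>(1) \<phi>(1)] by simp_all
    have s: "F \<odot> \<phi> \<in> dom (Sq N)" by (rule ap_type[OF F(1) \<phi>(1)])
    have p: "cs (Proj N) \<odot> (F \<odot> \<phi>) \<in> dom T1" using ap_type[OF cs_type[of "Proj N", simplified] s] .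
    obtain i where i: "i \<in> Num" "Su i \<preceq> cs (Len N) \<odot> (F \<odot> \<phi>)" "Mod \<phi> (cs (Proj N) \<odot> (F \<odot> \<phi>) \<odot> i)"
      using F(3)[OF \<phi>] by blast
    have le: "cs (Proj N) \<odot> (F \<odot> \<phi>) \<odot> i \<preceq> ?n"
      unfolding psi_eq[OF F(1) \<phi>(1)] by (rule sum_ge[OF p i(1) Len_dom[OF s] i(2)])
    have m: "Mod \<phi> ?n" by (rule Mod_mono[OF i(3) _ n(1) le]) (use p i(1) in simp)
    show ?thesis unfolding ModSt_def
    proof (intro ballI HOL.impI)
      fix f g assume f: "f \<in> dom T1" "st f" and g: "g \<in> dom T1" "st g" and b: "BinSt f \<and> BinSt g"
        and e: "cv segT \<odot> f \<odot> ?n = cv segT \<odot> g \<odot> ?n"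
      \<comment> \<open>The truncations are binary everywhere and, \<open>?n\<close> being standard,
        have the same segments of this length as \<open>f\<close> and \<open>g\<close>; so the
        internal modulus applies to them.\<close>
      have "\<phi> \<odot> (cv sgfT \<odot> f) = \<phi> \<odot> (cv sgfT \<odot> g)"
        using m f g b e n seg_sgf unfolding Mod_def by (simp add: Bin_sgf)
      then show "\<phi> \<odot> f = \<phi> \<odot> g" using \<phi>_sgf[OF PP \<phi>] f g b by simp
    qed
  qed
  with \<Psi> show ?thesis unfolding sat_rel_MUC by blast
qed

text \<open>The tested sequences are decoded from codes up to the standard bound \<open>?B\<close>,
  hence standard and binary, so a relativised modulus passes the test. Conversely, a standard
  sequence that is binary at standard arguments agrees with a tested one up to
  \<open>\<Omega> \<phi>\<close>, so \<open>\<phi>\<close> takes the same value at both.\<close>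

lemma Xi_correct:
  assumes \<Omega>: "\<Omega> \<in> dom T3" "st \<Omega>" and \<phi>: "\<phi> \<in> dom T2" "st \<phi>" and x: "ModSt \<phi> (\<Omega> \<odot> \<phi>)"
  defines "n \<equiv> cv xiT \<odot> \<Omega> \<odot> \<phi>"
  shows "ModSt \<phi> n" "m \<in> Num \<Longrightarrow> st m \<Longrightarrow> ModSt \<phi> m \<Longrightarrow> n \<preceq> m"
proof -
  let ?x = "\<Omega> \<odot> \<phi>"
  let ?T = "cv testT \<odot> \<phi> \<odot> ?x" and ?B = "cv cdT \<odot> cv onesT \<odot> ?x"
  have xN: "?x \<in> Num" "st ?x" using \<Omega> \<phi> st_ap[OF \<Omega>(2) \<phi>(2) \<Omega>(1) \<phi>(1)] by simp_all
  have T: "?T \<in> dom T1" using \<phi> xN by simp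
  have B: "?B \<in> Num" "st ?B" using xN st_cd[of "cv onesT" ?x] by simp_all
  have n: "n = cv lstT \<odot> ?T \<odot> ?x" using xi_eq[OF \<Omega>(1) \<phi>(1)] by (simp add: n_def)
  have nN: "n \<in> Num" using T xN by (simp add: n)
  have nx: "n \<preceq> ?x" using lst_le[OF T xN(1)] by (simp add: n)
  have dec: "cv decT \<odot> c \<odot> ?x \<in> dom T1" "Bin (cv decT \<odot> c \<odot> ?x)" "c \<preceq> ?B \<Longrightarrow> st (cv decT \<odot> c \<odot> ?x)"
    if "c \<in> Num" for c
    using that xN B st_below[of c ?B] by (simp_all add: Bin_dec st_dec)
  show "ModSt \<phi> n"
  \<comment> \<open>The search returns \<open>?x\<close> when no smaller number passes the test;
    that value is a relativised modulus by assumption.\<close>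
  proof (cases "n = ?x")
    case True
    then show ?thesis using x by simp
  next
    case False
    then have t: "?T \<odot> n = Z" using lst_zero[OF T xN(1)] by (simp add: n)
    show ?thesis unfolding ModSt_def
    proof (intro ballI HOL.impI)
      fix f g assume f: "f \<in> dom T1" "st f" and g: "g \<in> dom T1" "st g" and b: "BinSt f \<and> BinSt g"
        and e: "cv segT \<odot> f \<odot> n = cv segT \<odot> g \<odot> n"
      let ?c = "\<lambda>f. cv cdT \<odot> f \<odot> ?x"
      let ?d = "\<lambda>f. cv decT \<odot> ?c f \<odot> ?x"
      have c: "?c h \<in> Num" "?c h \<preceq> ?B" "cv segT \<odot> ?d h \<odot> n = cv segT \<odot> h \<odot> n" "\<phi> \<odot> ?d h = \<phi> \<odot> h"
        if h: "h \<in> dom T1" "st h" "BinSt h" for h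
      proof -
        show 1: "?c h \<in> Num" using h xN by simp
        show 2: "?c h \<preceq> ?B" using cd_le[of h "cv onesT" ?x] h xN by simp
        show "cv segT \<odot> ?d h \<odot> n = cv segT \<odot> h \<odot> n" using seg_dec[OF h(1,3) xN nN nx] .
        \<comment> \<open>Agreement up to \<open>?x\<close> lets the given modulus identify the
          values of \<open>\<phi>\<close>; the agreement up to \<open>n\<close> shown before feeds
          the test.\<close>
        have "cv segT \<odot> ?d h \<odot> ?x = cv segT \<odot> h \<odot> ?x" using seg_dec[OF h(1,3) xN xN(1)] xN by simp
        then show "\<phi> \<odot> ?d h = \<phi> \<odot> h"
          by (rule ModStD[OF x dec(1)[OF 1] h(1) dec(3)[OF 1 2] h(2) Bin_imp_BinSt[OF dec(2)[OF 1]] h(3)])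
      qed
      note cf = c[OF f conjunct1[OF b]] and cg = c[OF g conjunct2[OF b]]
      have "cv badT \<odot> \<phi> \<odot> ?x \<odot> n \<odot> ?c f \<odot> ?c g = Z"
        using t[unfolded test_Z[OF \<phi>(1) xN(1) nN]] cf(1,2) cg(1,2) by blast
      then have "cv segT \<odot> ?d f \<odot> n = cv segT \<odot> ?d g \<odot> n \<longrightarrow> \<phi> \<odot> ?d f = \<phi> \<odot> ?d g"
        unfolding bad_Z[OF \<phi>(1) xN(1) nN cf(1) cg(1)] .
      then show "\<phi> \<odot> f = \<phi> \<odot> g" unfolding cf(3,4) cg(3,4) using e by blast
    qed
  qed
  show "n \<preceq> m" if m: "m \<in> Num" "st m" "ModSt \<phi> m"
  proof (rule ccontr)
    assume "\<not> n \<preceq> m"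
    then have "?T \<odot> m \<noteq> Z" using lst_least[OF T xN(1) m(1)] not_le[OF nN m(1)] by (simp add: n)
    \<comment> \<open>A failed test is a counterexample made of standard binary sequences, which
      \<open>ModSt \<phi> m\<close> rules out.\<close>
    then obtain c d where cd: "c \<in> Num" "d \<in> Num" "c \<preceq> ?B" "d \<preceq> ?B"
      and "cv badT \<odot> \<phi> \<odot> ?x \<odot> m \<odot> c \<odot> d \<noteq> Z"
      unfolding test_Z[OF \<phi>(1) xN(1) m(1)] by blast
    then have *: "cv segT \<odot> (cv decT \<odot> c \<odot> ?x) \<odot> m = cv segT \<odot> (cv decT \<odot> d \<odot> ?x) \<odot> m"
      "\<phi> \<odot> (cv decT \<odot> c \<odot> ?x) \<noteq> \<phi> \<odot> (cv decT \<odot> d \<odot> ?x)"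
      unfolding bad_Z[OF \<phi>(1) xN(1) m(1) cd(1,2)] by blast+
    have "\<phi> \<odot> (cv decT \<odot> c \<odot> ?x) = \<phi> \<odot> (cv decT \<odot> d \<odot> ?x)"
      by (rule ModStD[OF m(3) dec(1)[OF cd(1)] dec(1)[OF cd(2)] dec(3)[OF cd(1,3)] dec(3)[OF cd(2,4)]
            Bin_imp_BinSt[OF dec(2)[OF cd(1)]] Bin_imp_BinSt[OF dec(2)[OF cd(2)]] *(1)])
    with *(2) show False by blast
  qed
qed

lemma rel_MUC_MUC:
  assumes "sat e0 (rel MUC)" shows "sat \<rho> MUC"
proof -
  let ?\<Xi> = "(0, T3)" and ?\<phi> = "(1, T2)"
  obtain \<Omega> where \<Omega>: "\<Omega> \<in> dom T3" "st \<Omega>" "\<And>\<phi>. \<phi> \<in> dom T2 \<Longrightarrow> st \<phi> \<Longrightarrow> ModSt \<phi> (\<Omega> \<odot> \<phi>)"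
    using assms by (auto simp: sat_rel_MUC)
  let ?X = "cv xiT \<odot> \<Omega>"
  have X: "?X \<in> dom T3" "st ?X"
    by (rule ap_type[OF functional_dom(6) \<Omega>(1)]) (rule st_ap[OF functional_st(5) \<Omega>(2) functional_dom(6) \<Omega>(1)])
  have O: "cs Omega0 \<in> dom T3" using cs_type[of Omega0] by simp
  let ?O = "And (St (C Omega0)) (AllSt ?\<Xi> (Imp (rel M) (AllSt ?\<phi> (Eq (C Omega0 \<cdot> V ?\<phi>) (V ?\<Xi> \<cdot> V ?\<phi>)))))"
  have "wff D (rel M)"
    by (simp add: M_def Let_def modulus_def binary_def seg_def AllSt_def)
  then have "sat e0 ?O"
    by (intro ax[OF RCA0\<Omega>_axiom.Omega0]) (simp_all add: AllSt_def)
  then have "sat (e0(?\<Xi> := ?X)) (rel M) \<longrightarrow> (\<forall>\<phi>\<in>dom T2. st \<phi> \<longrightarrow> cs Omega0 \<odot> \<phi> = ?X \<odot> \<phi>)"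
    using X by simp
  \<comment> \<open>In the relativised \<open>M\<close> minimality is required against standard
    \<open>m\<close> only, which is what \<open>Xi_correct\<close> provides.\<close>
  moreover have "sat (e0(?\<Xi> := ?X)) (rel M)"
    using Xi_correct[OF \<Omega>(1,2) _ _ \<Omega>(3)] by (simp add: sat_rel_M)
  ultimately have O_st: "ModSt \<phi> (cs Omega0 \<odot> \<phi>)" if "\<phi> \<in> dom T2" "st \<phi>" for \<phi>
    using that Xi_correct(1)[OF \<Omega>(1,2) that \<Omega>(3)] by simp
  let ?f = "(2, T1)" and ?g = "(3, T1)" and ?n = "C Omega0 \<cdot> V ?\<phi>"
  \<comment> \<open>Transfer acts on the tuple of the three outer variables; \<open>Omega0\<close>
    is a constant, so no parameter remains. Inside, \<open>binary\<close> keeps its unrestricted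
    quantifier, so the standard instances concern sequences that are binary everywhere, a special
    case of \<open>ModSt\<close>.\<close>
  let ?A = "Imp (And (binary (V ?f)) (binary (V ?g)))
    (Imp (Eq (seg (V ?f) ?n) (seg (V ?g) ?n)) (Eq (V ?\<phi> \<cdot> V ?f) (V ?\<phi> \<cdot> V ?g)))"
  have all: "foldr All [?\<phi>, ?f, ?g] ?A = All ?\<phi> (modulus (V ?\<phi>) ?n)"
    by (simp add: modulus_def Let_def)
  have "sat e0 (Imp (foldr AllSt [?\<phi>, ?f, ?g] ?A) (foldr All [?\<phi>, ?f, ?g] ?A))"
    by (rule ax[OF RCA0\<Omega>_axiom.PF_TP]) (auto simp: Neg_def And_def AllSt_def binary_def seg_def leq_def Let_def)
  moreover have "sat e0 (foldr AllSt [?\<phi>, ?f, ?g] ?A)"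
  proof -
    have "\<phi> \<odot> f = \<phi> \<odot> g" if "\<phi> \<in> dom T2" "st \<phi>" "f \<in> dom T1" "st f" "g \<in> dom T1" "st g" "Bin f" "Bin g"
      "cv segT \<odot> f \<odot> (cs Omega0 \<odot> \<phi>) = cv segT \<odot> g \<odot> (cs Omega0 \<odot> \<phi>)" for \<phi> f g
      by (rule ModStD[OF O_st[OF that(1,2)] that(3,5,4,6) Bin_imp_BinSt[OF that(7)] Bin_imp_BinSt[OF that(8)] that(9)])
    moreover have "sat e0 (foldr AllSt [?\<phi>, ?f, ?g] ?A) \<longleftrightarrow> (\<forall>\<phi>\<in>dom T2. st \<phi> \<longrightarrow> (\<forall>f\<in>dom T1. st f \<longrightarrow>
      (\<forall>g\<in>dom T1. st g \<longrightarrow> Bin f \<and> Bin g \<longrightarrow>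
        cv segT \<odot> f \<odot> (cs Omega0 \<odot> \<phi>) = cv segT \<odot> g \<odot> (cs Omega0 \<odot> \<phi>) \<longrightarrow> \<phi> \<odot> f = \<phi> \<odot> g)))"
      by (simp add: binary_def seg_def Let_def Bin_def)
    ultimately show ?thesis by blast
  qed
  ultimately have "sat e0 (All ?\<phi> (modulus (V ?\<phi>) ?n))" unfolding all sat.simps(4) by blast
  then have "\<forall>\<phi>\<in>dom T2. Mod \<phi> (cs Omega0 \<odot> \<phi>)" by simp
  then show ?thesis unfolding sat_MUC using O by blast
qed

end

lemma wff_principles: "wff D MUC" "wff D \<PP>" "wff D (rel MUC)"
  by (simp_all add: MUC_def \<PP>_def Let_def Ex_def AllSt_def ExSt_def modulus_def binary_def seg_def)

lemma fv_principles: "fv MUC = {}" "fv \<PP> = {}" "fv (rel MUC) = {}"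
  by (auto simp: MUC_def \<PP>_def Let_def Ex_def AllSt_def ExSt_def modulus_def binary_def seg_def)

theorem corollary4p2:
  fixes D :: specs
  assumes "spec_family D"
  shows "RCA0\<Omega>_proves D (And (Iff MUC (rel MUC)) (Iff (rel MUC) \<PP>))"
  unfolding RCA0\<Omega>_proves_def
proof (rule completeness)
  fix dom :: "ty \<Rightarrow> (ty \<times> tm set) set" and ap cs st \<rho>
  assume "model dom ap cs st D"
  then interpret model dom ap cs st D .
  \<comment> \<open>The principles are sentences, so all implications may be read in
    \<open>e0\<close>.\<close>
  have closed: "sat r MUC \<longleftrightarrow> sat e0 MUC" "sat r (rel MUC) \<longleftrightarrow> sat e0 (rel MUC)" "sat r \<PP> \<longleftrightarrow> sat e0 \<PP>" for r
    by (rule sat_cong, simp add: fv_principles)+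
  \<comment> \<open>The implications lead from \<open>MUC\<close> to \<open>\<PP>\<close>, on to
    \<open>rel MUC\<close> and back to \<open>MUC\<close>; this cycle gives both
    biconditionals.\<close>
  show "sat \<rho> (And (Iff MUC (rel MUC)) (Iff (rel MUC) \<PP>))"
    using MUC_PP[of e0] PP_rel_MUC[of e0] rel_MUC_MUC[of e0] closed[of \<rho>] by auto
qed (auto simp: wff_principles fv_principles Iff_def)

end
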